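(* Let $a(z)$, $a_2(z)$, $a_1(z)$ and $a_0(z)\not\equiv 0$ be rational functions, and let $w(z)$ be a transcendental entire solution with $\sigma_2(w)<1$ of the equation $$w(z+1)-w(z-1)+a(z)\frac{w'(z)}{w(z)}=\frac{a_2(z)w(z)^2+a_1(z)w(z)+a_0(z)}{w(z)}.$$ Then (i) $\sigma(w)\ge 1$; (ii) $\Theta(b,w)=0$ provided that $b\in\mathbb{C}$ and $a_2(z)b^2+a_1(z)b+a_0(z)\not\equiv 0$.
   Context: All rational functions of $z$ are over $\mathbb{C}$; $a,a_2,a_1$ may be identically zero. For a meromorphic function $w$ in the complex plane with Nevanlinna characteristic $T(r,w)$, the order is $\sigma(w)=\limsup_{r\to\infty}\frac{\log T(r,w)}{\log r}$ and the hyper-order is $\sigma_2(w)=\limsup_{r\to\infty}\frac{\log\log T(r,w)}{\log r}$. For $b\in\mathbb{C}$, $\Theta(b,w)=1-\limsup_{r\to\infty}\frac{\overline N\left(r,\frac{1}{w-b}\right)}{T(r,w)}$, where $\overline N\left(r,\frac1{w-b}\right)$ is the integrated Nevanlinna counting function of the zeros of $w-b$, each zero counted only once. A solution of the equation is a function satisfying it identically as an identity of meromorphic functions. *)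

theory Defs
  imports "HOL-Complex_Analysis.Complex_Analysis"
begin

(* At zeros of the denominator the quotient takes the value 0 (division by zero in HOL), also where
   the singularity is removable. Identities between rational or meromorphic functions are
   therefore stated up to a sparse set of points, using the cosparse filter. *)
definition rational_function :: "(complex \<Rightarrow> complex) \<Rightarrow> bool" where
  "rational_function f \<longleftrightarrow> (\<exists>p q. q \<noteq> 0 \<and> f = (\<lambda>z. poly p z / poly q z))"

(* For entire f this means: f is not a polynomial. *)
definition transcendental_entire :: "(complex \<Rightarrow> complex) \<Rightarrow> bool" where
  "transcendental_entire f \<longleftrightarrow> f holomorphic_on UNIV \<and> \<not> rational_function f"

definition log_plus :: "real \<Rightarrow> real" where
  "log_plus x = ln (max 1 x)"

definition proximity :: "real \<Rightarrow> (complex \<Rightarrow> complex) \<Rightarrow> real" where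
  "proximity r f =
     1 / (2 * pi) * integral {0..2 * pi} (\<lambda>\<theta>. log_plus (norm (f (of_real r * cis \<theta>))))"

definition pole_count :: "(complex \<Rightarrow> complex) \<Rightarrow> real \<Rightarrow> nat" where
  "pole_count f r = (\<Sum>z | norm z \<le> r \<and> is_pole f z. nat (- zorder f z))"

definition distinct_pole_count :: "(complex \<Rightarrow> complex) \<Rightarrow> real \<Rightarrow> nat" where
  "distinct_pole_count f r = card {z. norm z \<le> r \<and> is_pole f z}"

definition integrated_count :: "(real \<Rightarrow> nat) \<Rightarrow> real \<Rightarrow> real" where
  "integrated_count n r =
     integral {0..r} (\<lambda>t. (real (n t) - real (n 0)) / t) + real (n 0) * ln r"

definition nev_N :: "real \<Rightarrow> (complex \<Rightarrow> complex) \<Rightarrow> real" where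
  "nev_N r f = integrated_count (pole_count f) r"

definition nev_Nbar :: "real \<Rightarrow> (complex \<Rightarrow> complex) \<Rightarrow> real" where
  "nev_Nbar r f = integrated_count (distinct_pole_count f) r"

definition nev_T :: "real \<Rightarrow> (complex \<Rightarrow> complex) \<Rightarrow> real" where
  "nev_T r f = proximity r f + nev_N r f"

(* The next three definitions take values in ereal. They are meant for transcendental f, where the
   characteristic tends to infinity and so the arguments of ln and the denominators are eventually
   positive. *)
definition nev_order :: "(complex \<Rightarrow> complex) \<Rightarrow> ereal" where
  "nev_order f = Limsup at_top (\<lambda>r. ereal (ln (nev_T r f) / ln r))"

definition hyper_order :: "(complex \<Rightarrow> complex) \<Rightarrow> ereal" where
  "hyper_order f = Limsup at_top (\<lambda>r. ereal (ln (ln (nev_T r f)) / ln r))"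

definition nev_Theta :: "complex \<Rightarrow> (complex \<Rightarrow> complex) \<Rightarrow> ereal" where
  "nev_Theta b f =
     1 - Limsup at_top (\<lambda>r. ereal (nev_Nbar r (\<lambda>z. 1 / (f z - b)) / nev_T r f))"

end

theory Submission
  imports Defs
begin

text \<open>
  Clear denominators, so that \<open>q w (w(z+1) - w(z-1)) + A w' = A2 w\<^sup>2 + A1 w + A0\<close> with polynomial
  coefficients, and put \<open>g = w - b\<close>.

  Logarithmic differences: dividing the zeros out of \<open>g\<close> in a disc of radius \<open>R\<close> by Blaschke factors
  leaves a zero-free \<open>G\<close> with \<open>|g| \<le> |G|\<close> inside and equality on the circle. As \<open>ln |G|\<close> is harmonic, its
  mean over \<open>|z| = r\<close> is the mean of \<open>ln |g|\<close> over \<open>|z| = R\<close>, and the Poisson kernel shows that a unit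
  shift of its argument costs only \<open>O(T(R) / (R - r))\<close> on average. Hence the proximity functions of
  \<open>g(z\<plusminus>1)/g\<close> and \<open>g'/g\<close> are at most the increment of the mean of \<open>ln |g|\<close> from \<open>r\<close> to \<open>R\<close> plus \<open>O(T(R) / (R - r))\<close>. For
  \<open>R = r + k\<close> with a large constant \<open>k\<close> this is a small multiple of \<open>T(r)\<close> on a sequence of radii, since
  otherwise \<open>T\<close> would grow exponentially and the hyper-order would be at least 1.

  Ramification: since \<open>b\<close> does not solve the equation, \<open>1/g\<close> has small proximity function, so
  that \<open>g\<close> has almost \<open>T\<close> zeros with multiplicity. The entire function
  \<open>H = A2 w + A1 - q (w(z+1) - w(z-1))\<close> satisfies \<open>H w = A w' - A0\<close> and is therefore small, and
  \<open>H g + (H b + A0) = A g'\<close> shows that a zero of \<open>g\<close> of multiplicity \<open>m\<close> is a zero of \<open>H b + A0\<close> of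
  multiplicity at least \<open>m - 1\<close>. So multiple zeros are rare.

  Order: if the order were less than 1, choose points \<open>z\<close> far out at which a multiple of
  \<open>|z|^p exp (\<epsilon> |z|^\<gamma>)\<close>, \<open>\<gamma> < 1\<close>, touches \<open>|w|\<close> from above. There \<open>z w'/w\<close> is a real number \<open>\<nu>\<close> with
  \<open>\<nu> \<ge> p\<close> and \<open>\<nu> = o(|z|)\<close>, and the equation becomes \<open>2 \<nu> (1 + o(1)) = z A2/q + o(1)\<close>, whose right-hand side
  is either bounded or at least of the size of \<open>|z|\<close>; for large \<open>p\<close> both are impossible.
\<close>

section \<open>Circle means and the Poisson integral\<close>

definition circle_mean :: "real \<Rightarrow> (complex \<Rightarrow> real) \<Rightarrow> real" where
  "circle_mean r u = 1 / (2 * pi) * integral {0..2 * pi} (\<lambda>\<theta>. u (of_real r * cis \<theta>))"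

lemma continuous_on_circle_param:
  fixes u :: "complex \<Rightarrow> 'a::topological_space"
  assumes "continuous_on (sphere 0 r) u" "r \<ge> 0"
  shows "continuous_on A (\<lambda>\<theta>. u (of_real r * cis \<theta>))"
  by (rule continuous_on_compose2[OF assms(1)])
     (use assms(2) in \<open>auto intro!: continuous_intros simp: norm_mult\<close>)

lemma circle_mean_integrable:
  fixes u :: "complex \<Rightarrow> 'a::euclidean_space"
  assumes "continuous_on (sphere 0 r) u" "r \<ge> 0"
  shows "(\<lambda>\<theta>. u (of_real r * cis \<theta>)) integrable_on {0..2 * pi}"
  by (rule integrable_continuous_interval) (rule continuous_on_circle_param[OF assms])

lemma circle_mean_cong:
  assumes "\<And>z. norm z = r \<Longrightarrow> u z = v z" "r \<ge> 0"
  shows "circle_mean r u = circle_mean r v"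
  unfolding circle_mean_def using assms by (auto simp: norm_mult)

lemma circle_mean_const [simp]: "circle_mean r (\<lambda>_. c) = c"
  by (simp add: circle_mean_def)

lemma circle_mean_add:
  assumes "continuous_on (sphere 0 r) u" "continuous_on (sphere 0 r) v" "r \<ge> 0"
  shows "circle_mean r (\<lambda>z. u z + v z) = circle_mean r u + circle_mean r v"
  unfolding circle_mean_def
  by (subst integral_add) (use assms in \<open>auto intro!: circle_mean_integrable simp: ring_distribs\<close>)

lemma circle_mean_diff:
  assumes "continuous_on (sphere 0 r) u" "continuous_on (sphere 0 r) v" "r \<ge> 0"
  shows "circle_mean r (\<lambda>z. u z - v z) = circle_mean r u - circle_mean r v"
  unfolding circle_mean_def
  by (subst integral_diff) (use assms in \<open>auto intro!: circle_mean_integrable simp: right_diff_distrib\<close>)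

lemma circle_mean_cmult: "circle_mean r (\<lambda>z. c * u z) = c * circle_mean r u"
  by (simp add: circle_mean_def)

lemma circle_mean_mono:
  assumes "continuous_on (sphere 0 r) u" "continuous_on (sphere 0 r) v" "r \<ge> 0"
    and "\<And>z. norm z = r \<Longrightarrow> u z \<le> v z"
  shows "circle_mean r u \<le> circle_mean r v"
  unfolding circle_mean_def
  by (intro mult_left_mono integral_le circle_mean_integrable)
     (use assms in \<open>auto simp: norm_mult\<close>)

text \<open>Continuity in the radius lets inequalities proved on zero-free circles pass to arbitrary
  radii by a limit.\<close>

lemma continuous_on_circle_mean_radius:
  assumes "continuous_on UNIV u"
  shows "continuous_on UNIV (\<lambda>r. circle_mean r u)"
proof -
  have "continuous_on UNIV (\<lambda>r. integral (cbox 0 (2*pi)) (\<lambda>\<theta>. u (complex_of_real r * cis \<theta>)))"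
    by (rule integral_continuous_on_param, unfold case_prod_unfold,
        rule continuous_on_compose2[OF assms]) (auto intro!: continuous_intros)
  thus ?thesis unfolding circle_mean_def by (auto intro!: continuous_intros)
qed

text \<open>The parametrization \<open>u = R * cis \<theta>\<close> has differential i u d\<theta>,
  which turns the Cauchy kernel 1/(u - z) into u/(u - z); the factor i cancels.\<close>

lemma Cauchy_integral_circle_mean:
  fixes f :: "complex \<Rightarrow> complex"
  assumes f: "f holomorphic_on ball 0 R'" and "0 < R" "R < R'" "norm z < R"
  shows "((\<lambda>\<theta>. f (of_real R * cis \<theta>) * (of_real R * cis \<theta> / (of_real R * cis \<theta> - z)))
            has_integral (2 * pi * f z)) {0..2 * pi}"
proof -
  have "((\<lambda>u. f u / (u - z)) has_contour_integral 2 * of_real pi * \<i> * f z) (circlepath 0 R)"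
    by (rule Cauchy_integral_circlepath)
       (use assms in \<open>auto intro!: holomorphic_on_imp_continuous_on holomorphic_on_subset[OF f]\<close>)
  hence "((\<lambda>u. f u / (u - z)) has_contour_integral 2 * of_real pi * \<i> * f z) (part_circlepath 0 R 0 (2*pi))"
    by (simp add: circlepath_def)
  hence "((\<lambda>t. f (0 + R * cis t) / (0 + R * cis t - z) * R * \<i> * cis t) has_integral (2 * of_real pi * \<i> * f z)) {0..2*pi}"
    by (subst (asm) has_contour_integral_part_circlepath_iff) auto
  hence "((\<lambda>t. (-\<i>) * (f (0 + R * cis t) / (0 + R * cis t - z) * R * \<i> * cis t)) has_integral (-\<i>) * (2 * of_real pi * \<i> * f z)) {0..2*pi}"
    by (rule has_integral_mult_right)
  thus ?thesis
    by (simp add: mult_ac)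
qed

section \<open>The Poisson kernel and the Poisson formula\<close>

definition poisson_kernel :: "complex \<Rightarrow> complex \<Rightarrow> real" where
  "poisson_kernel \<zeta> z = ((norm \<zeta>)\<^sup>2 - (norm z)\<^sup>2) / (norm (\<zeta> - z))\<^sup>2"

text \<open>As the real part of a function holomorphic in \<open>z\<close> off
  \<open>\<zeta>\<close>, the kernel obeys the mean value property in \<open>z\<close>, and its
  differences reduce to differences of simple fractions.\<close>

lemma poisson_kernel_altdef:
  assumes "\<zeta> \<noteq> z"
  shows "poisson_kernel \<zeta> z = Re ((\<zeta> + z) / (\<zeta> - z))"
  unfolding poisson_kernel_def Re_divide cmod_power2
  by (simp add: power2_eq_square algebra_simps)

lemma poisson_kernel_nonneg: "norm z \<le> norm \<zeta> \<Longrightarrow> poisson_kernel \<zeta> z \<ge> 0"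
  unfolding poisson_kernel_def by (auto intro!: divide_nonneg_nonneg power_mono)

text \<open>The kernel form of Harnack's upper bound: with the denominator replaced by its least
  value, one factor \<open>norm \<zeta> - norm z\<close> cancels.\<close>

lemma poisson_kernel_le:
  assumes "norm z < norm \<zeta>"
  shows "poisson_kernel \<zeta> z \<le> (norm \<zeta> + norm z) / (norm \<zeta> - norm z)"
proof -
  have d: "norm \<zeta> - norm z \<le> norm (\<zeta> - z)" by (rule norm_triangle_ineq2)
  have "poisson_kernel \<zeta> z \<le> ((norm \<zeta>)\<^sup>2 - (norm z)\<^sup>2) / (norm \<zeta> - norm z)\<^sup>2"
    unfolding poisson_kernel_def
    using assms d by (intro divide_left_mono power_mono mult_pos_pos zero_less_power)
      (auto intro!: power_mono)
  also have "\<dots> = (norm \<zeta> + norm z) / (norm \<zeta> - norm z)"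
    using assms by (simp add: power2_eq_square square_diff_square_factored)
  finally show ?thesis .
qed

lemma continuous_on_poisson_kernel:
  assumes "r < R" "0 \<le> r"
  shows "continuous_on (sphere 0 R \<times> sphere 0 r) (\<lambda>(\<zeta>, z). poisson_kernel \<zeta> z)"
  unfolding poisson_kernel_def case_prod_unfold using assms
  by (intro continuous_intros) auto

lemma continuous_on_poisson_kernel_left:
  assumes "norm z < R"
  shows "continuous_on (sphere 0 R) (\<lambda>\<zeta>. poisson_kernel \<zeta> z)"
  unfolding poisson_kernel_def using assms
  by (intro continuous_intros) auto

text \<open>Cauchy's formula is applied to \<open>f\<close> times (R^2 - |z|^2) / (R^2 - cnj z
  \<zeta>), a factor equal to 1 at \<zeta> = z. On the circle R^2 = \<zeta> cnj \<zeta>, so its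
  denominator is \<zeta> cnj (\<zeta> - z), and together with the Cauchy kernel it forms the Poisson
  kernel.\<close>

lemma poisson_formula_complex:
  fixes f :: "complex \<Rightarrow> complex"
  assumes f: "f holomorphic_on ball 0 R'" and R: "0 < R" "R < R'" and z: "norm z < R"
  shows "((\<lambda>\<theta>. f (of_real R * cis \<theta>) * of_real (poisson_kernel (of_real R * cis \<theta>) z))
            has_integral (2 * pi * f z)) {0..2 * pi}"
proof -
  define s where "s = norm z"
  \<comment> \<open>For nonzero \<open>z\<close> the correction factor has its only pole at R^2 /
    cnj z, of modulus R^2 / |z| > R; \<open>R''\<close> keeps the disc free of it.\<close>
  define R'' where "R'' = (if z = 0 then R' else min R' (R\<^sup>2 / norm z))"
  have "R * norm z < R * R" using z R by (intro mult_strict_left_mono) auto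
  hence R'': "R < R''" unfolding R''_def using R by (auto simp: field_simps power2_eq_square)
  have nz: "complex_of_real (R\<^sup>2) - cnj z * \<zeta> \<noteq> 0" if "\<zeta> \<in> ball 0 R''" for \<zeta>
  proof
    assume eq: "complex_of_real (R\<^sup>2) - cnj z * \<zeta> = 0"
    hence "complex_of_real (R\<^sup>2) = cnj z * \<zeta>" by simp
    hence "norm (complex_of_real (R\<^sup>2)) = norm z * norm \<zeta>" by (metis norm_mult complex_mod_cnj)
    hence e: "R\<^sup>2 = norm z * norm \<zeta>" by (simp add: norm_power)
    show False
    proof (cases "z = 0")
      case False
      hence "norm \<zeta> < R\<^sup>2 / norm z" using that by (auto simp: R''_def)
      thus False using e False by (simp add: field_simps)
    qed (use e R in auto)
  qed
  define g where "g = (\<lambda>\<zeta>. f \<zeta> * (of_real (R\<^sup>2 - s\<^sup>2) / (of_real (R\<^sup>2) - cnj z * \<zeta>)))"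
  have "g holomorphic_on ball 0 R''"
    unfolding g_def
    by (intro holomorphic_intros holomorphic_on_subset[OF f] nz) (auto simp: R''_def)
  from Cauchy_integral_circle_mean[OF this R(1) R'' z]
  have *: "((\<lambda>\<theta>. g (of_real R * cis \<theta>) * (of_real R * cis \<theta> / (of_real R * cis \<theta> - z)))
            has_integral (2 * pi * g z)) {0..2 * pi}" .
  have "s < R" using z by (simp add: s_def)
  hence s2: "R\<^sup>2 - s\<^sup>2 \<noteq> 0"
    by (metis R(1) less_irrefl norm_ge_zero power2_eq_imp_eq right_minus_eq s_def less_imp_le)
  have "cnj z * z = of_real (s\<^sup>2)"
    unfolding s_def complex_norm_square by (rule mult.commute)
  hence "of_real (R\<^sup>2) - cnj z * z = complex_of_real (R\<^sup>2 - s\<^sup>2)" by simp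
  hence gz: "g z = f z"
    unfolding g_def using s2 by (metis divide_self mult.right_neutral of_real_eq_0_iff)
  have "g (of_real R * cis \<theta>) * (of_real R * cis \<theta> / (of_real R * cis \<theta> - z)) =
        f (of_real R * cis \<theta>) * of_real (poisson_kernel (of_real R * cis \<theta>) z)" for \<theta>
  proof -
    define \<zeta> where "\<zeta> = of_real R * cis \<theta>"
    have n: "norm \<zeta> = R" using R by (simp add: \<zeta>_def norm_mult)
    have \<zeta>0: "\<zeta> \<noteq> 0" "\<zeta> \<noteq> z" using n R z by auto
    have R2: "complex_of_real (R\<^sup>2) = \<zeta> * cnj \<zeta>" using n by (metis complex_norm_square)
    have nn: "complex_of_real ((norm (\<zeta> - z))\<^sup>2) = (\<zeta> - z) * (cnj \<zeta> - cnj z)"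
      unfolding complex_norm_square by simp
    have "cnj \<zeta> - cnj z \<noteq> 0" using \<zeta>0 by (metis complex_cnj_cancel_iff right_minus_eq)
    have e: "of_real (R\<^sup>2) - cnj z * \<zeta> = \<zeta> * (cnj \<zeta> - cnj z)"
      unfolding R2 by (simp add: algebra_simps)
    have "g \<zeta> * (\<zeta> / (\<zeta> - z)) = f \<zeta> * (of_real (R\<^sup>2 - s\<^sup>2) / ((\<zeta> - z) * (cnj \<zeta> - cnj z)))"
    proof -
      have "x * (c / (\<zeta> * d)) * (\<zeta> / e) = x * (c / (e * d))" for x c d e :: complex
        using \<zeta>0(1) by (simp add: mult.commute)
      thus ?thesis unfolding g_def e .
    qed
    also have "\<dots> = f \<zeta> * of_real (poisson_kernel \<zeta> z)"
      unfolding poisson_kernel_def n s_def[symmetric] of_real_divide nn ..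
    finally show ?thesis unfolding \<zeta>_def .
  qed
  with * gz show ?thesis by simp
qed

lemma poisson_formula:
  assumes f: "f holomorphic_on ball 0 R'" and R: "0 < R" "R < R'" and z: "norm z < R"
  shows "circle_mean R (\<lambda>\<zeta>. Re (f \<zeta>) * poisson_kernel \<zeta> z) = Re (f z)"
proof -
  have "((\<lambda>\<theta>. Re (f (of_real R * cis \<theta>) * of_real (poisson_kernel (of_real R * cis \<theta>) z)))
            has_integral Re (2 * pi * f z)) {0..2 * pi}"
    using has_integral_linear[OF poisson_formula_complex[OF assms] bounded_linear_Re]
    by (simp add: o_def)
  hence "integral {0..2*pi} (\<lambda>\<theta>. Re (f (of_real R * cis \<theta>)) * poisson_kernel (of_real R * cis \<theta>) z)
           = 2 * pi * Re (f z)"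
    by (intro integral_unique) simp
  thus ?thesis by (simp add: circle_mean_def)
qed

lemma mean_value_Re:
  assumes f: "f holomorphic_on ball 0 R'" and R: "0 < R" "R < R'"
  shows "circle_mean R (\<lambda>\<zeta>. Re (f \<zeta>)) = Re (f 0)"
proof -
  have "circle_mean R (\<lambda>\<zeta>. Re (f \<zeta>) * poisson_kernel \<zeta> 0) = circle_mean R (\<lambda>\<zeta>. Re (f \<zeta>))"
    by (rule circle_mean_cong) (use R in \<open>auto simp: poisson_kernel_def\<close>)
  with poisson_formula[OF assms, of 0] R show ?thesis by simp
qed

text \<open>The mean is over the interior variable: the kernel is there the real part of a
  holomorphic function with value 1 at the origin.\<close>

lemma circle_mean_poisson_kernel_right:
  assumes "0 < r" "r < norm \<zeta>"
  shows "circle_mean r (\<lambda>z. poisson_kernel \<zeta> z) = 1"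
proof -
  have "circle_mean r (\<lambda>z. poisson_kernel \<zeta> z) = circle_mean r (\<lambda>z. Re ((\<zeta> + z) / (\<zeta> - z)))"
    by (rule circle_mean_cong) (use assms in \<open>auto intro!: poisson_kernel_altdef\<close>)
  also have "\<dots> = Re ((\<zeta> + 0) / (\<zeta> - 0))"
    by (rule mean_value_Re[where R' = "norm \<zeta>"]) (use assms in \<open>auto intro!: holomorphic_intros\<close>)
  finally show ?thesis using assms by auto
qed

lemma circle_mean_swap:
  assumes k: "continuous_on (sphere 0 R \<times> sphere 0 r) (\<lambda>(\<zeta>, z). k \<zeta> z)" and "0 \<le> R" "0 \<le> r"
  shows "circle_mean r (\<lambda>z. circle_mean R (\<lambda>\<zeta>. k \<zeta> z)) = circle_mean R (\<lambda>\<zeta>. circle_mean r (\<lambda>z. k \<zeta> z))"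
    and "continuous_on (sphere 0 r) (\<lambda>z. circle_mean R (\<lambda>\<zeta>. k \<zeta> z))"
proof -
  have c: "continuous_on (cbox (0, 0) (2*pi, 2*pi))
     (\<lambda>(\<theta>, \<phi>). k (of_real R * cis \<phi>) (of_real r * cis \<theta>))"
    unfolding case_prod_unfold
    by (rule continuous_on_compose2[OF k, of _ "\<lambda>x. (of_real R * cis (snd x), of_real r * cis (fst x))",
          unfolded case_prod_unfold fst_conv snd_conv])
       (use assms in \<open>auto intro!: continuous_intros simp: norm_mult\<close>)
  show "circle_mean r (\<lambda>z. circle_mean R (\<lambda>\<zeta>. k \<zeta> z)) = circle_mean R (\<lambda>\<zeta>. circle_mean r (\<lambda>z. k \<zeta> z))"
    unfolding circle_mean_def using integral_swap_continuous[OF c] by simp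
  have "continuous_on (sphere 0 r) (\<lambda>z. integral (cbox 0 (2*pi)) (\<lambda>\<phi>. k (of_real R * cis \<phi>) z))"
    by (rule integral_continuous_on_param, unfold case_prod_unfold,
        rule continuous_on_compose2[OF k, of _ "\<lambda>x. (of_real R * cis (snd x), fst x)",
          unfolded case_prod_unfold fst_conv snd_conv])
       (use assms in \<open>auto intro!: continuous_intros simp: norm_mult\<close>)
  thus "continuous_on (sphere 0 r) (\<lambda>z. circle_mean R (\<lambda>\<zeta>. k \<zeta> z))"
    unfolding circle_mean_def by (auto intro!: continuous_intros)
qed

section \<open>Poisson integrals of boundary data\<close>

definition poisson_integral :: "real \<Rightarrow> (complex \<Rightarrow> real) \<Rightarrow> complex \<Rightarrow> real" where
  "poisson_integral R v z = circle_mean R (\<lambda>\<zeta>. v \<zeta> * poisson_kernel \<zeta> z)"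

text \<open>The order of the two means is exchanged, and the kernel has mean 1 in its interior
  variable. Taking Poisson integrals therefore preserves means exactly.\<close>

lemma
  assumes v: "continuous_on (sphere 0 R) v" and r: "0 < r" "r < R"
  shows circle_mean_poisson_integral: "circle_mean r (poisson_integral R v) = circle_mean R v"
    and continuous_on_poisson_integral: "continuous_on (sphere 0 r) (poisson_integral R v)"
proof -
  have k: "continuous_on (sphere 0 R \<times> sphere 0 r) (\<lambda>(\<zeta>, z). v \<zeta> * poisson_kernel \<zeta> z)"
    using continuous_on_poisson_kernel[of r R] r unfolding case_prod_unfold
    by (intro continuous_on_mult continuous_on_compose2[OF v]) (auto intro!: continuous_intros)
  have "circle_mean r (poisson_integral R v) =
          circle_mean R (\<lambda>\<zeta>. v \<zeta> * circle_mean r (poisson_kernel \<zeta>))"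
    unfolding poisson_integral_def
    using circle_mean_swap(1)[OF k] r by (simp add: circle_mean_cmult)
  also have "\<dots> = circle_mean R v"
    by (rule circle_mean_cong) (use r in \<open>auto simp: circle_mean_poisson_kernel_right\<close>)
  finally show "circle_mean r (poisson_integral R v) = circle_mean R v" .
  show "continuous_on (sphere 0 r) (poisson_integral R v)"
    unfolding poisson_integral_def using circle_mean_swap(2)[OF k] r by simp
qed

lemma poisson_integral_mono:
  assumes "continuous_on (sphere 0 R) v" "continuous_on (sphere 0 R) v'" "norm z < R"
    and "\<And>\<zeta>. norm \<zeta> = R \<Longrightarrow> v \<zeta> \<le> v' \<zeta>"
  shows "poisson_integral R v z \<le> poisson_integral R v' z"
  unfolding poisson_integral_def
  by (rule circle_mean_mono)
     (use assms norm_ge_zero[of z] in \<open>auto intro!: continuous_intros continuous_on_poisson_kernel_left mult_right_mono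
        poisson_kernel_nonneg simp del: norm_ge_zero\<close>)

lemma poisson_integral_le:
  assumes v: "continuous_on (sphere 0 R) v" "norm z < R"
    and nn: "\<And>\<zeta>. norm \<zeta> = R \<Longrightarrow> 0 \<le> v \<zeta>"
  shows "poisson_integral R v z \<le> (R + norm z) / (R - norm z) * circle_mean R v"
proof -
  have R: "R \<ge> 0" using assms(2) norm_ge_zero[of z] by linarith
  have "poisson_integral R v z \<le> circle_mean R (\<lambda>\<zeta>. (R + norm z) / (R - norm z) * v \<zeta>)"
    unfolding poisson_integral_def
  proof (rule circle_mean_mono)
    fix \<zeta> :: complex assume \<zeta>: "norm \<zeta> = R"
    show "v \<zeta> * poisson_kernel \<zeta> z \<le> (R + norm z) / (R - norm z) * v \<zeta>"
      using mult_left_mono[OF poisson_kernel_le[of z \<zeta>] nn[OF \<zeta>]] \<zeta> assms(2) by (simp add: mult.commute)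
  qed (use v R in \<open>auto intro!: continuous_intros continuous_on_poisson_kernel_left\<close>)
  thus ?thesis unfolding circle_mean_cmult .
qed

text \<open>The shift changes (\<zeta> + z) / (\<zeta> - z) by 2 \<zeta> h / ((\<zeta> - z - h)
  (\<zeta> - z)). Since |\<zeta> - z| is at least 2, the shifted factor keeps half its size, and the
  change of the kernel is small relative to the kernel itself. The error can thus be integrated
  against \<open>\<bar>v\<bar>\<close>.\<close>

lemma poisson_integral_shift:
  assumes v: "continuous_on (sphere 0 R) v" and z: "norm z + 2 \<le> R" and h: "norm h \<le> 1"
  shows "poisson_integral R v (z + h) \<le>
           poisson_integral R v z + 4 / (R - norm z) * poisson_integral R (\<lambda>\<zeta>. \<bar>v \<zeta>\<bar>) z"
proof -
  have zh: "norm (z + h) < R" using norm_triangle_ineq[of z h] z h by linarith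
  have zR: "norm z < R" using z by linarith
  have R0: "R > 0" using zR norm_ge_zero[of z] by linarith
  \<comment> \<open>Chosen so that C (R^2 - |z|^2) = 4 (R + |z|), which dominates the 4 R of the
    estimate below.\<close>
  define C where "C = 4 / (R - norm z)"
  have key: "\<bar>poisson_kernel \<zeta> (z + h) - poisson_kernel \<zeta> z\<bar> \<le> C * poisson_kernel \<zeta> z"
    if \<zeta>: "norm \<zeta> = R" for \<zeta>
  proof -
    have ne: "\<zeta> \<noteq> z" "\<zeta> \<noteq> z + h" using \<zeta> zh zR by auto
    have d: "norm (\<zeta> - z) \<ge> 2" using norm_triangle_ineq2[of \<zeta> z] \<zeta> z by linarith
    have "norm (\<zeta> - (z + h)) \<ge> norm (\<zeta> - z) - norm h"
      using norm_triangle_ineq2[of "\<zeta> - z" h] by (simp add: algebra_simps)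
    hence d2: "norm (\<zeta> - (z + h)) \<ge> norm (\<zeta> - z) / 2" using d h by linarith
    have "(\<zeta> + (z + h)) / (\<zeta> - (z + h)) - (\<zeta> + z) / (\<zeta> - z) = 2 * \<zeta> * h / ((\<zeta> - (z + h)) * (\<zeta> - z))"
      using ne by (simp add: divide_simps) (simp add: algebra_simps)
    hence "\<bar>poisson_kernel \<zeta> (z + h) - poisson_kernel \<zeta> z\<bar> = \<bar>Re (2 * \<zeta> * h / ((\<zeta> - (z + h)) * (\<zeta> - z)))\<bar>"
      using ne by (simp add: poisson_kernel_altdef flip: minus_complex.sel)
    also have "\<dots> \<le> norm (2 * \<zeta> * h / ((\<zeta> - (z + h)) * (\<zeta> - z)))" by (rule abs_Re_le_cmod)
    also have "\<dots> = 2 * R * norm h / (norm (\<zeta> - (z + h)) * norm (\<zeta> - z))"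
      by (simp add: norm_mult norm_divide \<zeta>)
    also have "\<dots> \<le> 2 * R * 1 / (norm (\<zeta> - z) / 2 * norm (\<zeta> - z))"
      using d d2 h R0 by (intro frac_le mult_mono mult_pos_pos) auto
    also have "\<dots> = 4 * R / (norm (\<zeta> - z))\<^sup>2" by (simp add: power2_eq_square)
    also have "\<dots> \<le> C * (R\<^sup>2 - (norm z)\<^sup>2) / (norm (\<zeta> - z))\<^sup>2"
    proof (intro divide_right_mono)
      have "C * (R\<^sup>2 - (norm z)\<^sup>2) = 4 * (R + norm z)"
        unfolding C_def using zR by (simp add: power2_eq_square field_simps)
      thus "4 * R \<le> C * (R\<^sup>2 - (norm z)\<^sup>2)" by simp
    qed auto
    finally show ?thesis by (simp add: poisson_kernel_def \<zeta>)
  qed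
  have cont: "continuous_on (sphere 0 R) (\<lambda>\<zeta>. \<bar>v \<zeta>\<bar>)" using v by (intro continuous_intros)
  have "poisson_integral R v (z + h) \<le> circle_mean R (\<lambda>\<zeta>. v \<zeta> * poisson_kernel \<zeta> z + C * (\<bar>v \<zeta>\<bar> * poisson_kernel \<zeta> z))"
    unfolding poisson_integral_def
  proof (rule circle_mean_mono)
    fix \<zeta> :: complex assume \<zeta>: "norm \<zeta> = R"
    have "v \<zeta> * poisson_kernel \<zeta> (z + h) - v \<zeta> * poisson_kernel \<zeta> z \<le>
            \<bar>v \<zeta> * (poisson_kernel \<zeta> (z + h) - poisson_kernel \<zeta> z)\<bar>" by (simp add: algebra_simps)
    also have "\<dots> \<le> \<bar>v \<zeta>\<bar> * (C * poisson_kernel \<zeta> z)"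
      unfolding abs_mult using key[OF \<zeta>] by (intro mult_left_mono) auto
    finally show "v \<zeta> * poisson_kernel \<zeta> (z + h) \<le> v \<zeta> * poisson_kernel \<zeta> z + C * (\<bar>v \<zeta>\<bar> * poisson_kernel \<zeta> z)"
      by (simp add: mult_ac)
  qed (use v R0 cont zh zR in \<open>auto intro!: continuous_intros continuous_on_poisson_kernel_left\<close>)
  also have "\<dots> = poisson_integral R v z + C * poisson_integral R (\<lambda>\<zeta>. \<bar>v \<zeta>\<bar>) z"
    unfolding poisson_integral_def
    by (subst circle_mean_add)
       (use v R0 cont zR in \<open>auto intro!: continuous_intros continuous_on_poisson_kernel_left simp: circle_mean_cmult\<close>)
  finally show ?thesis unfolding C_def .
qed

section \<open>Zeros of entire functions\<close>

text \<open>At every point an entire function that is not identically zero has nonnegative order, so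
  \<open>nat\<close> loses nothing there.\<close>

definition zmult :: "(complex \<Rightarrow> complex) \<Rightarrow> complex \<Rightarrow> nat" where
  "zmult g a = nat (zorder g a)"

lemma zmult_eqI:
  assumes "k holomorphic_on UNIV" "k a \<noteq> 0" "\<And>z. g z = (z - a) ^ n * k z"
  shows "zmult g a = n"
proof -
  have "zorder g a = int n"
    by (rule zorder_eqI[where S = UNIV and g = k]) (use assms(1,2) in \<open>auto simp: assms(3)\<close>)
  thus ?thesis by (simp add: zmult_def)
qed

text \<open>The local cofactor given by the order is glued to the quotient by the power of
  \<open>z - a\<close>, which is holomorphic off \<open>a\<close>; the two agree near
  \<open>a\<close> and give one entire cofactor.\<close>

lemma zmult_factor:
  assumes g: "g holomorphic_on UNIV" and nz: "g w0 \<noteq> 0"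
  obtains k where "k holomorphic_on UNIV" "k a \<noteq> 0" "\<And>z. g z = (z - a) ^ zmult g a * k z"
proof -
  define n where "n = zmult g a"
  define p where "p = zor_poly g a"
  obtain r where r: "r > 0" "p holomorphic_on cball a r"
      "\<And>w. w \<in> cball a r \<Longrightarrow> g w = p w * (w - a) ^ n \<and> p w \<noteq> 0"
    using zorder_exist_zero[OF g open_UNIV connected_UNIV UNIV_I, of a] nz
    unfolding n_def zmult_def p_def by blast
  define k where "k = (\<lambda>z. if z = a then p a else g z / (z - a) ^ n)"
  have kp: "k z = p z" if "z \<in> ball a r" for z
    unfolding k_def using r(3)[of z] that by auto
  have "k holomorphic_on (UNIV - {a})"
    unfolding k_def
    by (rule holomorphic_transform[of "\<lambda>z. g z / (z - a) ^ n"])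
       (auto intro!: holomorphic_intros holomorphic_on_subset[OF g])
  moreover have "k holomorphic_on ball a r"
    by (rule holomorphic_transform[of p]) (use r(2) kp in \<open>auto intro: holomorphic_on_subset\<close>)
  ultimately have "k holomorphic_on (UNIV - {a}) \<union> ball a r"
    by (intro holomorphic_on_Un) auto
  also have "(UNIV - {a}) \<union> ball a r = UNIV" using r(1) by auto
  finally have hol: "k holomorphic_on UNIV" .
  have ka: "k a \<noteq> 0" unfolding k_def using r(1) r(3)[of a] by auto
  have "g z = (z - a) ^ n * k z" for z
    using r(1) r(3)[of a] by (cases "z = a") (auto simp: k_def)
  with hol ka show ?thesis unfolding n_def by (rule that)
qed

lemma zmult_zero_iff:
  assumes g: "g holomorphic_on UNIV" and nz: "g w0 \<noteq> 0"
  shows "zmult g a = 0 \<longleftrightarrow> g a \<noteq> 0"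
proof -
  obtain k where "k holomorphic_on UNIV" "k a \<noteq> 0" "\<And>z. g z = (z - a) ^ zmult g a * k z"
    using zmult_factor[OF g nz] by blast
  from this(2) this(3)[of a] show ?thesis by simp
qed

text \<open>The cofactor may itself vanish at \<open>a\<close>; its order is then added to
  \<open>n\<close>.\<close>

lemma zmult_ge:
  assumes f: "f holomorphic_on UNIV" and nz: "f w0 \<noteq> 0"
    and k: "k holomorphic_on UNIV" and eq: "\<And>z. f z = (z - a) ^ n * k z"
  shows "zmult f a \<ge> n"
proof -
  have "k w0 \<noteq> 0" using nz eq by auto
  then obtain l where l: "l holomorphic_on UNIV" "l a \<noteq> 0" "\<And>z. k z = (z - a) ^ zmult k a * l z"
    using zmult_factor[OF k] by blast
  have "zmult f a = n + zmult k a"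
  proof (rule zmult_eqI[OF l(1,2)])
    show "f z = (z - a) ^ (n + zmult k a) * l z" for z
      using eq[of z] l(3)[of z] by (simp add: power_add mult_ac)
  qed
  thus ?thesis by simp
qed

lemma finite_zeros:
  assumes g: "g holomorphic_on UNIV" and nz: "g w0 \<noteq> 0"
  shows "finite {z. norm z \<le> r \<and> g z = 0}"
proof (cases "g constant_on UNIV")
  case True
  hence "g z \<noteq> 0" for z using nz by (auto simp: constant_on_def)
  thus ?thesis by simp
next
  case False
  from holomorphic_compact_finite_zeros[OF g open_UNIV connected_UNIV compact_cball[of 0 r] subset_UNIV False]
  show ?thesis by (simp add: conj_commute)
qed

lemma factor_finite_zeros:
  assumes "finite Z" and g: "g holomorphic_on UNIV" and nz: "g w0 \<noteq> 0"
  shows "\<exists>F. F holomorphic_on UNIV \<and> (\<forall>z. g z = F z * (\<Prod>a\<in>Z. (z - a) ^ zmult g a)) \<and> (\<forall>z\<in>Z. F z \<noteq> 0)"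
  using \<open>finite Z\<close>
proof (induction Z rule: finite_induct)
  case empty
  show ?case using g by auto
next
  case (insert b Z)
  then obtain F where F: "F holomorphic_on UNIV" "\<And>z. g z = F z * (\<Prod>a\<in>Z. (z - a) ^ zmult g a)"
    "\<And>z. z \<in> Z \<Longrightarrow> F z \<noteq> 0" by blast
  have "F w0 \<noteq> 0" using nz F(2) by auto
  then obtain k where k: "k holomorphic_on UNIV" "k b \<noteq> 0" "\<And>z. F z = (z - b) ^ zmult F b * k z"
    using zmult_factor[OF F(1)] by blast
  \<comment> \<open>The factors removed so far do not vanish at the new point \<open>b\<close>, so
    they leave the order there unchanged.\<close>
  have "zmult g b = zmult F b"
  proof (rule zmult_eqI)
    show "(\<lambda>z. k z * (\<Prod>a\<in>Z. (z - a) ^ zmult g a)) holomorphic_on UNIV"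
      by (intro holomorphic_intros k)
    show "k b * (\<Prod>a\<in>Z. (b - a) ^ zmult g a) \<noteq> 0"
      using k(2) insert.hyps by auto
    show "g z = (z - b) ^ zmult F b * (k z * (\<Prod>a\<in>Z. (z - a) ^ zmult g a))" for z
      using F(2)[of z] k(3)[of z] by (simp add: mult_ac)
  qed
  hence "\<forall>z. g z = k z * (\<Prod>a\<in>insert b Z. (z - a) ^ zmult g a)"
    using F(2) k(3) insert.hyps by (simp add: mult_ac)
  moreover have "\<forall>z\<in>insert b Z. k z \<noteq> 0"
    using k(2,3) F(3) by (metis insert_iff mult_zero_right)
  ultimately show ?case using k(1) by blast
qed

text \<open>Both claims come from the identity |r^2 - cnj a z|^2 = r^2 |z - a|^2 + (r^2 - |z|^2)
  (r^2 - |a|^2), whose last term vanishes on the circle and is nonnegative inside.\<close>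

lemma norm_blaschke:
  fixes a z :: complex
  assumes r: "r > 0" and a: "norm a < r"
  shows "norm z = r \<Longrightarrow> norm (of_real r - cnj a * z / of_real r) = norm (z - a)"
    and "norm z \<le> r \<Longrightarrow> norm (z - a) \<le> norm (of_real r - cnj a * z / of_real r)"
proof -
  have "of_real r - cnj a * z / of_real r = (of_real (r * r) - cnj a * z) / of_real r"
    using r by (simp add: diff_divide_distrib)
  hence n: "norm (of_real r - cnj a * z / of_real r) = norm (of_real (r * r) - cnj a * z) / r"
    using r by (simp only: norm_divide norm_of_real abs_of_pos)
  have *: "(norm (of_real (r * r) - cnj a * z))\<^sup>2 = (r * norm (z - a))\<^sup>2 +
          (r\<^sup>2 - (norm z)\<^sup>2) * (r\<^sup>2 - (norm a)\<^sup>2)"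
    unfolding power_mult_distrib cmod_power2 by (simp add: power2_eq_square algebra_simps)
  show "norm (of_real r - cnj a * z / of_real r) = norm (z - a)" if z: "norm z = r"
  proof -
    have "norm (of_real (r * r) - cnj a * z) = r * norm (z - a)"
      by (rule power2_eq_imp_eq) (use r in \<open>simp_all only: * z, simp_all\<close>)
    thus ?thesis unfolding n using r by simp
  qed
  show "norm (z - a) \<le> norm (of_real r - cnj a * z / of_real r)" if z: "norm z \<le> r"
  proof -
    have "0 \<le> (r\<^sup>2 - (norm z)\<^sup>2) * (r\<^sup>2 - (norm a)\<^sup>2)"
      using z a by (intro mult_nonneg_nonneg) (auto intro!: power_mono)
    hence "r * norm (z - a) \<le> norm (of_real (r * r) - cnj a * z)"
      unfolding le_add_same_cancel1[of "(r * norm (z - a))\<^sup>2", symmetric] *[symmetric]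
      by (rule power2_le_imp_le) simp
    thus ?thesis unfolding n using r by (simp add: pos_le_divide_eq mult.commute)
  qed
qed

lemma ln_mult_prod_power:
  fixes c :: "'a \<Rightarrow> real"
  assumes "finite Z" "x > 0" "\<And>a. a \<in> Z \<Longrightarrow> c a > 0"
  shows "ln (x * (\<Prod>a\<in>Z. c a ^ n a)) = ln x + (\<Sum>a\<in>Z. real (n a) * ln (c a))"
  using assms(1,3)
proof (induction Z rule: finite_induct)
  case (insert b Z)
  have pos: "c b > 0" "(\<Prod>a\<in>Z. c a ^ n a) > 0" using insert.prems by (auto intro!: prod_pos)
  have "ln (x * (\<Prod>a\<in>insert b Z. c a ^ n a)) = ln (c b ^ n b * (x * (\<Prod>a\<in>Z. c a ^ n a)))"
    using insert.hyps by (simp add: mult_ac)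
  also have "\<dots> = real (n b) * ln (c b) + ln (x * (\<Prod>a\<in>Z. c a ^ n a))"
    using pos assms(2) by (subst ln_mult) (auto simp: ln_realpow)
  finally show ?case using insert by simp
qed simp

text \<open>Cancelling a power of \<open>z - a\<close> gives an identity only off \<open>a\<close>;
  continuity supplies the value at \<open>a\<close>.\<close>

lemma continuous_eq_at_point:
  fixes f g :: "complex \<Rightarrow> complex"
  assumes "continuous_on UNIV f" "continuous_on UNIV g" "\<And>z. z \<noteq> a \<Longrightarrow> f z = g z"
  shows "f a = g a"
proof -
  have "f \<midarrow>a\<rightarrow> f a" "g \<midarrow>a\<rightarrow> g a"
    using assms(1,2) by (simp_all add: continuous_on_def)
  moreover have "f \<midarrow>a\<rightarrow> g a \<longleftrightarrow> g \<midarrow>a\<rightarrow> g a"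
    by (rule LIM_cong) (use assms(3) in auto)
  ultimately show ?thesis using LIM_unique by blast
qed

text \<open>Reflecting every factor \<open>z - a\<close> with \<open>norm a < r\<close> to \<open>r - cnj a * z / r\<close> removes the zeros
  of \<open>g\<close> from the disc without changing its modulus on the circle; \<open>f\<close> is a logarithm of the
  resulting function. A zero at the origin contributes \<open>ln r\<close>, because \<open>ln 0 = 0\<close> in HOL.\<close>

lemma log_majorant:
  assumes g: "g holomorphic_on UNIV" and nz: "g w0 \<noteq> 0"
  obtains C where "\<And>r. r > 0 \<Longrightarrow> (\<And>z. norm z = r \<Longrightarrow> g z \<noteq> 0) \<Longrightarrow>
     \<exists>f R'. f holomorphic_on ball 0 R' \<and> r < R' \<and>
       (\<forall>z. norm z = r \<longrightarrow> ln (norm (g z)) = Re (f z)) \<and>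
       (\<forall>z. norm z \<le> r \<longrightarrow> norm (g z) \<le> exp (Re (f z))) \<and>
       Re (f 0) = C + (\<Sum>a | norm a \<le> r \<and> g a = 0. real (zmult g a) * (ln r - ln (norm a)))"
proof -
  obtain g0 where g0: "g0 holomorphic_on UNIV" "g0 0 \<noteq> 0" "\<And>z. g z = (z - 0) ^ zmult g 0 * g0 z"
    using zmult_factor[OF g nz] by blast
  show ?thesis
  \<comment> \<open>\<open>g0 0\<close> is the first nonzero Taylor coefficient of \<open>g\<close>
    at the origin, so the constant does not depend on \<open>r\<close>.\<close>
  proof (rule that[of "ln (norm (g0 0))"])
    fix r :: real assume r: "r > 0" and circ: "\<And>z. norm z = r \<Longrightarrow> g z \<noteq> 0"
    define Z where "Z = {a. norm a \<le> r \<and> g a = 0}"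
    have Z: "finite Z" unfolding Z_def by (rule finite_zeros[OF g nz])
    have Zr: "norm a < r" if "a \<in> Z" for a
      using that circ[of a] by (cases "norm a = r") (auto simp: Z_def)
    obtain F where F: "F holomorphic_on UNIV" "\<And>z. g z = F z * (\<Prod>a\<in>Z. (z - a) ^ zmult g a)"
      "\<And>z. z \<in> Z \<Longrightarrow> F z \<noteq> 0"
      using factor_finite_zeros[OF Z g nz] by blast
    define G where "G = (\<lambda>z. F z * (\<Prod>a\<in>Z. (of_real r - cnj a * z / of_real r) ^ zmult g a))"
    have G: "G holomorphic_on UNIV" unfolding G_def using r by (intro holomorphic_intros F) auto
    have Feq0: "F z \<noteq> 0" if "norm z \<le> r" for z
      using F(2)[of z] F(3)[of z] that Z_def by auto
    have refl_nz: "of_real r - cnj a * z / of_real r \<noteq> 0" if "a \<in> Z" "norm z \<le> r" for a z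
    proof
      assume e: "of_real r - cnj a * z / of_real r = 0"
      hence "norm (z - a) = 0" using norm_blaschke(2)[OF r Zr[OF that(1)] that(2)] by simp
      hence "z = a" by simp
      with e have "of_real r * of_real r = cnj a * a" using r by (simp add: field_simps)
      hence "of_real (r * r) = complex_of_real ((norm a)\<^sup>2)"
        by (metis complex_norm_square mult.commute of_real_mult)
      hence "r\<^sup>2 = (norm a)\<^sup>2" by (metis of_real_eq_iff power2_eq_square)
      thus False using Zr[OF that(1)] r by (simp add: power2_eq_iff_nonneg)
    qed
    have Gnz: "G z \<noteq> 0" if "norm z \<le> r" for z
      unfolding G_def using that Feq0 refl_nz Z by auto
    have Gcirc: "norm (G z) = norm (g z)" if "norm z = r" for z
      unfolding G_def F(2)[of z] norm_mult prod_norm[symmetric] norm_power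
      using norm_blaschke(1)[OF r Zr that] by (intro arg_cong2[where f = "(*)"] prod.cong) auto
    have Gle: "norm (g z) \<le> norm (G z)" if "norm z \<le> r" for z
      unfolding G_def F(2)[of z] norm_mult prod_norm[symmetric] norm_power
      using norm_blaschke(2)[OF r Zr that] by (intro mult_left_mono prod_mono conjI power_mono) auto
    \<comment> \<open>The logarithm is needed on an open disc containing the closed one, so absence
      of zeros is first extended to a neighbourhood of uniform width, by compactness.\<close>
    have "open {z. G z \<noteq> 0}"
      using G by (intro open_Collect_neq holomorphic_on_imp_continuous_on holomorphic_intros)
    then obtain \<epsilon> where \<epsilon>: "\<epsilon> > 0" "(\<Union>x\<in>cball 0 r. ball x \<epsilon>) \<subseteq> {z. G z \<noteq> 0}"
      using compact_subset_open_imp_ball_epsilon_subset[of "cball 0 r" "{z. G z \<noteq> 0}"] Gnz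
      by (auto simp: subset_iff)
    have Gnz': "G z \<noteq> 0" if "z \<in> ball 0 (r + \<epsilon>)" for z
    proof (cases "norm z \<le> r")
      case False
      \<comment> \<open>The radial projection of \<open>z\<close> to the circle, at distance
        \<open>norm z - r\<close> < \<open>\<epsilon>\<close> from \<open>z\<close>.\<close>
      define x where "x = of_real (r / norm z) * z"
      have z0: "norm z > 0" using False r by linarith
      hence "norm x = r" using r by (simp add: x_def norm_mult norm_divide)
      moreover have "x - z = of_real (r / norm z - 1) * z" by (simp add: x_def algebra_simps)
      hence "norm (x - z) = \<bar>r / norm z - 1\<bar> * norm z" by (metis norm_mult norm_of_real)
      hence "norm (x - z) = norm z - r"
        using False r z0 by (simp only: abs_if divide_less_eq diff_less_0_iff_less) (simp add: field_simps)
      ultimately have "x \<in> cball 0 r" "z \<in> ball x \<epsilon>" using that by (auto simp: dist_norm)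
      thus ?thesis using \<epsilon>(2) by blast
    qed (use Gnz in auto)
    obtain f where f: "f holomorphic_on ball 0 (r + \<epsilon>)" "\<And>z. z \<in> ball 0 (r + \<epsilon>) \<Longrightarrow> G z = exp (f z)"
    proof (rule contractible_imp_holomorphic_log[of G "ball 0 (r + \<epsilon>)"])
      show "G holomorphic_on ball 0 (r + \<epsilon>)" by (rule holomorphic_on_subset[OF G]) auto
    qed (use Gnz' in \<open>auto intro: convex_imp_contractible\<close>)
    have nf: "norm (G z) = exp (Re (f z))" if "norm z \<le> r" for z
      using f(2)[of z] that \<epsilon>(1) by simp
    \<comment> \<open>When 0 is a zero of \<open>g\<close>, both factorizations contain the same
      power of \<open>z\<close>. It is cancelled off the origin, and the value at the origin follows
      by continuity.\<close>
    have "g0 0 = F 0 * (\<Prod>a\<in>Z - {0}. (0 - a) ^ zmult g a)"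
    proof (rule continuous_eq_at_point[where f = g0 and
            g = "\<lambda>z. F z * (\<Prod>a\<in>Z - {0}. (z - a) ^ zmult g a)" and a = 0])
      show "continuous_on UNIV g0" by (intro holomorphic_on_imp_continuous_on g0)
      show "continuous_on UNIV (\<lambda>z. F z * (\<Prod>a\<in>Z - {0}. (z - a) ^ zmult g a))"
        by (intro holomorphic_on_imp_continuous_on holomorphic_intros F)
      fix z :: complex assume z: "z \<noteq> 0"
      have "(\<Prod>a\<in>Z. (z - a) ^ zmult g a) = (z - 0) ^ zmult g 0 * (\<Prod>a\<in>Z - {0}. (z - a) ^ zmult g a)"
      proof (cases "0 \<in> Z")
        case True
        show ?thesis by (rule prod.remove[OF Z True])
      next
        case False
        hence "g 0 \<noteq> 0" using r by (auto simp: Z_def)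
        hence "zmult g 0 = 0" using zmult_zero_iff[OF g nz] by simp
        thus ?thesis using False by simp
      qed
      with F(2)[of z] g0(3)[of z] z
      show "g0 z = F z * (\<Prod>a\<in>Z - {0}. (z - a) ^ zmult g a)" by simp
    qed
    hence "ln (norm (g0 0)) = ln (norm (F 0) * (\<Prod>a\<in>Z - {0}. norm a ^ zmult g a))"
      by (simp add: norm_mult prod_norm[symmetric] norm_power)
    also have "\<dots> = ln (norm (F 0)) + (\<Sum>a\<in>Z - {0}. real (zmult g a) * ln (norm a))"
      using Feq0[of 0] r Z by (intro ln_mult_prod_power) auto
    also have "(\<Sum>a\<in>Z - {0}. real (zmult g a) * ln (norm a)) = (\<Sum>a\<in>Z. real (zmult g a) * ln (norm a))"
      by (rule sum.mono_neutral_left) (use Z in auto)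
    finally have lng0: "ln (norm (g0 0)) = ln (norm (F 0)) + (\<Sum>a\<in>Z. real (zmult g a) * ln (norm a))" .
    have "Re (f 0) = ln (norm (G 0))" using nf[of 0] r by simp
    also have "norm (G 0) = norm (F 0) * (\<Prod>a\<in>Z. r ^ zmult g a)"
      using r by (simp add: G_def norm_mult prod_norm[symmetric] norm_power)
    also have "ln \<dots> = ln (norm (F 0)) + (\<Sum>a\<in>Z. real (zmult g a) * ln r)"
      using Feq0[of 0] r Z by (intro ln_mult_prod_power) auto
    also have "\<dots> = ln (norm (g0 0)) + (\<Sum>a\<in>Z. real (zmult g a) * (ln r - ln (norm a)))"
      by (simp add: lng0 right_diff_distrib sum_subtractf)
    finally have f0: "Re (f 0) = \<dots>" .
    show "\<exists>f R'. f holomorphic_on ball 0 R' \<and> r < R' \<and>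
       (\<forall>z. norm z = r \<longrightarrow> ln (norm (g z)) = Re (f z)) \<and>
       (\<forall>z. norm z \<le> r \<longrightarrow> norm (g z) \<le> exp (Re (f z))) \<and>
       Re (f 0) = ln (norm (g0 0)) + (\<Sum>a | norm a \<le> r \<and> g a = 0. real (zmult g a) * (ln r - ln (norm a)))"
    proof (intro exI[of _ f] exI[of _ "r + \<epsilon>"] conjI allI impI)
      show "ln (norm (g z)) = Re (f z)" if "norm z = r" for z
        using nf[of z] that by (simp flip: Gcirc[OF that])
      show "norm (g z) \<le> exp (Re (f z))" if "norm z \<le> r" for z
        using Gle[OF that] nf[OF that] by simp
    qed (use f(1) \<epsilon>(1) f0 in \<open>simp_all add: Z_def\<close>)
  qed
qed

section \<open>Jensen's formula and the logarithmic difference estimate\<close>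

definition log_mean :: "(complex \<Rightarrow> complex) \<Rightarrow> real \<Rightarrow> real" where
  "log_mean g r = circle_mean r (\<lambda>z. ln (norm (g z)))"

text \<open>Means of \<open>ln (norm (g z))\<close> are evaluated only on such circles, where the
  integrand is continuous; logarithmic singularities never have to be integrated.\<close>

definition zero_free_circle :: "(complex \<Rightarrow> complex) \<Rightarrow> real \<Rightarrow> bool" where
  "zero_free_circle g r \<longleftrightarrow> (\<forall>z. norm z = r \<longrightarrow> g z \<noteq> 0)"

lemma proximity_eq_circle_mean: "proximity r g = circle_mean r (\<lambda>z. log_plus (norm (g z)))"
  by (simp add: proximity_def circle_mean_def)

lemma log_plus_nonneg: "log_plus x \<ge> 0"
  by (simp add: log_plus_def)

lemma log_plus_mono: "x \<le> y \<Longrightarrow> log_plus x \<le> log_plus y"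
  unfolding log_plus_def by (intro ln_mono) auto

lemma log_plus_le_iff: "c \<ge> 0 \<Longrightarrow> log_plus x \<le> c \<longleftrightarrow> x \<le> exp c"
proof -
  assume "c \<ge> 0"
  have "ln (max 1 x) \<le> c \<longleftrightarrow> max 1 x \<le> exp c" by (subst exp_le_cancel_iff[symmetric]) simp
  with \<open>c \<ge> 0\<close> show ?thesis by (simp add: log_plus_def)
qed

lemma ln_le_log_plus: "ln x \<le> log_plus x" if "x > 0"
  using that unfolding log_plus_def by (intro ln_mono) auto

text \<open>This expresses the mean of \<open>\<bar>ln (norm g)\<bar>\<close> by the proximity
  function and \<open>log_mean\<close>, without the proximity function of 1/g.\<close>

lemma abs_ln_eq_log_plus: "x > 0 \<Longrightarrow> \<bar>ln x\<bar> = 2 * log_plus x - ln x"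
  by (auto simp: log_plus_def max_def abs_if)

lemma continuous_on_log_plus [continuous_intros]:
  "continuous_on A u \<Longrightarrow> continuous_on A (\<lambda>z. log_plus (u z))"
  unfolding log_plus_def by (intro continuous_intros) auto

lemma continuous_on_entire:
  "g holomorphic_on UNIV \<Longrightarrow> continuous_on A g"
  using holomorphic_on_imp_continuous_on continuous_on_subset by blast

lemma continuous_on_ln_norm:
  "g holomorphic_on UNIV \<Longrightarrow> zero_free_circle g r \<Longrightarrow> continuous_on (sphere 0 r) (\<lambda>z. ln (norm (g z)))"
  unfolding zero_free_circle_def
  by (intro continuous_on_ln continuous_on_norm continuous_on_entire) auto

lemma continuous_on_proximity:
  assumes "g holomorphic_on UNIV"
  shows "continuous_on UNIV (\<lambda>r. proximity r g)"
  unfolding proximity_eq_circle_mean using assms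
  by (intro continuous_on_circle_mean_radius continuous_intros continuous_on_entire)

lemma proximity_nonneg:
  assumes "g holomorphic_on UNIV" "r \<ge> 0"
  shows "proximity r g \<ge> 0"
proof -
  have "circle_mean r (\<lambda>_. 0) \<le> circle_mean r (\<lambda>z. log_plus (norm (g z)))"
    by (rule circle_mean_mono) (use assms in \<open>auto intro!: continuous_intros continuous_on_entire log_plus_nonneg\<close>)
  thus ?thesis by (simp add: proximity_eq_circle_mean)
qed

lemma log_mean_le_proximity:
  assumes "g holomorphic_on UNIV" "r \<ge> 0" "zero_free_circle g r"
  shows "log_mean g r \<le> proximity r g"
  unfolding log_mean_def proximity_eq_circle_mean
  by (rule circle_mean_mono)
     (use assms in \<open>auto intro!: continuous_intros continuous_on_entire continuous_on_ln_norm ln_le_log_plus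
        simp: zero_free_circle_def\<close>)

lemma zero_free_radius:
  assumes g: "g holomorphic_on UNIV" and nz: "g w0 \<noteq> 0" and "r < s"
  obtains R where "r < R" "R < s" "zero_free_circle g R"
proof -
  have "infinite {r<..<s}" using \<open>r < s\<close> by simp
  moreover have "finite (norm ` {z. norm z \<le> s \<and> g z = 0})"
    by (intro finite_imageI finite_zeros[OF g nz])
  ultimately have "\<not> {r<..<s} \<subseteq> norm ` {z. norm z \<le> s \<and> g z = 0}"
    using finite_subset by blast
  then obtain R where "R \<in> {r<..<s}" "R \<notin> norm ` {z. norm z \<le> s \<and> g z = 0}" by blast
  thus ?thesis by (intro that[of R]) (auto simp: zero_free_circle_def)
qed

text \<open>\<open>Re (f z)\<close> is harmonic on a neighbourhood of the closed disc, with boundary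
  values \<open>ln (norm (g z))\<close>. Its interior values are therefore Poisson integrals of
  these, and its means over all concentric circles in the disc agree.\<close>

lemma circle_majorant:
  assumes g: "g holomorphic_on UNIV" and nz: "g w0 \<noteq> 0" and R: "R > 0" "zero_free_circle g R"
  obtains f R' where "f holomorphic_on ball 0 R'" "R < R'"
    "\<forall>z. norm z = R \<longrightarrow> ln (norm (g z)) = Re (f z)"
    "\<forall>z. norm z \<le> R \<longrightarrow> norm (g z) \<le> exp (Re (f z))"
    "\<forall>z. norm z < R \<longrightarrow> Re (f z) = poisson_integral R (\<lambda>z. ln (norm (g z))) z"
    "\<forall>r. 0 < r \<longrightarrow> r \<le> R \<longrightarrow> circle_mean r (\<lambda>z. Re (f z)) = log_mean g R"
proof -
  from log_majorant[OF g nz] obtain C where C: "\<And>r. r > 0 \<Longrightarrow> (\<And>z. norm z = r \<Longrightarrow> g z \<noteq> 0) \<Longrightarrow>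
     \<exists>f R'. f holomorphic_on ball 0 R' \<and> r < R' \<and>
       (\<forall>z. norm z = r \<longrightarrow> ln (norm (g z)) = Re (f z)) \<and>
       (\<forall>z. norm z \<le> r \<longrightarrow> norm (g z) \<le> exp (Re (f z))) \<and>
       Re (f 0) = C + (\<Sum>a | norm a \<le> r \<and> g a = 0. real (zmult g a) * (ln r - ln (norm a)))"
    by blast
  then obtain f R' where f: "f holomorphic_on ball 0 R'" "R < R'"
    "\<forall>z. norm z = R \<longrightarrow> ln (norm (g z)) = Re (f z)"
    "\<forall>z. norm z \<le> R \<longrightarrow> norm (g z) \<le> exp (Re (f z))"
    using C[OF R(1)] R(2) unfolding zero_free_circle_def by blast
  have "Re (f z) = poisson_integral R (\<lambda>z. ln (norm (g z))) z" if "norm z < R" for z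
    unfolding poisson_formula[OF f(1) R(1) f(2) that, symmetric] poisson_integral_def
    by (rule circle_mean_cong) (use f(3) R in simp_all)
  moreover have "circle_mean r (\<lambda>z. Re (f z)) = log_mean g R" if "0 < r" "r \<le> R" for r
  proof -
    have "circle_mean r (\<lambda>z. Re (f z)) = Re (f 0)"
      by (rule mean_value_Re[OF f(1)]) (use that f(2) in auto)
    also have "\<dots> = circle_mean R (\<lambda>z. Re (f z))"
      by (rule mean_value_Re[OF f(1), symmetric]) (use R f(2) in auto)
    also have "\<dots> = log_mean g R" unfolding log_mean_def
      by (rule circle_mean_cong) (use f(3) R in simp_all)
    finally show ?thesis .
  qed
  ultimately show ?thesis using f by (intro that[of f R']) simp_all
qed

text \<open>The mean value property of the harmonic majorant, whose value at the centre is exactly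
  the weighted sum over the zeros.\<close>

lemma jensen:
  assumes g: "g holomorphic_on UNIV" and nz: "g w0 \<noteq> 0"
  obtains C where "\<And>r. r > 0 \<Longrightarrow> zero_free_circle g r \<Longrightarrow>
    log_mean g r = C + (\<Sum>a | norm a \<le> r \<and> g a = 0. real (zmult g a) * (ln r - ln (norm a)))"
proof -
  from log_majorant[OF g nz] obtain C where C: "\<And>r. r > 0 \<Longrightarrow> (\<And>z. norm z = r \<Longrightarrow> g z \<noteq> 0) \<Longrightarrow>
     \<exists>f R'. f holomorphic_on ball 0 R' \<and> r < R' \<and>
       (\<forall>z. norm z = r \<longrightarrow> ln (norm (g z)) = Re (f z)) \<and>
       (\<forall>z. norm z \<le> r \<longrightarrow> norm (g z) \<le> exp (Re (f z))) \<and>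
       Re (f 0) = C + (\<Sum>a | norm a \<le> r \<and> g a = 0. real (zmult g a) * (ln r - ln (norm a)))"
    by blast
  show ?thesis
  proof (rule that[of C])
    fix r :: real assume r: "r > 0" "zero_free_circle g r"
    then obtain f R' where f: "f holomorphic_on ball 0 R'" "r < R'"
      "\<And>z. norm z = r \<Longrightarrow> ln (norm (g z)) = Re (f z)"
      "Re (f 0) = C + (\<Sum>a | norm a \<le> r \<and> g a = 0. real (zmult g a) * (ln r - ln (norm a)))"
      using C[of r] unfolding zero_free_circle_def by blast
    have "log_mean g r = circle_mean r (\<lambda>z. Re (f z))" unfolding log_mean_def
      by (rule circle_mean_cong) (use f(3) r in auto)
    also have "\<dots> = Re (f 0)" by (rule mean_value_Re[OF f(1) r(1) f(2)])
    finally show "log_mean g r = C + (\<Sum>a | norm a \<le> r \<and> g a = 0. real (zmult g a) * (ln r - ln (norm a)))"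
      using f(4) by simp
  qed
qed

text \<open>On the inner circle \<open>ln (norm (g z))\<close> lies below the majorant, whose mean
  there is already the mean over the outer circle.\<close>

lemma log_mean_mono:
  assumes g: "g holomorphic_on UNIV" and nz: "g w0 \<noteq> 0"
    and r: "0 < r" "r \<le> R" "zero_free_circle g r" "zero_free_circle g R"
  shows "log_mean g r \<le> log_mean g R"
proof -
  obtain f R' where f: "f holomorphic_on ball 0 R'" "R < R'"
    "\<forall>z. norm z = R \<longrightarrow> ln (norm (g z)) = Re (f z)"
    "\<forall>z. norm z \<le> R \<longrightarrow> norm (g z) \<le> exp (Re (f z))"
    "\<forall>z. norm z < R \<longrightarrow> Re (f z) = poisson_integral R (\<lambda>z. ln (norm (g z))) z"
    "\<forall>r. 0 < r \<longrightarrow> r \<le> R \<longrightarrow> circle_mean r (\<lambda>z. Re (f z)) = log_mean g R"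
    by (rule circle_majorant[OF g nz less_le_trans[OF r(1,2)] r(4)])
  note f = f[rule_format]
  have "log_mean g r \<le> circle_mean r (\<lambda>z. Re (f z))"
    unfolding log_mean_def
  proof (rule circle_mean_mono)
    show "continuous_on (sphere 0 r) (\<lambda>z. Re (f z))"
      by (intro continuous_intros holomorphic_on_imp_continuous_on holomorphic_on_subset[OF f(1)])
         (use r f(2) in auto)
    fix z :: complex assume z: "norm z = r"
    have "ln (norm (g z)) \<le> ln (exp (Re (f z)))"
      using f(4)[of z] z r(2,3) by (intro ln_mono) (simp_all add: zero_free_circle_def)
    thus "ln (norm (g z)) \<le> Re (f z)" by simp
  qed (use g r in \<open>simp_all add: continuous_on_ln_norm\<close>)
  also have "\<dots> = log_mean g R" by (rule f(6)[OF r(1,2)])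
  finally show ?thesis .
qed

text \<open>Subharmonicity of \<open>log_plus (norm (g z))\<close>: enlarging the boundary values of
  the majorant from \<open>ln\<close> to \<open>log_plus\<close> makes its Poisson integral bound
  both \<open>ln (norm (g z))\<close> and 0.\<close>

lemma log_plus_le_poisson_integral:
  assumes g: "g holomorphic_on UNIV" and nz: "g w0 \<noteq> 0" and z: "norm z < R" and R: "zero_free_circle g R"
  shows "log_plus (norm (g z)) \<le> poisson_integral R (\<lambda>z. log_plus (norm (g z))) z"
proof -
  have R0: "R > 0" using z norm_ge_zero[of z] by linarith
  obtain f R' where f: "f holomorphic_on ball 0 R'" "R < R'"
    "\<forall>z. norm z = R \<longrightarrow> ln (norm (g z)) = Re (f z)"
    "\<forall>z. norm z \<le> R \<longrightarrow> norm (g z) \<le> exp (Re (f z))"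
    "\<forall>z. norm z < R \<longrightarrow> Re (f z) = poisson_integral R (\<lambda>z. ln (norm (g z))) z"
    "\<forall>r. 0 < r \<longrightarrow> r \<le> R \<longrightarrow> circle_mean r (\<lambda>z. Re (f z)) = log_mean g R"
    by (rule circle_majorant[OF g nz R0 R])
  note f = f[rule_format]
  have cl: "continuous_on (sphere 0 R) (\<lambda>z. log_plus (norm (g z)))"
    using g by (intro continuous_intros continuous_on_entire)
  have "poisson_integral R (\<lambda>z. ln (norm (g z))) z \<le> poisson_integral R (\<lambda>z. log_plus (norm (g z))) z"
    using continuous_on_ln_norm[OF g R] cl z
    by (rule poisson_integral_mono) (use R in \<open>auto intro!: ln_le_log_plus simp: zero_free_circle_def\<close>)
  moreover have "poisson_integral R (\<lambda>_. 0) z \<le> poisson_integral R (\<lambda>z. log_plus (norm (g z))) z"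
    using _ cl z by (rule poisson_integral_mono) (auto intro: log_plus_nonneg)
  hence "0 \<le> poisson_integral R (\<lambda>z. log_plus (norm (g z))) z"
    by (simp add: poisson_integral_def)
  ultimately show ?thesis
    using order_trans[OF f(4)[of z]] f(5)[of z] z by (subst log_plus_le_iff) simp_all
qed

text \<open>Averaging the preceding bound gives monotonicity; Harnack's bound for nonnegative
  boundary data gives the pointwise estimate. As the circle of radius \<open>R\<close> may carry
  zeros, zero-free radii \<open>S R n\<close> tend to \<open>R\<close> from above, and continuity of
  the proximity function closes the gap.\<close>

lemma
  assumes g: "g holomorphic_on UNIV" and nz: "g w0 \<noteq> 0"
  shows proximity_mono: "0 < r \<Longrightarrow> r \<le> R \<Longrightarrow> proximity r g \<le> proximity R g"
    and norm_le_exp_proximity: "norm z < R \<Longrightarrow>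
           log_plus (norm (g z)) \<le> (R + norm z) / (R - norm z) * proximity R g"
proof -
  have cl: "continuous_on (sphere 0 s) (\<lambda>z. log_plus (norm (g z)))" for s
    using g by (intro continuous_intros continuous_on_entire)
  have "\<exists>s. R < s \<and> s < R + 1 / real (Suc n) \<and> zero_free_circle g s" for R :: real and n
    using zero_free_radius[OF g nz, of R "R + 1 / real (Suc n)"] by auto
  then obtain S where S: "R < S R n" "S R n < R + 1 / real (Suc n)" "zero_free_circle g (S R n)" for R n
    by metis
  have lim: "(\<lambda>n. S R n) \<longlonglongrightarrow> R" for R
  proof (rule tendsto_sandwich[where f = "\<lambda>_. R" and h = "\<lambda>n. R + 1 / real (Suc n)"])
    show "(\<lambda>n. R + 1 / real (Suc n)) \<longlonglongrightarrow> R"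
      using tendsto_add[OF tendsto_const[of R] LIMSEQ_Suc[OF lim_1_over_n]] by simp
    show "\<forall>\<^sub>F n in sequentially. S R n \<le> R + 1 / real (Suc n)"
      by (rule always_eventually) (use S(2)[of R] in \<open>auto intro: less_imp_le simp del: of_nat_Suc\<close>)
    show "\<forall>\<^sub>F n in sequentially. R \<le> S R n"
      by (rule always_eventually) (use S(1)[of R] in \<open>auto intro: less_imp_le\<close>)
  qed (rule tendsto_const)
  have lim': "(\<lambda>n. proximity (S R n) g) \<longlonglongrightarrow> proximity R g" for R
    by (rule continuous_on_tendsto_compose[OF continuous_on_proximity[OF g] lim[of R]]) auto
  show "proximity r g \<le> proximity R g" if r: "0 < r" "r \<le> R" for r R
  proof (rule LIMSEQ_le_const[OF lim'])
    have "proximity r g \<le> proximity (S R n) g" for n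
    proof -
      have "proximity r g \<le> circle_mean r (poisson_integral (S R n) (\<lambda>z. log_plus (norm (g z))))"
        unfolding proximity_eq_circle_mean
      proof (rule circle_mean_mono[OF cl])
        show "continuous_on (sphere 0 r) (poisson_integral (S R n) (\<lambda>z. log_plus (norm (g z))))"
          by (rule continuous_on_poisson_integral[OF cl]) (use r S[of R n] in auto)
        show "log_plus (norm (g z)) \<le> poisson_integral (S R n) (\<lambda>z. log_plus (norm (g z))) z"
          if "norm z = r" for z
          by (rule log_plus_le_poisson_integral[OF g nz]) (use r S[of R n] that in auto)
      qed (use r in auto)
      also have "\<dots> = proximity (S R n) g"
        unfolding proximity_eq_circle_mean
        by (rule circle_mean_poisson_integral[OF cl]) (use r S[of R n] in auto)
      finally show ?thesis .
    qed
    thus "\<exists>N. \<forall>n\<ge>N. proximity r g \<le> proximity (S R n) g" by blast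
  qed
  show "log_plus (norm (g z)) \<le> (R + norm z) / (R - norm z) * proximity R g" if z: "norm z < R" for z R
  proof (rule LIMSEQ_le_const)
    show "(\<lambda>n. (S R n + norm z) / (S R n - norm z) * proximity (S R n) g)
            \<longlonglongrightarrow> (R + norm z) / (R - norm z) * proximity R g"
      using z by (intro tendsto_intros lim lim') auto
    have "log_plus (norm (g z)) \<le> (S R n + norm z) / (S R n - norm z) * proximity (S R n) g" for n
    proof -
      have zS: "norm z < S R n" using z S(1)[of R n] by linarith
      have "log_plus (norm (g z)) \<le> poisson_integral (S R n) (\<lambda>z. log_plus (norm (g z))) z"
        by (rule log_plus_le_poisson_integral[OF g nz zS S(3)])
      also have "\<dots> \<le> (S R n + norm z) / (S R n - norm z) * proximity (S R n) g"
        unfolding proximity_eq_circle_mean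
        by (rule poisson_integral_le[OF cl zS]) (rule log_plus_nonneg)
      finally show ?thesis .
    qed
    thus "\<exists>N. \<forall>n\<ge>N. log_plus (norm (g z)) \<le> (S R n + norm z) / (S R n - norm z) * proximity (S R n) g"
      by blast
  qed
qed

text \<open>At z + h the function is bounded by the majorant for radius \<open>R\<close>, at
  \<open>z\<close> it is kept as it is, and moving the majorant by \<open>h\<close> costs a Poisson
  integral of \<open>\<bar>ln (norm g)\<bar>\<close>. Since majorant and Poisson integral have means
  known from the circle of radius \<open>R\<close>, the mean of \<open>X\<close> is exact.\<close>

lemma log_difference:
  assumes g: "g holomorphic_on UNIV" and nz: "g w0 \<noteq> 0"
    and r: "0 < r" "r + 2 \<le> R" "zero_free_circle g r" "zero_free_circle g R"
  obtains X where "continuous_on (sphere 0 r) X"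
    "\<And>z h. norm z = r \<Longrightarrow> norm h \<le> 1 \<Longrightarrow> norm (g (z + h)) \<le> exp (X z) * norm (g z)"
    "\<And>z. norm z = r \<Longrightarrow> norm (deriv g z) \<le> exp (X z) * norm (g z)"
    "circle_mean r X = log_mean g R - log_mean g r + 4 / (R - r) * (2 * proximity R g - log_mean g R)"
proof -
  have R: "R > 0" "r < R" using r by auto
  obtain f R' where f: "f holomorphic_on ball 0 R'" "R < R'"
    "\<forall>z. norm z = R \<longrightarrow> ln (norm (g z)) = Re (f z)"
    "\<forall>z. norm z \<le> R \<longrightarrow> norm (g z) \<le> exp (Re (f z))"
    "\<forall>z. norm z < R \<longrightarrow> Re (f z) = poisson_integral R (\<lambda>z. ln (norm (g z))) z"
    "\<forall>r. 0 < r \<longrightarrow> r \<le> R \<longrightarrow> circle_mean r (\<lambda>z. Re (f z)) = log_mean g R"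
    by (rule circle_majorant[OF g nz R(1) r(4)])
  note f = f[rule_format]
  define P where "P = poisson_integral R (\<lambda>z. \<bar>ln (norm (g z))\<bar>)"
  define X where "X = (\<lambda>z. Re (f z) + 4 / (R - r) * P z - ln (norm (g z)))"
  have cabs: "continuous_on (sphere 0 R) (\<lambda>z. \<bar>ln (norm (g z))\<bar>)"
    by (intro continuous_intros continuous_on_ln_norm g r)
  have cP: "continuous_on (sphere 0 r) P"
    unfolding P_def by (rule continuous_on_poisson_integral[OF cabs r(1) R(2)])
  have cf: "continuous_on (sphere 0 r) (\<lambda>z. Re (f z))"
    by (intro continuous_intros holomorphic_on_imp_continuous_on holomorphic_on_subset[OF f(1)])
       (use R f(2) in auto)
  have cX: "continuous_on (sphere 0 r) (\<lambda>z. Re (f z) + 4 / (R - r) * P z)"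
    using cf cP by (intro continuous_on_add continuous_on_mult continuous_on_const)
  have shift: "norm (g (z + h)) \<le> exp (X z) * norm (g z)" if z: "norm z = r" and h: "norm h \<le> 1" for z h
  proof -
    have zh: "norm (z + h) < R" using norm_triangle_ineq[of z h] r z h by linarith
    have "Re (f (z + h)) \<le> Re (f z) + 4 / (R - r) * P z"
      using poisson_integral_shift[OF continuous_on_ln_norm[OF g r(4)], of z h] r z h zh R
      by (simp add: f(5) P_def)
    hence "norm (g (z + h)) \<le> exp (X z + ln (norm (g z)))"
      using f(4)[of "z + h"] zh by (intro order_trans[OF f(4)]) (auto simp: X_def)
    also have "\<dots> = exp (X z) * norm (g z)"
      using r(3) z by (simp add: exp_add zero_free_circle_def)
    finally show ?thesis .
  qed
  show ?thesis
  proof (rule that[of X])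
    show "continuous_on (sphere 0 r) X"
      unfolding X_def using cX continuous_on_ln_norm[OF g r(3)] by (rule continuous_on_diff)
    show "norm (deriv g z) \<le> exp (X z) * norm (g z)" if "norm z = r" for z
    proof -
      \<comment> \<open>Cauchy's inequality on the unit circle about \<open>z\<close>, where the
        shift bound applies; hence the same \<open>X\<close> serves for the derivative.\<close>
      have "norm ((deriv ^^ 1) g z) \<le> fact 1 * (exp (X z) * norm (g z)) / 1 ^ 1"
      proof (rule Cauchy_inequality)
        show "norm (g x) \<le> exp (X z) * norm (g z)" if "norm (z - x) = 1" for x
          using shift[OF \<open>norm z = r\<close>, of "x - z"] that by (simp add: norm_minus_commute)
      qed (use g in \<open>auto intro: continuous_on_entire holomorphic_on_subset\<close>)
      thus ?thesis by simp
    qed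
    have "circle_mean r X = log_mean g R + 4 / (R - r) * circle_mean r P - log_mean g r"
      unfolding X_def log_mean_def[of g r]
      using circle_mean_diff[OF cX continuous_on_ln_norm[OF g r(3)]]
        circle_mean_add[OF cf continuous_on_mult[OF continuous_on_const cP], of "4 / (R - r)"] r(1) R f(6)[of r]
      by (simp only: circle_mean_cmult)
    also have "circle_mean r P = circle_mean R (\<lambda>z. \<bar>ln (norm (g z))\<bar>)"
      unfolding P_def by (rule circle_mean_poisson_integral[OF cabs r(1) R(2)])
    also have "\<dots> = circle_mean R (\<lambda>z. 2 * log_plus (norm (g z)) - ln (norm (g z)))"
      by (rule circle_mean_cong) (use r(4) R in \<open>auto simp: abs_ln_eq_log_plus zero_free_circle_def\<close>)
    also have "\<dots> = 2 * proximity R g - log_mean g R"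
      unfolding proximity_eq_circle_mean log_mean_def
      by (subst circle_mean_diff)
         (use R g r(4) in \<open>auto intro!: continuous_intros continuous_on_entire continuous_on_ln_norm
            simp: circle_mean_cmult\<close>)
    finally show "circle_mean r X = log_mean g R - log_mean g r + 4 / (R - r) * (2 * proximity R g - log_mean g R)"
      by simp
  qed (use shift in auto)
qed

section \<open>Counting functions and growth of transcendental entire functions\<close>

text \<open>The share of a single zero of modulus \<open>c\<close> in an integrated counting
  function.\<close>

lemma has_integral_truncated_inverse:
  fixes c r :: real
  assumes "0 < c" "c \<le> r"
  shows "((\<lambda>t. (if c \<le> t then 1 else 0) / t) has_integral (ln r - ln c)) {0..r}"
proof -
  have "((\<lambda>t. 1 / t) has_integral (ln r - ln c)) {c..r}"
    using assms
    by (intro fundamental_theorem_of_calculus)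
       (auto intro!: derivative_eq_intros simp flip: has_real_derivative_iff_has_vector_derivative
          simp: divide_inverse)
  hence "((\<lambda>t. if t \<in> {c..r} then 1 / t else 0) has_integral (ln r - ln c)) {0..r}"
    by (subst has_integral_restrict) (use assms in auto)
  thus ?thesis by (rule has_integral_eq[rotated]) auto
qed

lemma is_pole_inverse_iff:
  assumes g: "g holomorphic_on UNIV" and nz: "g w0 \<noteq> 0"
  shows "is_pole (\<lambda>z. 1 / g z) a \<longleftrightarrow> g a = 0"
proof
  assume a: "g a = 0"
  obtain k where k: "k holomorphic_on UNIV" "k a \<noteq> 0" "\<And>z. g z = (z - a) ^ zmult g a * k z"
    using zmult_factor[OF g nz] by blast
  have n: "zmult g a > 0" using zmult_zero_iff[OF g nz, of a] a by auto
  have "is_pole (\<lambda>z. (1 / k z) / (z - a) ^ zmult g a) a"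
  proof (rule is_pole_basic[where A = "{z. k z \<noteq> 0}"])
    show "open {z. k z \<noteq> 0}"
      using k(1) by (intro open_Collect_neq holomorphic_on_imp_continuous_on holomorphic_intros)
    show "(\<lambda>z. 1 / k z) holomorphic_on {z. k z \<noteq> 0}"
      by (intro holomorphic_intros holomorphic_on_subset[OF k(1)]) auto
  qed (use k n in auto)
  moreover have "(\<lambda>z. 1 / g z) = (\<lambda>z. (1 / k z) / (z - a) ^ zmult g a)"
    by (subst k(3)) (simp add: mult.commute)
  ultimately show "is_pole (\<lambda>z. 1 / g z) a" by simp
next
  assume pole: "is_pole (\<lambda>z. 1 / g z) a"
  show "g a = 0"
  proof (rule ccontr)
    assume "g a \<noteq> 0"
    have "open {z. g z \<noteq> 0}"
      using g by (intro open_Collect_neq holomorphic_on_imp_continuous_on holomorphic_intros)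
    moreover have "(\<lambda>z. 1 / g z) holomorphic_on {z. g z \<noteq> 0}"
      by (intro holomorphic_intros holomorphic_on_subset[OF g]) auto
    ultimately show False
      using not_is_pole_holomorphic[of "{z. g z \<noteq> 0}" a "\<lambda>z. 1 / g z"] \<open>g a \<noteq> 0\<close> pole by auto
  qed
qed

text \<open>A zero off the origin enters the integral from its own modulus on. A zero at the origin
  yields the separate term \<open>n 0 * ln r\<close>, which fits the same formula because
  \<open>ln 0 = 0\<close>.\<close>

lemma nev_Nbar_inverse:
  assumes g: "g holomorphic_on UNIV" and nz: "g w0 \<noteq> 0" and r: "r > 0"
  shows "nev_Nbar r (\<lambda>z. 1 / g z) = (\<Sum>a | norm a \<le> r \<and> g a = 0. ln r - ln (norm a))"
proof -
  define Z where "Z = (\<lambda>t. {a. norm a \<le> t \<and> g a = 0})"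
  have fin: "finite (Z t)" for t unfolding Z_def by (rule finite_zeros[OF g nz])
  have n: "distinct_pole_count (\<lambda>z. 1 / g z) t = card (Z t)" for t
    by (simp add: distinct_pole_count_def is_pole_inverse_iff[OF g nz] Z_def)
  have eq: "real (card (Z t)) - real (card (Z 0)) = (\<Sum>a\<in>Z r - Z 0. if norm a \<le> t then 1 else 0)"
    if t: "t \<in> {0..r}" for t
  proof -
    have "(\<Sum>a\<in>Z r - Z 0. if norm a \<le> t then 1 else 0) = (\<Sum>a\<in>Z t - Z 0. 1 :: real)"
      by (rule sum.mono_neutral_cong_right) (use t fin in \<open>auto simp: Z_def\<close>)
    also have "\<dots> = real (card (Z t)) - real (card (Z 0))"
    proof -
      have sub: "Z 0 \<subseteq> Z t" using t by (auto simp: Z_def)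
      have "card (Z t - Z 0) = card (Z t) - card (Z 0)" by (rule card_Diff_subset[OF fin sub])
      thus ?thesis using card_mono[OF fin sub] by simp
    qed
    finally show ?thesis by simp
  qed
  have "((\<lambda>t. \<Sum>a\<in>Z r - Z 0. (if norm a \<le> t then 1 else 0) / t) has_integral
          (\<Sum>a\<in>Z r - Z 0. ln r - ln (norm a))) {0..r}"
    by (intro has_integral_sum has_integral_truncated_inverse) (use fin in \<open>auto simp: Z_def\<close>)
  hence "((\<lambda>t. (real (card (Z t)) - real (card (Z 0))) / t) has_integral
          (\<Sum>a\<in>Z r - Z 0. ln r - ln (norm a))) {0..r}"
    by (rule has_integral_eq[rotated]) (simp add: eq sum_divide_distrib)
  hence "nev_Nbar r (\<lambda>z. 1 / g z) = (\<Sum>a\<in>Z r - Z 0. ln r - ln (norm a)) + real (card (Z 0)) * ln r"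
    unfolding nev_Nbar_def integrated_count_def n by (simp add: integral_unique)
  also have "real (card (Z 0)) * ln r = (\<Sum>a\<in>Z 0. ln r - ln (norm a))"
    by (simp add: Z_def)
  also have "(\<Sum>a\<in>Z r - Z 0. ln r - ln (norm a)) + (\<Sum>a\<in>Z 0. ln r - ln (norm a)) =
               (\<Sum>a\<in>Z r. ln r - ln (norm a))"
    using r fin by (intro sum.subset_diff[symmetric]) (auto simp: Z_def)
  finally show ?thesis by (simp add: Z_def)
qed

lemma ln_weight_nonneg: "1 \<le> r \<Longrightarrow> norm a \<le> r \<Longrightarrow> 0 \<le> ln r - ln (norm (a :: complex))"
  by (cases "a = 0") (auto simp: ln_mono)

lemma nev_Nbar_inverse_nonneg:
  assumes "g holomorphic_on UNIV" "g w0 \<noteq> 0" "r \<ge> 1"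
  shows "0 \<le> nev_Nbar r (\<lambda>z. 1 / g z)"
  using assms by (subst nev_Nbar_inverse) (auto intro!: sum_nonneg ln_weight_nonneg simp del: diff_ge_0_iff_ge)

text \<open>Half of the first main theorem: Jensen's formula on a slightly larger zero-free circle,
  with every multiplicity lowered to one, and then continuity of the proximity function.\<close>

lemma nev_Nbar_le_proximity:
  assumes g: "g holomorphic_on UNIV" and nz: "g w0 \<noteq> 0"
  obtains C where "\<And>r. r \<ge> 1 \<Longrightarrow> nev_Nbar r (\<lambda>z. 1 / g z) \<le> proximity r g + C"
proof -
  obtain C where C: "\<And>r. r > 0 \<Longrightarrow> zero_free_circle g r \<Longrightarrow>
    log_mean g r = C + (\<Sum>a | norm a \<le> r \<and> g a = 0. real (zmult g a) * (ln r - ln (norm a)))"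
    using jensen[OF g nz] by blast
  show ?thesis
  proof (rule that[of "- C"])
    fix r :: real assume r: "r \<ge> 1"
    show "nev_Nbar r (\<lambda>z. 1 / g z) \<le> proximity r g + (- C)"
    proof (rule field_le_epsilon)
      fix e :: real assume e: "e > 0"
      have "isCont (\<lambda>r. proximity r g) r"
        using continuous_on_proximity[OF g] by (simp add: continuous_on_eq_continuous_at)
      then obtain d where d: "d > 0" "\<And>R. \<bar>R - r\<bar> < d \<Longrightarrow> \<bar>proximity R g - proximity r g\<bar> < e"
        using e unfolding continuous_at_eps_delta by (auto simp: dist_real_def)
      obtain R where R: "r < R" "R < r + d" "zero_free_circle g R"
        using zero_free_radius[OF g nz, of r "r + d"] d(1) by auto
      have lnr: "ln r \<le> ln R" using r R by simp
      have "nev_Nbar r (\<lambda>z. 1 / g z) = (\<Sum>a | norm a \<le> r \<and> g a = 0. ln r - ln (norm a))"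
        using nev_Nbar_inverse[OF g nz, of r] r by simp
      also have "\<dots> \<le> (\<Sum>a | norm a \<le> r \<and> g a = 0. real (zmult g a) * (ln R - ln (norm a)))"
      proof (rule sum_mono)
        fix a assume a: "a \<in> {a. norm a \<le> r \<and> g a = 0}"
        hence "zmult g a \<noteq> 0" using zmult_zero_iff[OF g nz] by auto
        hence "1 * (ln r - ln (norm a)) \<le> real (zmult g a) * (ln R - ln (norm a))"
          using a ln_weight_nonneg[OF r, of a] lnr by (intro mult_mono) auto
        thus "ln r - ln (norm a) \<le> real (zmult g a) * (ln R - ln (norm a))" by simp
      qed
      also have "\<dots> \<le> (\<Sum>a | norm a \<le> R \<and> g a = 0. real (zmult g a) * (ln R - ln (norm a)))"
      proof (rule sum_mono2)
        show "0 \<le> real (zmult g a) * (ln R - ln (norm a))"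
          if "a \<in> {a. norm a \<le> R \<and> g a = 0} - {a. norm a \<le> r \<and> g a = 0}" for a
          using that ln_weight_nonneg[of R a] r R by (intro mult_nonneg_nonneg) auto
      qed (use R finite_zeros[OF g nz] in auto)
      also have "\<dots> = log_mean g R - C" using C[of R] r R by simp
      also have "\<dots> \<le> proximity R g - C" using log_mean_le_proximity[OF g, of R] r R by simp
      also have "\<dots> \<le> proximity r g + - C + e" using d(2)[of R] R by simp
      finally show "nev_Nbar r (\<lambda>z. 1 / g z) \<le> proximity r g + - C + e" .
    qed
  qed
qed

text \<open>In Jensen's formula for \<open>g\<close>, one unit of each multiplicity goes to the
  reduced counting function. What remains is at most the multiplicity in \<open>f\<close>, and
  Jensen's formula for \<open>f\<close> bounds that part by its proximity function.\<close>

lemma log_mean_le_nev_Nbar: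
  assumes g: "g holomorphic_on UNIV" and nz: "g w0 \<noteq> 0"
    and f: "f holomorphic_on UNIV" and fnz: "f w1 \<noteq> 0"
    and mult: "\<And>a. g a = 0 \<Longrightarrow> zmult g a \<le> zmult f a + 1"
  obtains C where "\<And>r. r \<ge> 1 \<Longrightarrow> zero_free_circle g r \<Longrightarrow> zero_free_circle f r \<Longrightarrow>
    log_mean g r \<le> nev_Nbar r (\<lambda>z. 1 / g z) + proximity r f + C"
proof -
  obtain C where C: "\<And>r. r > 0 \<Longrightarrow> zero_free_circle g r \<Longrightarrow>
    log_mean g r = C + (\<Sum>a | norm a \<le> r \<and> g a = 0. real (zmult g a) * (ln r - ln (norm a)))"
    using jensen[OF g nz] by blast
  obtain C' where C': "\<And>r. r > 0 \<Longrightarrow> zero_free_circle f r \<Longrightarrow>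
    log_mean f r = C' + (\<Sum>a | norm a \<le> r \<and> f a = 0. real (zmult f a) * (ln r - ln (norm a)))"
    using jensen[OF f fnz] by blast
  show ?thesis
  proof (rule that[of "C - C'"])
    fix r :: real assume r: "r \<ge> 1" "zero_free_circle g r" "zero_free_circle f r"
    have "(\<Sum>a | norm a \<le> r \<and> g a = 0. real (zmult g a) * (ln r - ln (norm a))) \<le>
          (\<Sum>a | norm a \<le> r \<and> g a = 0. (ln r - ln (norm a)) + real (zmult f a) * (ln r - ln (norm a)))"
    proof (rule sum_mono)
      fix a assume a: "a \<in> {a. norm a \<le> r \<and> g a = 0}"
      have "real (zmult g a) * (ln r - ln (norm a)) \<le> real (zmult f a + 1) * (ln r - ln (norm a))"
        using a mult[of a] ln_weight_nonneg[OF r(1), of a] by (intro mult_right_mono) auto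
      thus "real (zmult g a) * (ln r - ln (norm a)) \<le>
              (ln r - ln (norm a)) + real (zmult f a) * (ln r - ln (norm a))"
        by (simp add: algebra_simps)
    qed
    also have "\<dots> = nev_Nbar r (\<lambda>z. 1 / g z) +
        (\<Sum>a | norm a \<le> r \<and> g a = 0. real (zmult f a) * (ln r - ln (norm a)))"
      using nev_Nbar_inverse[OF g nz, of r] r(1) by (simp add: sum.distrib)
    also have "(\<Sum>a | norm a \<le> r \<and> g a = 0. real (zmult f a) * (ln r - ln (norm a))) =
       (\<Sum>a\<in>{a. norm a \<le> r \<and> g a = 0} \<inter> {a. norm a \<le> r \<and> f a = 0}. real (zmult f a) * (ln r - ln (norm a)))"
      by (rule sum.mono_neutral_right) (use finite_zeros[OF g nz] zmult_zero_iff[OF f fnz] in auto)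
    also have "\<dots> \<le> (\<Sum>a | norm a \<le> r \<and> f a = 0. real (zmult f a) * (ln r - ln (norm a)))"
    proof (rule sum_mono2)
      show "0 \<le> real (zmult f a) * (ln r - ln (norm a))"
        if "a \<in> {a. norm a \<le> r \<and> f a = 0} - {a. norm a \<le> r \<and> g a = 0} \<inter> {a. norm a \<le> r \<and> f a = 0}" for a
        using that ln_weight_nonneg[OF r(1), of a] by (intro mult_nonneg_nonneg) auto
    qed (use finite_zeros[OF f fnz] in auto)
    also have "\<dots> = log_mean f r - C'" using C'[of r] r by simp
    also have "\<dots> \<le> proximity r f - C'" using log_mean_le_proximity[OF f, of r] r by simp
    finally show "log_mean g r \<le> nev_Nbar r (\<lambda>z. 1 / g z) + proximity r f + (C - C')"
      using C[of r] r by simp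
  qed
qed

text \<open>Serves the degenerate case, in which \<open>w - b\<close> has only finitely many
  zeros.\<close>

lemma log_mean_le_ln:
  assumes g: "g holomorphic_on UNIV" and nz: "g w0 \<noteq> 0" and fin: "finite {a. g a = 0}"
  obtains K C where "K \<ge> 0" "\<And>r. r \<ge> 1 \<Longrightarrow> zero_free_circle g r \<Longrightarrow> log_mean g r \<le> K * ln r + C"
proof -
  obtain C where C: "\<And>r. r > 0 \<Longrightarrow> zero_free_circle g r \<Longrightarrow>
    log_mean g r = C + (\<Sum>a | norm a \<le> r \<and> g a = 0. real (zmult g a) * (ln r - ln (norm a)))"
    using jensen[OF g nz] by blast
  define K where "K = (\<Sum>a | g a = 0. real (zmult g a))"
  define C' where "C' = (\<Sum>a | g a = 0. real (zmult g a) * \<bar>ln (norm a)\<bar>)"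
  show ?thesis
  proof (rule that[of K "C + C'"])
    show "K \<ge> 0" unfolding K_def by (intro sum_nonneg) auto
    fix r :: real assume r: "r \<ge> 1" "zero_free_circle g r"
    have "(\<Sum>a | norm a \<le> r \<and> g a = 0. real (zmult g a) * (ln r - ln (norm a))) \<le>
          (\<Sum>a | norm a \<le> r \<and> g a = 0. real (zmult g a) * (ln r + \<bar>ln (norm a)\<bar>))"
      by (intro sum_mono mult_left_mono) auto
    also have "\<dots> \<le> (\<Sum>a | g a = 0. real (zmult g a) * (ln r + \<bar>ln (norm a)\<bar>))"
      by (rule sum_mono2[OF fin]) (use r(1) in auto)
    also have "\<dots> = K * ln r + C'"
      by (simp add: K_def C'_def ring_distribs sum.distrib sum_distrib_right)
    finally show "log_mean g r \<le> K * ln r + (C + C')" using C[of r] r by simp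
  qed
qed

section \<open>The characteristic of a transcendental entire function outgrows the logarithm\<close>

lemma nev_T_entire:
  assumes "w holomorphic_on UNIV"
  shows "nev_T r w = proximity r w"
proof -
  have "\<not> is_pole w z" for z
    using not_is_pole_holomorphic[OF open_UNIV _ assms] by auto
  thus ?thesis by (simp add: nev_T_def nev_N_def integrated_count_def pole_count_def)
qed

lemma rational_function_poly: "rational_function (poly p)"
  unfolding rational_function_def by (rule exI[of _ p], rule exI[of _ 1]) simp

lemma entire_polynomial:
  assumes w: "w holomorphic_on UNIV" and z: "\<And>n. n \<ge> N \<Longrightarrow> (deriv ^^ n) w 0 = 0"
  shows "rational_function w"
proof -
  define p where "p = (\<Sum>n<N. monom ((deriv ^^ n) w 0 / fact n) n)"
  have "w x = poly p x" for x
  proof -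
    have "((\<lambda>n. (deriv ^^ n) w 0 / fact n * (x - 0) ^ n) sums w x)"
      by (rule holomorphic_power_series[where r = "norm x + 1"])
         (auto intro: holomorphic_on_subset[OF w])
    moreover have "((\<lambda>n. (deriv ^^ n) w 0 / fact n * (x - 0) ^ n) sums
            (\<Sum>n<N. (deriv ^^ n) w 0 / fact n * (x - 0) ^ n))"
      by (rule sums_finite) (use z in auto)
    ultimately have "w x = (\<Sum>n<N. (deriv ^^ n) w 0 / fact n * (x - 0) ^ n)"
      by (rule sums_unique2)
    thus ?thesis by (simp add: p_def poly_sum poly_monom)
  qed
  hence "w = poly p" by (rule ext)
  thus ?thesis using rational_function_poly by simp
qed

lemma transcendental_unbounded:
  assumes w: "w holomorphic_on UNIV" and tr: "\<not> rational_function w"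
    and C: "C > 0"
  shows "\<exists>z. norm z \<ge> s \<and> norm (w z) > C * norm z ^ n"
proof (rule ccontr)
  assume "\<not> ?thesis"
  hence b: "norm (w z) \<le> C * norm z ^ n" if "norm z \<ge> s" for z using that by force
  have "w z = (\<Sum>k\<le>n. (deriv^^k) w 0 / fact k * z ^ k)" for z
    by (rule Liouville_polynomial[OF w b])
  hence "w = poly (\<Sum>k\<le>n. monom ((deriv^^k) w 0 / fact k) k)"
    by (intro ext) (simp add: poly_sum poly_monom)
  hence "rational_function w" by (rule ssubst) (rule rational_function_poly)
  with tr show False ..
qed

text \<open>Otherwise there are arbitrarily large \<open>r\<close> with \<open>proximity r w\<close>
  below C ln r. On the circle of radius r/2 the Harnack factor is 3, so |w| is at most r^(3D) with D
  = max C 0, and Cauchy's estimates annihilate every Taylor coefficient of order above 3D.\<close>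

lemma proximity_ge_ln:
  assumes w: "w holomorphic_on UNIV" and tr: "\<not> rational_function w"
  shows "\<forall>\<^sub>F r in at_top. C * ln r \<le> proximity r w"
proof (rule ccontr)
  assume contr: "\<not> ?thesis"
  have nz: "\<exists>w0. w w0 \<noteq> 0"
  proof (rule ccontr)
    assume "\<not> ?thesis"
    hence "w = poly 0" by (intro ext) simp
    with tr rational_function_poly show False by simp
  qed
  then obtain w0 where w0: "w w0 \<noteq> 0" by blast
  define D where "D = max C 0"
  define N where "N = nat \<lceil>3 * D\<rceil> + 1"
  have N: "3 * D < real N" unfolding N_def by linarith
  have "(deriv ^^ n) w 0 = 0" if n: "n \<ge> N" for n
  proof (rule ccontr)
    assume nz: "(deriv ^^ n) w 0 \<noteq> 0"
    have "((\<lambda>r. fact n * r powr (3 * D) / (r / 2) ^ n) \<longlongrightarrow> 0) at_top"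
    proof -
      have "((\<lambda>r::real. fact n * 2 ^ n * r powr (3 * D - real n)) \<longlongrightarrow> fact n * 2 ^ n * 0) at_top"
        using N n by (intro tendsto_intros tendsto_neg_powr filterlim_ident) auto
      moreover have "\<forall>\<^sub>F r::real in at_top. fact n * 2 ^ n * r powr (3 * D - real n) = fact n * r powr (3 * D) / (r / 2) ^ n"
        using eventually_gt_at_top[of 0]
        by eventually_elim (simp add: powr_diff powr_realpow power_divide)
      ultimately show ?thesis by (simp cong: filterlim_cong)
    qed
    hence "\<forall>\<^sub>F r in at_top. fact n * r powr (3 * D) / (r / 2) ^ n < norm ((deriv ^^ n) w 0)"
      by (rule order_tendstoD) (use nz in auto)
    moreover have "\<exists>\<^sub>F r in at_top. proximity r w < C * ln r"
      using contr by (simp add: not_eventually not_le)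
    ultimately have "\<exists>\<^sub>F r in at_top. proximity r w < C * ln r \<and>
        fact n * r powr (3 * D) / (r / 2) ^ n < norm ((deriv ^^ n) w 0) \<and> r \<ge> 1"
      using eventually_ge_at_top[of "1::real"]
      by (auto elim!: frequently_rev_mp eventually_elim2)
    then obtain r where r: "proximity r w < C * ln r" "r \<ge> 1"
        "fact n * r powr (3 * D) / (r / 2) ^ n < norm ((deriv ^^ n) w 0)"
      by (auto dest: frequently_ex)
    have "norm ((deriv ^^ n) w 0) \<le> fact n * r powr (3 * D) / (r / 2) ^ n"
    proof (rule Cauchy_inequality)
      fix z :: complex assume z: "norm (0 - z) = r / 2"
      have "log_plus (norm (w z)) \<le> (r + norm z) / (r - norm z) * proximity r w"
        by (rule norm_le_exp_proximity[OF w w0]) (use z r in auto)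
      also have "(r + norm z) / (r - norm z) = 3" using z r by (simp add: field_simps)
      also have "3 * proximity r w \<le> 3 * (D * ln r)"
        using r(1,2) mult_right_mono[of C D "ln r"] by (simp add: D_def)
      finally have "norm (w z) \<le> exp (3 * (D * ln r))"
        using r(2) by (subst (asm) log_plus_le_iff) (auto simp: D_def)
      also have "\<dots> = r powr (3 * D)" using r(2) by (simp add: powr_def)
      finally show "norm (w z) \<le> r powr (3 * D)" .
    qed (use r in \<open>auto intro: continuous_on_entire[OF w] holomorphic_on_subset[OF w]\<close>)
    with r(3) show False by simp
  qed
  from entire_polynomial[OF w this] tr show False by simp
qed

section \<open>The equation with cleared denominators\<close>

text \<open>The bound is claimed for all exponents from \<open>K\<close> on so that finitely many
  polynomials can share one.\<close>

lemma poly_norm_le_power: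
  fixes p :: "complex poly"
  obtains K :: nat and \<rho> :: real where "\<rho> \<ge> 1" "\<forall>k (z::complex). k \<ge> K \<longrightarrow> norm z \<ge> \<rho> \<longrightarrow> norm (poly p z) \<le> norm z ^ k"
proof -
  have "\<exists>K \<rho>. \<rho> \<ge> 1 \<and> (\<forall>z. norm z \<ge> \<rho> \<longrightarrow> norm (poly p z) \<le> norm z ^ K)"
  proof (induction p)
    case 0
    show ?case by (intro exI[of _ 0] exI[of _ 1]) simp
  next
    case (pCons a p)
    then obtain K \<rho> where K: "\<rho> \<ge> 1" "\<And>z. norm z \<ge> \<rho> \<Longrightarrow> norm (poly p z) \<le> norm z ^ K" by blast
    show ?case
    proof (intro exI[of _ "K + 2"] exI[of _ "\<rho> + norm a + 1"] conjI allI impI)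
      show "1 \<le> \<rho> + norm a + 1" using K(1) by simp
      fix z :: complex assume z: "\<rho> + norm a + 1 \<le> norm z"
      have z1: "norm z \<ge> 1" "norm z \<ge> \<rho>" "norm z \<ge> norm a + 1" using z K(1) norm_ge_zero[of a] by linarith+
      have "norm (poly (pCons a p) z) \<le> norm a + norm z * norm (poly p z)"
        by (simp add: norm_triangle_le norm_mult)
      also have "\<dots> \<le> norm a * norm z ^ (K + 1) + norm z * norm z ^ K"
        using z1 K(2)[of z] mult_left_mono[OF one_le_power[OF z1(1), of "K + 1"], of "norm a"]
        by (intro add_mono mult_left_mono) auto
      also have "\<dots> = (norm a + 1) * norm z ^ (K + 1)" by (simp add: algebra_simps)
      also have "\<dots> \<le> norm z * norm z ^ (K + 1)" using z1 by (intro mult_right_mono) auto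
      finally show "norm (poly (pCons a p) z) \<le> norm z ^ (K + 2)" by simp
    qed
  qed
  then obtain K \<rho> where K: "\<rho> \<ge> 1" "\<And>z. norm z \<ge> \<rho> \<Longrightarrow> norm (poly p z) \<le> norm z ^ K" by blast
  show ?thesis
  proof (rule that[OF K(1)], intro allI impI)
    fix k :: nat and z :: complex assume "K \<le> k" "\<rho> \<le> norm z"
    thus "norm (poly p z) \<le> norm z ^ k"
      using K(1) K(2)[of z] power_increasing[of K k "norm z"] by linarith
  qed
qed

lemma polys_norm_le_power:
  fixes S :: "complex poly set"
  assumes "finite S"
  obtains K :: nat and \<rho> :: real where "\<rho> \<ge> 1" "\<forall>z. \<forall>p\<in>S. norm z \<ge> \<rho> \<longrightarrow> norm (poly p z) \<le> norm z ^ K"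
proof -
  have "\<exists>K \<rho>. \<rho> \<ge> 1 \<and> (\<forall>k\<ge>K. \<forall>z. \<forall>p\<in>S. norm z \<ge> \<rho> \<longrightarrow> norm (poly p z) \<le> norm z ^ k)"
    using assms
  proof (induction S rule: finite_induct)
    case empty
    show ?case by (intro exI[of _ 0] exI[of _ 1]) simp
  next
    case (insert p S)
    then obtain K \<rho> where K: "\<rho> \<ge> 1"
      "\<forall>k\<ge>K. \<forall>z. \<forall>p\<in>S. norm z \<ge> \<rho> \<longrightarrow> norm (poly p z) \<le> norm z ^ k" by blast
    obtain K' \<rho>' where K': "\<rho>' \<ge> 1"
      "\<forall>k (z::complex). k \<ge> K' \<longrightarrow> norm z \<ge> \<rho>' \<longrightarrow> norm (poly p z) \<le> norm z ^ k"
      by (rule poly_norm_le_power)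
    show ?case
      by (rule exI[of _ "max K K'"], rule exI[of _ "max \<rho> \<rho>'"]) (use K K' in simp)
  qed
  thus ?thesis using that by blast
qed

lemma poly_norm_le_poly:
  fixes P Q :: "complex poly"
  assumes Q: "Q \<noteq> 0" and deg: "degree P \<le> degree Q"
  obtains \<Lambda> \<rho> where "\<Lambda> > 0" "\<forall>z. norm z \<ge> \<rho> \<longrightarrow> norm (poly P z) \<le> \<Lambda> * norm (poly Q z)"
proof -
  define c where "c = norm (lead_coeff Q)"
  define d where "d = norm (lead_coeff P) + 1"
  have c: "c > 0" using Q by (simp add: c_def)
  have d: "d > 0" using norm_ge_zero[of "lead_coeff P"] unfolding d_def by linarith
  have "((\<lambda>z. norm (poly Q z / z ^ degree Q)) \<longlongrightarrow> c) at_infinity"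
    unfolding c_def by (intro tendsto_norm poly_divide_tendsto_aux)
  hence "\<forall>\<^sub>F z in at_infinity. norm (poly Q z / z ^ degree Q) > c / 2"
    by (rule order_tendstoD) (use c in simp)
  moreover have "((\<lambda>z. norm (poly P z / z ^ degree P)) \<longlongrightarrow> norm (lead_coeff P)) at_infinity"
    by (intro tendsto_norm poly_divide_tendsto_aux)
  hence "\<forall>\<^sub>F z in at_infinity. norm (poly P z / z ^ degree P) < d"
    by (rule order_tendstoD) (simp add: d_def)
  ultimately have "\<forall>\<^sub>F z in at_infinity. norm (poly Q z / z ^ degree Q) > c / 2 \<and> norm (poly P z / z ^ degree P) < d"
    by (rule eventually_conj)
  then obtain \<rho> where \<rho>: "\<forall>z. norm z \<ge> \<rho> \<longrightarrow> norm (poly Q z / z ^ degree Q) > c / 2 \<and> norm (poly P z / z ^ degree P) < d"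
    unfolding eventually_at_infinity by blast
  show ?thesis
  proof (rule that[of "2 * d / c" "max \<rho> 1"])
    show "0 < 2 * d / c" using c d by simp
    show "\<forall>z. norm z \<ge> max \<rho> 1 \<longrightarrow> norm (poly P z) \<le> 2 * d / c * norm (poly Q z)"
    proof (intro allI impI)
      fix z :: complex assume z: "max \<rho> 1 \<le> norm z"
      have z1: "norm z \<ge> 1" and "norm z \<ge> \<rho>" using z by auto
      hence \<rho>': "norm (poly Q z / z ^ degree Q) > c / 2" "norm (poly P z / z ^ degree P) < d"
        using \<rho> by blast+
      have p: "norm z ^ n > 0" for n by (rule zero_less_power) (use z1 in linarith)
      have "norm (poly P z) \<le> d * norm z ^ degree P"
        using \<rho>'(2) p by (simp add: norm_divide norm_power pos_divide_less_eq)
      also have "\<dots> \<le> d * norm z ^ degree Q"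
        using d z1 deg by (intro mult_left_mono power_increasing) auto
      also have "norm z ^ degree Q \<le> 2 / c * norm (poly Q z)"
        using \<rho>'(1) p[of "degree Q"] c by (simp add: norm_divide norm_power pos_less_divide_eq field_simps)
      hence "d * norm z ^ degree Q \<le> d * (2 / c * norm (poly Q z))" using d by (intro mult_left_mono) auto
      finally show "norm (poly P z) \<le> 2 * d / c * norm (poly Q z)" by (simp add: mult_ac)
    qed
  qed
qed

lemma poly_norm_ge_const:
  fixes p :: "complex poly"
  assumes "p \<noteq> 0"
  obtains c \<rho> where "c > 0" "\<And>z. norm z \<ge> \<rho> \<Longrightarrow> norm (poly p z) \<ge> c"
proof -
  obtain \<Lambda> \<rho> where \<Lambda>: "\<Lambda> > 0" "\<forall>z. norm z \<ge> \<rho> \<longrightarrow> norm (poly 1 z) \<le> \<Lambda> * norm (poly p z)"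
    by (rule poly_norm_le_poly[OF assms, of 1]) simp
  show ?thesis
  proof (rule that[of "1 / \<Lambda>" \<rho>])
    show "1 / \<Lambda> > 0" using \<Lambda>(1) by simp
    show "1 / \<Lambda> \<le> norm (poly p z)" if "\<rho> \<le> norm z" for z
      using \<Lambda>(2)[rule_format, OF that] \<Lambda>(1) by (simp add: pos_divide_le_eq mult.commute)
  qed
qed

text \<open>One function \<open>X\<close> controls the unit shifts and the derivative together. The
  multiplied form avoids division by \<open>g\<close>.\<close>

definition log_quotient_bound :: "(complex \<Rightarrow> complex) \<Rightarrow> real \<Rightarrow> (complex \<Rightarrow> real) \<Rightarrow> bool" where
  "log_quotient_bound g r X \<longleftrightarrow> continuous_on (sphere 0 r) X \<and>
     (\<forall>z h. norm z = r \<longrightarrow> norm h \<le> 1 \<longrightarrow> norm (g (z + h)) \<le> exp (X z) * norm (g z)) \<and>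
     (\<forall>z. norm z = r \<longrightarrow> norm (deriv g z) \<le> exp (X z) * norm (g z))"

lemma log_quotient_bound_nonneg:
  assumes "log_quotient_bound g r X" "norm z = r" "g z \<noteq> 0"
  shows "X z \<ge> 0"
proof -
  have "norm (g (z + 0)) \<le> exp (X z) * norm (g z)"
    using assms unfolding log_quotient_bound_def by (metis norm_zero zero_le_one)
  hence "1 * norm (g z) \<le> exp (X z) * norm (g z)" by simp
  hence "1 \<le> exp (X z)" by (rule mult_right_le_imp_le) (use assms(3) in simp)
  thus ?thesis by simp
qed

text \<open>After expansion about \<open>b\<close>, every term except the value at \<open>b\<close>
  contains one of \<open>g\<close>, \<open>gp\<close>, \<open>gm\<close>, \<open>g'\<close> and is
  thus at most a multiple of E |g|. The constant adds 2 (|b| + 1) from the difference term and 1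
  from each of the other three.\<close>

lemma equation_small_value:
  fixes q A A2 A1 A0 b g gp gm g' :: complex
  assumes eq: "q * (b + g) * (gp - gm) + A * g' = A2 * (b + g)\<^sup>2 + A1 * (b + g) + A0"
    and L: "norm q \<le> L" "norm A \<le> L" "norm A2 \<le> L" "norm (2 * A2 * b + A1) \<le> L"
    and E: "norm gp \<le> E * norm g" "norm gm \<le> E * norm g" "norm g' \<le> E * norm g" "E \<ge> 1"
    and g: "norm g \<le> 1"
  shows "norm (A2 * b\<^sup>2 + A1 * b + A0) \<le> L * E * (2 * norm b + 5) * norm g"
proof -
  have L0: "L \<ge> 0" using L(1) norm_ge_zero order_trans by blast
  have "A2 * b\<^sup>2 + A1 * b + A0 = q * (b + g) * (gp - gm) + A * g' - A2 * g * g - (2 * A2 * b + A1) * g"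
    using eq by (simp add: algebra_simps power2_eq_square)
  also have "norm \<dots> \<le> norm (q * (b + g) * (gp - gm)) + norm (A * g') + norm (A2 * g * g) + norm ((2 * A2 * b + A1) * g)"
    by (intro order_trans[OF norm_triangle_ineq4] add_mono order_trans[OF norm_triangle_ineq] order_refl)
  also have "\<dots> \<le> L * (norm b + 1) * (2 * (E * norm g)) + L * (E * norm g) + L * 1 * (E * norm g) + L * (E * norm g)"
  proof -
    have gE: "norm g \<le> E * norm g" using E(4) mult_right_mono[of 1 E "norm g"] by simp
    have "norm (b + g) \<le> norm b + 1" using norm_triangle_ineq[of b g] g by simp
    moreover have "norm (gp - gm) \<le> 2 * (E * norm g)" using norm_triangle_ineq4[of gp gm] E by simp
    ultimately show ?thesis
      unfolding norm_mult using L E g gE L0 by (intro add_mono mult_mono) auto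
  qed
  also have "\<dots> = L * E * (2 * norm b + 5) * norm g" by (simp add: algebra_simps)
  finally show ?thesis .
qed

text \<open>After multiplication by the common denominator \<open>q\<close> and by \<open>w\<close>
  both sides are entire, so the identity can be required at every point.\<close>

locale difference_equation =
  fixes q A A2 A1 A0 :: "complex poly" and w :: "complex \<Rightarrow> complex"
  assumes w: "w holomorphic_on UNIV"
    and A0: "A0 \<noteq> 0"
    and eq: "poly q z * w z * (w (z + 1) - w (z - 1)) + poly A z * deriv w z =
               poly A2 z * (w z)\<^sup>2 + poly A1 z * w z + poly A0 z"
    and nonconst: "\<exists>z. w z \<noteq> b"
begin

text \<open>The last polynomial is the coefficient of \<open>g\<close> when the right-hand side is
  expanded in \<open>g = w - b\<close>.\<close>

lemma coefficient_bound:
  obtains K \<rho> where "\<rho> \<ge> 1"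
    "\<forall>z. \<forall>p\<in>{q, A, A2, A1, A0, smult (2 * b) A2 + A1}. norm z \<ge> \<rho> \<longrightarrow> norm (poly p z) \<le> norm z ^ K"
proof -
  have "finite {q, A, A2, A1, A0, smult (2 * b) A2 + A1}" by (intro finite.insertI finite.emptyI)
  then obtain K \<rho> where "\<rho> \<ge> 1"
    "\<forall>z. \<forall>p\<in>{q, A, A2, A1, A0, smult (2 * b) A2 + A1}. norm z \<ge> \<rho> \<longrightarrow> norm (poly p z) \<le> norm z ^ K"
    by (rule polys_norm_le_power)
  thus ?thesis by (rule that)
qed

text \<open>The pointwise form of the statement that 1/(w - b) has small proximity function. Where
  |w - b| <= 1, the nonzero polynomial value at \<open>b\<close> is at least \<open>c\<close> but at
  most a multiple of exp (X z) |w - b|, so |w - b| cannot be too small.\<close>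

lemma log_plus_le_of_nonsolution:
  assumes B: "smult (b\<^sup>2) A2 + smult b A1 + A0 \<noteq> 0"
  obtains K C \<rho> where "\<rho> \<ge> 1" "C \<ge> 0" "\<forall>r X z. r \<ge> \<rho> \<longrightarrow> log_quotient_bound (\<lambda>z. w z - b) r X \<longrightarrow> norm z = r \<longrightarrow>
      w z \<noteq> b \<longrightarrow> log_plus (norm (w z - b)) \<le> ln (norm (w z - b)) + X z + real K * ln r + C"
proof -
  obtain c \<rho>1 where c: "c > 0" "\<And>z. norm z \<ge> \<rho>1 \<Longrightarrow> norm (poly (smult (b\<^sup>2) A2 + smult b A1 + A0) z) \<ge> c"
    using poly_norm_ge_const[OF B] by blast
  obtain K \<rho>2 where K: "\<rho>2 \<ge> 1"
    "\<forall>z. \<forall>p\<in>{q, A, A2, A1, A0, smult (2 * b) A2 + A1}. norm z \<ge> \<rho>2 \<longrightarrow> norm (poly p z) \<le> norm z ^ K"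
    by (rule coefficient_bound[of b])
  \<comment> \<open>The maximum with 1 makes \<open>ln M\<close> nonnegative, which the case |w - b|
    > 1 uses.\<close>
  define M where "M = max 1 ((2 * norm b + 5) / c)"
  have M: "M \<ge> 1" "(2 * norm b + 5) \<le> M * c"
    using c(1) by (simp_all add: M_def flip: pos_divide_le_eq)
  show ?thesis
  proof (rule that[of "max \<rho>1 \<rho>2" "ln M" K], goal_cases)
    case 1
    show "1 \<le> max \<rho>1 \<rho>2" using K(1) by simp
  next
    case 2
    show "0 \<le> ln M" using M by simp
  next
    case 3
    show ?case
    proof (intro allI impI)
      fix r X z assume r: "max \<rho>1 \<rho>2 \<le> r" and X: "log_quotient_bound (\<lambda>z. w z - b) r X" and z: "norm z = r"
        and wb: "w z \<noteq> b"
      have r1: "r \<ge> 1" using r K(1) by simp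
      have Xz: "X z \<ge> 0" using log_quotient_bound_nonneg[OF X z] wb by simp
      have *: "0 \<le> X z + real K * ln r + ln M" using Xz r1 M by simp
      define g where "g = w z - b"
      have g0: "norm g > 0" using wb by (simp add: g_def)
      show "log_plus (norm (w z - b)) \<le> ln (norm (w z - b)) + X z + real K * ln r + ln M"
      proof (cases "norm g \<le> 1")
        case False
        hence "log_plus (norm (w z - b)) = ln (norm (w z - b))" by (simp add: log_plus_def max_def g_def)
        with * show ?thesis by simp
      next
        case True
        have d: "deriv (\<lambda>z. w z - b) z = deriv w z"
          using w by (subst deriv_diff) (auto intro: holomorphic_on_imp_differentiable_at)
        have Kz: "norm (poly p z) \<le> r ^ K" if "p \<in> {q, A, A2, A1, A0, smult (2 * b) A2 + A1}" for p
          using bspec[OF spec[OF K(2), of z] that] r z by simp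
        have shift: "norm (w (z + h) - b) \<le> exp (X z) * norm (w z - b)" if "norm h \<le> 1" for h
          using X z that by (simp add: log_quotient_bound_def)
        have "c \<le> norm (poly A2 z * b\<^sup>2 + poly A1 z * b + poly A0 z)"
          using c(2)[of z] r z by (simp add: mult.commute)
        also have "\<dots> \<le> r ^ K * exp (X z) * (2 * norm b + 5) * norm g"
        proof (rule equation_small_value[of "poly q z" b g "w (z + 1) - b" "w (z - 1) - b" "poly A z" "deriv w z"])
          show "poly q z * (b + g) * (w (z + 1) - b - (w (z - 1) - b)) + poly A z * deriv w z =
                poly A2 z * (b + g)\<^sup>2 + poly A1 z * (b + g) + poly A0 z"
            using eq[of z] by (simp add: g_def)
          show "norm (2 * poly A2 z * b + poly A1 z) \<le> r ^ K"
            using Kz[of "smult (2 * b) A2 + A1"] by (simp add: mult.commute mult.left_commute)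
          show "norm (poly q z) \<le> r ^ K" "norm (poly A z) \<le> r ^ K" "norm (poly A2 z) \<le> r ^ K"
            by (rule Kz, simp)+
          show "norm (w (z + 1) - b) \<le> exp (X z) * norm g" "norm (w (z - 1) - b) \<le> exp (X z) * norm g"
            using shift[of 1] shift[of "- 1"] by (simp_all add: g_def)
          show "norm (deriv w z) \<le> exp (X z) * norm g"
            unfolding d[symmetric] g_def using X z by (simp add: log_quotient_bound_def)
        qed (use Xz True in simp_all)
        also have "\<dots> = (r ^ K * exp (X z) * norm g) * (2 * norm b + 5)" by (simp add: mult_ac)
        also have "\<dots> \<le> (r ^ K * exp (X z) * norm g) * (M * c)"
          using r1 M(2) by (intro mult_left_mono) auto
        finally have "1 * c \<le> (r ^ K * exp (X z) * norm g * M) * c" by (simp only: mult.assoc mult_1)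
        hence "1 \<le> r ^ K * exp (X z) * norm g * M" using c(1) by (rule mult_right_le_imp_le)
        hence "ln 1 \<le> ln (r ^ K * exp (X z) * norm g * M)" by (intro ln_mono) auto
        also have "\<dots> = ln (norm g) + X z + real K * ln r + ln M"
          using r1 g0 M by (simp add: ln_mult ln_realpow)
        finally show ?thesis using True by (simp add: log_plus_def g_def)
      qed
    qed
  qed
qed

end

lemma log_plus_add_le:
  assumes "x \<ge> 0" "y \<ge> 0"
  shows "log_plus (x + y) \<le> log_plus x + log_plus y + ln 2"
proof -
  have "max 1 (x + y) \<le> max 1 x + max 1 y" using assms by auto
  also have "\<dots> \<le> max 1 x * max 1 y * 2"
  proof -
    have "max 1 x * 1 \<le> max 1 x * max 1 y" "1 * max 1 y \<le> max 1 x * max 1 y"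
      by (intro mult_left_mono mult_right_mono; simp)+
    thus ?thesis by linarith
  qed
  finally have "ln (max 1 (x + y)) \<le> ln (max 1 x * max 1 y * 2)" by (intro ln_mono) auto
  also have "\<dots> = log_plus x + log_plus y + ln 2"
    by (simp add: log_plus_def ln_mult less_max_iff_disj less_imp_neq[symmetric])
  finally show ?thesis by (simp add: log_plus_def)
qed

lemma proximity_diff_const:
  assumes w: "w holomorphic_on UNIV" and r: "r \<ge> 0"
  shows "proximity r w \<le> proximity r (\<lambda>z. w z - b) + log_plus (norm b) + ln 2"
    and "proximity r (\<lambda>z. w z - b) \<le> proximity r w + log_plus (norm b) + ln 2"
proof -
  have *: "proximity r u \<le> proximity r v + log_plus (norm b) + ln 2"
    if u: "u holomorphic_on UNIV" and v: "v holomorphic_on UNIV" and uv: "\<And>z. norm (u z) \<le> norm (v z) + norm b"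
    for u v
  proof -
    have "proximity r u \<le> circle_mean r (\<lambda>z. log_plus (norm (v z)) + (log_plus (norm b) + ln 2))"
      unfolding proximity_eq_circle_mean
    proof (rule circle_mean_mono)
      show "log_plus (norm (u z)) \<le> log_plus (norm (v z)) + (log_plus (norm b) + ln 2)" for z
        using log_plus_mono[OF uv[of z]] log_plus_add_le[of "norm (v z)" "norm b"] by simp
    qed (use u v r in \<open>auto intro!: continuous_intros continuous_on_entire\<close>)
    also have "\<dots> = proximity r v + (log_plus (norm b) + ln 2)"
      unfolding proximity_eq_circle_mean
      by (subst circle_mean_add) (use v r in \<open>auto intro!: continuous_intros continuous_on_entire\<close>)
    finally show ?thesis by simp
  qed
  show "proximity r w \<le> proximity r (\<lambda>z. w z - b) + log_plus (norm b) + ln 2"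
  proof (rule *[OF w])
    show "norm (w z) \<le> norm (w z - b) + norm b" for z
      using norm_triangle_ineq[of "w z - b" b] by simp
  qed (intro holomorphic_intros w)
  show "proximity r (\<lambda>z. w z - b) \<le> proximity r w + log_plus (norm b) + ln 2"
  proof (rule *[OF _ w])
    show "norm (w z - b) \<le> norm (w z) + norm b" for z
      by (rule norm_triangle_ineq4)
  qed (intro holomorphic_intros w)
qed

section \<open>The entire function H and the multiple b-points\<close>

context difference_equation
begin

text \<open>By the equation this is (A w' - A0) / w wherever \<open>w\<close> is nonzero, written in
  a form that is visibly entire.\<close>

definition H :: "complex \<Rightarrow> complex" where
  "H z = poly A2 z * w z + poly A1 z - poly q z * (w (z + 1) - w (z - 1))"

lemma holomorphic_H: "H holomorphic_on UNIV"
proof -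
  have sh: "(\<lambda>z. w (z + c)) holomorphic_on UNIV" for c
    using holomorphic_on_compose_gen[of "\<lambda>z. z + c" UNIV w UNIV] w
    by (simp add: o_def holomorphic_intros)
  show ?thesis
    unfolding H_def using sh[of 1] sh[of "- 1"] w by (intro holomorphic_intros) simp_all
qed

lemma H_mult: "H z * w z = poly A z * deriv w z - poly A0 z"
  using eq[of z] unfolding H_def by (simp add: algebra_simps power2_eq_square)

lemma holomorphic_shift: "(\<lambda>z. H z * b + poly A0 z) holomorphic_on UNIV"
  by (intro holomorphic_intros holomorphic_H)

text \<open>With g = w - b the identity reads H b + A0 = A g' - H g, and both terms on the right
  contain \<open>(z - a) ^ n\<close>.\<close>

lemma H_factor:
  assumes k: "k holomorphic_on UNIV" "\<And>z. w z - b = (z - a) ^ Suc n * k z"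
  shows "H z * b + poly A0 z =
     (z - a) ^ n * (poly A z * (of_nat (Suc n) * k z + (z - a) * deriv k z) - (z - a) * H z * k z)"
proof -
  have weq: "w = (\<lambda>z. (z - a) ^ Suc n * k z + b)"
    using k(2) by (intro ext) (simp only: diff_eq_eq)
  have "((\<lambda>z. (z - a) ^ Suc n) has_field_derivative of_nat (Suc n) * (z - a) ^ n) (at z)"
    by (auto intro!: derivative_eq_intros simp del: power_Suc)
  moreover have "(k has_field_derivative deriv k z) (at z)"
    using k(1) by (simp add: holomorphic_derivI[of _ UNIV])
  ultimately have "((\<lambda>z. (z - a) ^ Suc n * k z + b) has_field_derivative
      of_nat (Suc n) * (z - a) ^ n * k z + deriv k z * (z - a) ^ Suc n + 0) (at z)"
    by (intro DERIV_add DERIV_mult DERIV_const)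
  hence "deriv w z = of_nat (Suc n) * (z - a) ^ n * k z + deriv k z * (z - a) ^ Suc n + 0"
    unfolding weq by (rule DERIV_imp_deriv)
  also have "\<dots> = (z - a) ^ n * (of_nat (Suc n) * k z + (z - a) * deriv k z)"
    by (simp only: power_Suc ring_distribs mult_ac add_0_right)
  finally have d: "deriv w z = (z - a) ^ n * (of_nat (Suc n) * k z + (z - a) * deriv k z)" .
  have "w z = (z - a) ^ Suc n * k z + b" using k(2)[of z] by (simp add: algebra_simps)
  with H_mult[of z] have "H z * ((z - a) ^ Suc n * k z + b) + poly A0 z = poly A z * deriv w z"
    by simp
  thus ?thesis unfolding d by (simp add: algebra_simps)
qed

lemma zmult_le_zmult_H:
  assumes a: "w a = b" and nz: "H z0 * b + poly A0 z0 \<noteq> 0"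
  shows "zmult (\<lambda>z. w z - b) a \<le> zmult (\<lambda>z. H z * b + poly A0 z) a + 1"
proof -
  let ?g = "\<lambda>z. w z - b"
  have g: "?g holomorphic_on UNIV" by (intro holomorphic_intros w)
  obtain z1 where z1: "?g z1 \<noteq> 0" using nonconst[of b] by auto
  obtain k where k: "k holomorphic_on UNIV" "k a \<noteq> 0" "\<And>z. ?g z = (z - a) ^ zmult ?g a * k z"
    using zmult_factor[OF g z1, of a] by blast
  have "zmult ?g a \<noteq> 0" using zmult_zero_iff[OF g z1, of a] a by simp
  then obtain n where n: "zmult ?g a = Suc n" using not0_implies_Suc by blast
  note k3 = k(3)[unfolded n]
  have "n \<le> zmult (\<lambda>z. H z * b + poly A0 z) a"
  proof (rule zmult_ge[OF holomorphic_shift nz])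
    show "(\<lambda>z. poly A z * (of_nat (Suc n) * k z + (z - a) * deriv k z) - (z - a) * H z * k z) holomorphic_on UNIV"
      by (intro holomorphic_intros holomorphic_H k(1) holomorphic_deriv open_UNIV)
    show "H z * b + poly A0 z = (z - a) ^ n *
            (poly A z * (of_nat (Suc n) * k z + (z - a) * deriv k z) - (z - a) * H z * k z)" for z
      by (rule H_factor[OF k(1) k3])
  qed
  thus ?thesis using n by simp
qed

text \<open>If H b + A0 vanishes identically, so does the cofactor of \<open>(z - a) ^ n\<close>.
  Its value at a b-point \<open>a\<close> of multiplicity n + 1 is (n + 1) A(a) k(a), hence every
  b-point is a root of \<open>A\<close>.\<close>

lemma finite_value_set:
  assumes f0: "\<And>z. H z * b + poly A0 z = 0"
  shows "finite {a. w a - b = 0}"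
proof -
  let ?g = "\<lambda>z. w z - b"
  have g: "?g holomorphic_on UNIV" by (intro holomorphic_intros w)
  obtain z1 where z1: "?g z1 \<noteq> 0" using nonconst[of b] by auto
  have sub: "{a. w a - b = 0} \<subseteq> {a. poly A a = 0}"
  proof
    fix a assume a: "a \<in> {a. w a - b = 0}"
    obtain k where k: "k holomorphic_on UNIV" "k a \<noteq> 0" "\<And>z. ?g z = (z - a) ^ zmult ?g a * k z"
      using zmult_factor[OF g z1, of a] by blast
    have "zmult ?g a \<noteq> 0" using zmult_zero_iff[OF g z1, of a] a by simp
    then obtain n where n: "zmult ?g a = Suc n" using not0_implies_Suc by blast
  note k3 = k(3)[unfolded n]
    define E where "E = (\<lambda>z. poly A z * (of_nat (Suc n) * k z + (z - a) * deriv k z) - (z - a) * H z * k z)"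
    have "E a = (\<lambda>_. 0) a"
    proof (rule continuous_eq_at_point[where f = E and g = "\<lambda>_. 0"])
      show "continuous_on UNIV E" unfolding E_def
        by (intro holomorphic_on_imp_continuous_on holomorphic_intros holomorphic_H k(1) holomorphic_deriv open_UNIV)
      show "E z = 0" if "z \<noteq> a" for z
        using H_factor[OF k(1) k3, of z] f0[of z] that by (simp add: E_def)
    qed (rule continuous_on_const)
    hence "poly A a * (of_nat (Suc n) * k a) = 0" by (simp add: E_def)
    hence "poly A a = 0" using k(2) by (simp del: of_nat_Suc)
    thus "a \<in> {a. poly A a = 0}" by simp
  qed
  \<comment> \<open>For A = 0 the product A0 (w - b) would vanish identically, and the unit disc
    would be covered by finitely many zeros.\<close>
  have "A \<noteq> 0"
  proof
    assume A: "A = 0"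
    have "poly A0 z * (w z - b) = 0" for z
    proof -
      have "poly A0 z = - (H z * b)" using f0[of z] by (simp add: add_eq_0_iff)
      moreover have "H z * w z = - poly A0 z" using H_mult[of z] A by simp
      ultimately have "poly A0 z * w z = poly A0 z * b" by (simp add: algebra_simps)
      thus ?thesis by (simp add: algebra_simps)
    qed
    hence "cball 0 1 \<subseteq> {z. poly A0 z = 0} \<union> {z. norm z \<le> 1 \<and> w z - b = 0}" by auto
    moreover have "finite ({z. poly A0 z = 0} \<union> {z. norm z \<le> 1 \<and> w z - b = 0})"
      using finite_zeros[OF g z1] poly_roots_finite[OF A0] by simp
    ultimately have "finite (cball (0 :: complex) 1)" by (rule finite_subset)
    thus False using uncountable_cball[of 1 "0 :: complex"] by (auto dest: countable_finite)
  qed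
  from finite_subset[OF sub poly_roots_finite[OF this]] show ?thesis .
qed

end

section \<open>Averaging the pointwise estimates over zero-free circles\<close>

context difference_equation
begin

text \<open>The left-hand side minus \<open>log_mean\<close> is the proximity function of 1/(w - b),
  which is thereby bounded by the mean of \<open>X\<close> and a logarithm.\<close>

lemma proximity_le_log_mean:
  assumes B: "smult (b\<^sup>2) A2 + smult b A1 + A0 \<noteq> 0"
  obtains K C \<rho> where "\<rho> \<ge> 1" "\<forall>r X. r \<ge> \<rho> \<longrightarrow> zero_free_circle (\<lambda>z. w z - b) r \<longrightarrow>
      log_quotient_bound (\<lambda>z. w z - b) r X \<longrightarrow>
      proximity r (\<lambda>z. w z - b) \<le> log_mean (\<lambda>z. w z - b) r + circle_mean r X + K * ln r + C"
proof -
  obtain K C \<rho> where K: "\<rho> \<ge> 1" "C \<ge> 0" "\<forall>r X z. r \<ge> \<rho> \<longrightarrow> log_quotient_bound (\<lambda>z. w z - b) r X \<longrightarrow> norm z = r \<longrightarrow>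
      w z \<noteq> b \<longrightarrow> log_plus (norm (w z - b)) \<le> ln (norm (w z - b)) + X z + real K * ln r + C"
    by (rule log_plus_le_of_nonsolution[OF B])
  note K = K(1,2) K(3)[rule_format]
  have g: "(\<lambda>z. w z - b) holomorphic_on UNIV" by (intro holomorphic_intros w)
  show ?thesis
  proof (rule that[OF K(1)], intro allI impI)
    fix r X assume r: "\<rho> \<le> r" "zero_free_circle (\<lambda>z. w z - b) r" and X: "log_quotient_bound (\<lambda>z. w z - b) r X"
    have cX: "continuous_on (sphere 0 r) X" using X by (simp add: log_quotient_bound_def)
    have cl: "continuous_on (sphere 0 r) (\<lambda>z. ln (norm (w z - b)))"
      using continuous_on_ln_norm[OF g r(2)] .
    have r0: "r \<ge> 0" using r K(1) by linarith
    have "proximity r (\<lambda>z. w z - b) \<le> circle_mean r (\<lambda>z. (ln (norm (w z - b)) + X z) + (real K * ln r + C))"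
      unfolding proximity_eq_circle_mean
    proof (rule circle_mean_mono)
      show "continuous_on (sphere 0 r) (\<lambda>z. log_plus (norm (w z - b)))"
        by (intro continuous_on_log_plus continuous_on_norm continuous_on_entire g)
      show "continuous_on (sphere 0 r) (\<lambda>z. (ln (norm (w z - b)) + X z) + (real K * ln r + C))"
        by (intro continuous_on_add cl cX continuous_on_const)
      fix z :: complex assume z: "norm z = r"
      show "log_plus (norm (w z - b)) \<le> (ln (norm (w z - b)) + X z) + (real K * ln r + C)"
        using K(3)[OF r(1) X z] r(2) z by (simp add: zero_free_circle_def)
    qed (fact r0)
    also have "\<dots> = log_mean (\<lambda>z. w z - b) r + circle_mean r X + (real K * ln r + C)"
      unfolding log_mean_def
      by (simp only: circle_mean_add[OF continuous_on_add[OF cl cX] continuous_on_const r0]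
            circle_mean_add[OF cl cX r0] circle_mean_const)
    finally show "proximity r (\<lambda>z. w z - b) \<le> log_mean (\<lambda>z. w z - b) r + circle_mean r X + real K * ln r + C"
      by simp
  qed
qed

text \<open>From H = A w'/w - A0/w: the first quotient is bounded by exp (X z) times a power of
  \<open>r\<close>, the second by the lower bound on |w| below. As exp (X z) enters only to the
  first power, the mean of \<open>X\<close> appears once.\<close>

lemma proximity_H_le:
  obtains K C \<rho> where "\<rho> \<ge> 1" "\<forall>r X. r \<ge> \<rho> \<longrightarrow> zero_free_circle w r \<longrightarrow> log_quotient_bound w r X \<longrightarrow>
      proximity r (\<lambda>z. H z * b + poly A0 z) \<le> circle_mean r X + K * ln r + C"
proof -
  \<comment> \<open>The value 0 is never a solution because \<open>A0\<close> is nonzero, so 1/w is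
    controlled for every choice of \<open>b\<close>.\<close>
  have B0: "smult (0\<^sup>2) A2 + smult 0 A1 + A0 \<noteq> 0" using A0 by simp
  obtain K C \<rho>1 where K: "\<rho>1 \<ge> 1" "C \<ge> 0" "\<forall>r X z. r \<ge> \<rho>1 \<longrightarrow> log_quotient_bound w r X \<longrightarrow> norm z = r \<longrightarrow>
      w z \<noteq> 0 \<longrightarrow> log_plus (norm (w z)) \<le> ln (norm (w z)) + X z + real K * ln r + C"
    by (rule log_plus_le_of_nonsolution[OF B0, unfolded diff_0_right])
  note K = K(1,2) K(3)[rule_format]
  obtain M \<rho>2 where M: "\<rho>2 \<ge> 1"
    "\<forall>z. \<forall>p\<in>{q, A, A2, A1, A0, smult (2 * b) A2 + A1}. norm z \<ge> \<rho>2 \<longrightarrow> norm (poly p z) \<le> norm z ^ M"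
    by (rule coefficient_bound[of b])
  define C' where "C' = C + ln (2 * norm b + 1)"
  show ?thesis
  proof (rule that[of "max \<rho>1 \<rho>2" "real (M + K)" C'], goal_cases)
    case 1
    show ?case using K(1) by simp
  next
    case 2
    show ?case
    proof (intro allI impI)
      fix r X assume r: "max \<rho>1 \<rho>2 \<le> r" "zero_free_circle w r" and X: "log_quotient_bound w r X"
      have cX: "continuous_on (sphere 0 r) X" using X by (simp add: log_quotient_bound_def)
      have r1: "r \<ge> 1" "r \<ge> 0" using r K(1) by simp_all
      have "proximity r (\<lambda>z. H z * b + poly A0 z) \<le> circle_mean r (\<lambda>z. X z + (real (M + K) * ln r + C'))"
        unfolding proximity_eq_circle_mean
      proof (rule circle_mean_mono)
        show "continuous_on (sphere 0 r) (\<lambda>z. log_plus (norm (H z * b + poly A0 z)))"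
          by (intro continuous_on_log_plus continuous_on_norm continuous_on_entire holomorphic_shift)
        show "continuous_on (sphere 0 r) (\<lambda>z. X z + (real (M + K) * ln r + C'))"
          by (intro continuous_on_add cX continuous_on_const)
        fix z :: complex assume z: "norm z = r"
        have w0: "w z \<noteq> 0" using r(2) z by (simp add: zero_free_circle_def)
        have X0: "X z \<ge> 0" using log_quotient_bound_nonneg[OF X z w0] .
        have Mz: "norm (poly p z) \<le> r ^ M" if "p \<in> {q, A, A2, A1, A0, smult (2 * b) A2 + A1}" for p
          using bspec[OF spec[OF M(2), of z] that] r z by simp
        define E where "E = exp (X z)"
        define J where "J = exp (real K * ln r + C)"
        have E1: "E \<ge> 1" and J1: "J \<ge> 1" using X0 r1 K(2) by (simp_all add: E_def J_def)
        have dw: "norm (deriv w z) \<le> E * norm (w z)"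
          using X z by (simp add: log_quotient_bound_def E_def)
        have "0 \<le> ln (norm (w z)) + (X z + (real K * ln r + C))"
          using K(3)[OF _ X z w0] r(1) log_plus_nonneg[of "norm (w z)"] by simp
        hence "exp 0 \<le> exp (ln (norm (w z)) + (X z + (real K * ln r + C)))" by (simp only: exp_le_cancel_iff)
        hence wJ: "1 \<le> norm (w z) * (E * J)" using w0 by (simp add: exp_add E_def J_def)
        have rM: "r ^ M \<ge> 1" using r1 by simp
        have "norm (H z) * norm (w z) = norm (poly A z * deriv w z - poly A0 z)"
          by (simp add: H_mult flip: norm_mult)
        also have "\<dots> \<le> norm (poly A z) * norm (deriv w z) + norm (poly A0 z)"
          by (metis norm_mult norm_triangle_ineq4)
        also have "\<dots> \<le> r ^ M * (E * norm (w z)) + r ^ M * (norm (w z) * (E * J))"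
        proof (intro add_mono mult_mono)
          have "norm (poly A0 z) * 1 \<le> r ^ M * (norm (w z) * (E * J))"
            using wJ Mz[of A0] rM by (intro mult_mono) auto
          thus "norm (poly A0 z) \<le> r ^ M * (norm (w z) * (E * J))" by simp
        qed (use Mz[of A] dw rM in auto)
        also have "\<dots> = (r ^ M * E * (1 + J)) * norm (w z)" by (simp add: algebra_simps)
        finally have Hz: "norm (H z) \<le> r ^ M * E * (1 + J)"
          by (rule mult_right_le_imp_le) (use w0 in simp)
        have "norm (H z * b + poly A0 z) \<le> norm (H z) * norm b + norm (poly A0 z)"
          by (metis norm_mult norm_triangle_ineq)
        also have "\<dots> \<le> (r ^ M * E * (1 + J)) * norm b + r ^ M * (E * J)"
        proof (intro add_mono mult_right_mono Hz)
          have "r ^ M * 1 \<le> r ^ M * (E * J)"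
            using rM E1 J1 mult_mono[of 1 E 1 J] by (intro mult_left_mono) auto
          thus "norm (poly A0 z) \<le> r ^ M * (E * J)" using Mz[of A0] by simp
        qed auto
        also have "\<dots> \<le> (r ^ M * E * (J + J)) * norm b + r ^ M * (E * J)"
          using rM E1 J1 by (intro add_mono mult_right_mono mult_left_mono) auto
        also have "\<dots> = E * J * r ^ M * (2 * norm b + 1)" by (simp add: algebra_simps)
        also have "\<dots> = exp (X z + (real (M + K) * ln r + C'))"
        proof -
          have "r ^ M = exp (real M * ln r)" using r1 by (simp add: exp_of_nat_mult)
          moreover have "exp (ln (2 * norm b + 1)) = 2 * norm b + 1"
            by (rule exp_ln) (use norm_ge_zero[of b] in linarith)
          ultimately show ?thesis
            by (simp add: E_def J_def C'_def ring_distribs exp_add mult_ac)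
        qed
        finally show "log_plus (norm (H z * b + poly A0 z)) \<le> X z + (real (M + K) * ln r + C')"
          using X0 r1 K(2) by (subst log_plus_le_iff) (auto simp: C'_def)
      qed (fact r1)
      also have "\<dots> = circle_mean r X + (real (M + K) * ln r + C')"
        by (simp only: circle_mean_add[OF cX continuous_on_const r1(2)] circle_mean_const)
      finally show "proximity r (\<lambda>z. H z * b + poly A0 z) \<le> circle_mean r X + real (M + K) * ln r + C'"
        by simp
    qed
  qed
qed

text \<open>The chain from the characteristic to \<open>log_mean\<close> of w - b, and from there to
  the reduced counting function. The function \<open>f\<close> is H b + A0, unless this vanishes
  identically; it is exposed so that circles through its zeros can be avoided.\<close>

lemma proximity_le_nev_Nbar:
  assumes B: "smult (b\<^sup>2) A2 + smult b A1 + A0 \<noteq> 0"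
  obtains f z0 K C \<rho> where "f holomorphic_on UNIV" "f z0 \<noteq> 0" "\<rho> \<ge> 1"
    "\<forall>r X Y. r \<ge> \<rho> \<longrightarrow> zero_free_circle w r \<longrightarrow> zero_free_circle (\<lambda>z. w z - b) r \<longrightarrow> zero_free_circle f r \<longrightarrow>
      log_quotient_bound (\<lambda>z. w z - b) r X \<longrightarrow> log_quotient_bound w r Y \<longrightarrow>
      proximity r w \<le> nev_Nbar r (\<lambda>z. 1 / (w z - b)) + circle_mean r X + circle_mean r Y + K * ln r + C"
proof -
  let ?g = "\<lambda>z. w z - b"
  have g: "?g holomorphic_on UNIV" by (intro holomorphic_intros w)
  obtain z1 where z1: "?g z1 \<noteq> 0" using nonconst[of b] by auto
  obtain K1 C1 \<rho>1 where g1: "\<rho>1 \<ge> 1" "\<forall>r X. r \<ge> \<rho>1 \<longrightarrow> zero_free_circle ?g r \<longrightarrow> log_quotient_bound ?g r X \<longrightarrow>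
      proximity r ?g \<le> log_mean ?g r + circle_mean r X + K1 * ln r + C1"
    by (rule proximity_le_log_mean[OF B])
  note g1 = g1(1) g1(2)[rule_format]
  define C0 where "C0 = log_plus (norm b) + ln 2"
  have C0: "proximity r w \<le> proximity r ?g + C0" if "r \<ge> 0" for r
    using proximity_diff_const(1)[OF w that, of b] by (simp add: C0_def)
  show ?thesis
  proof (cases "\<forall>z. H z * b + poly A0 z = 0")
    case True
    have fin: "finite {a. ?g a = 0}" by (rule finite_value_set) (use True in blast)
    obtain K C where K: "\<And>r. r \<ge> 1 \<Longrightarrow> zero_free_circle ?g r \<Longrightarrow> log_mean ?g r \<le> K * ln r + C"
      using log_mean_le_ln[OF g z1 fin] by blast
    show ?thesis
    \<comment> \<open>Degenerate case: \<open>w - b\<close> has finitely many zeros, so its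
      \<open>log_mean\<close> is O(ln r) and the constant 1 can stand for \<open>f\<close>.\<close>
    proof (rule that[of "\<lambda>_. 1" 0 \<rho>1 "K1 + K" "C1 + C + C0"], goal_cases)
      case 4
      show ?case
      proof (intro allI impI)
        fix r X Y assume r: "\<rho>1 \<le> r" "zero_free_circle w r" "zero_free_circle ?g r" 
          and X: "log_quotient_bound ?g r X" and Y: "log_quotient_bound w r Y"
        have r1: "r \<ge> 1" "r \<ge> 0" using r(1) g1(1) by simp_all
        have "circle_mean r (\<lambda>_. 0) \<le> circle_mean r Y"
        proof (rule circle_mean_mono)
          show "continuous_on (sphere 0 r) Y" using Y by (simp add: log_quotient_bound_def)
          show "0 \<le> Y z" if "norm z = r" for z
            using log_quotient_bound_nonneg[OF Y that] r(2) that by (simp add: zero_free_circle_def)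
        qed (use r1 in auto)
        hence "0 \<le> circle_mean r Y" by simp
        thus "proximity r w \<le> nev_Nbar r (\<lambda>z. 1 / ?g z) + circle_mean r X + circle_mean r Y +
                (K1 + K) * ln r + (C1 + C + C0)"
          using g1(2)[OF r(1) r(3) X] K[OF r1(1) r(3)] C0[OF r1(2)] nev_Nbar_inverse_nonneg[OF g z1 r1(1)]
          by (simp add: ring_distribs)
      qed
    qed (use g1(1) in auto)
  next
    case False
    then obtain z0 where z0: "H z0 * b + poly A0 z0 \<noteq> 0" by blast
    let ?f = "\<lambda>z. H z * b + poly A0 z"
    have "zmult ?g a \<le> zmult ?f a + 1" if "?g a = 0" for a
      by (rule zmult_le_zmult_H[OF _ z0]) (use that in simp)
    then obtain C where C: "\<And>r. r \<ge> 1 \<Longrightarrow> zero_free_circle ?g r \<Longrightarrow> zero_free_circle ?f r \<Longrightarrow>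
        log_mean ?g r \<le> nev_Nbar r (\<lambda>z. 1 / ?g z) + proximity r ?f + C"
      using log_mean_le_nev_Nbar[OF g z1 holomorphic_shift z0] by blast
    obtain K2 C2 \<rho>2 where f2: "\<rho>2 \<ge> 1" "\<forall>r X. r \<ge> \<rho>2 \<longrightarrow> zero_free_circle w r \<longrightarrow> log_quotient_bound w r X \<longrightarrow>
      proximity r ?f \<le> circle_mean r X + K2 * ln r + C2"
      by (rule proximity_H_le)
    note f2 = f2(1) f2(2)[rule_format]
    show ?thesis
    proof (rule that[OF holomorphic_shift z0, of "max \<rho>1 \<rho>2" "K1 + K2" "C0 + C1 + C2 + C"], goal_cases)
      case 2
      show ?case
      proof (intro allI impI)
        fix r X Y assume r: "max \<rho>1 \<rho>2 \<le> r" "zero_free_circle w r" "zero_free_circle ?g r" "zero_free_circle ?f r"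
          and X: "log_quotient_bound ?g r X" and Y: "log_quotient_bound w r Y"
        have r1: "r \<ge> 1" "r \<ge> 0" "\<rho>1 \<le> r" "\<rho>2 \<le> r" using r(1) g1(1) by simp_all
        show "proximity r w \<le> nev_Nbar r (\<lambda>z. 1 / ?g z) + circle_mean r X + circle_mean r Y +
                (K1 + K2) * ln r + (C0 + C1 + C2 + C)"
          using g1(2)[OF r1(3) r(3) X] f2(2)[OF r1(4) r(2) Y] C[OF r1(1) r(3,4)] C0[OF r1(2)]
          by (simp add: ring_distribs)
      qed
    qed (use g1(1) in auto)
  qed
qed

end

section \<open>Growth along a progression\<close>

text \<open>If every late step multiplied the sequence by more than 1 + \<epsilon>, it would grow at
  least exponentially.\<close>

lemma slow_growth_step:
  fixes \<Phi> :: "nat \<Rightarrow> real"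
  assumes pos: "\<And>n. \<Phi> n > 0" and slow: "\<And>\<delta>. \<delta> > 0 \<Longrightarrow> \<forall>\<^sub>F n in sequentially. \<Phi> n \<le> exp (\<delta> * real n)"
    and e: "\<epsilon> > 0"
  shows "\<exists>\<^sub>F n in sequentially. \<Phi> (Suc n) \<le> (1 + \<epsilon>) * \<Phi> n"
proof (rule ccontr)
  assume "\<not> ?thesis"
  hence "\<forall>\<^sub>F n in sequentially. (1 + \<epsilon>) * \<Phi> n < \<Phi> (Suc n)"
    by (simp add: not_frequently not_le)
  then obtain N where N: "\<And>n. n \<ge> N \<Longrightarrow> (1 + \<epsilon>) * \<Phi> n < \<Phi> (Suc n)"
    unfolding eventually_sequentially by blast
  \<comment> \<open>Half the exponential rate forced by the steps, so that the forced growth beats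
    the assumed bound.\<close>
  define \<delta> where "\<delta> = ln (1 + \<epsilon>) / 2"
  have \<delta>: "\<delta> > 0" using e by (simp add: \<delta>_def)
  have e2: "1 + \<epsilon> = exp (2 * \<delta>)" using e by (simp add: \<delta>_def)
  have lower: "exp (2 * \<delta> * real k) * \<Phi> N \<le> \<Phi> (N + k)" for k
  proof (induction k)
    case (Suc k)
    have "exp (2 * \<delta> * real (Suc k)) * \<Phi> N = exp (2 * \<delta>) * (exp (2 * \<delta> * real k) * \<Phi> N)"
      by (simp add: exp_add[symmetric] ring_distribs)
    also have "\<dots> \<le> exp (2 * \<delta>) * \<Phi> (N + k)" using Suc by (intro mult_left_mono) auto
    also have "\<dots> \<le> \<Phi> (N + Suc k)" using N[of "N + k"] e2 by simp
    finally show ?case .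
  qed simp
  obtain M where M: "\<And>n. n \<ge> M \<Longrightarrow> \<Phi> n \<le> exp (\<delta> * real n)"
    using slow[OF \<delta>] by (auto simp: eventually_sequentially)
  have "filterlim (\<lambda>k. exp (\<delta> * real k)) at_top sequentially"
    by (intro filterlim_compose[OF exp_at_top] filterlim_tendsto_pos_mult_at_top[OF tendsto_const \<delta>]
          filterlim_real_sequentially)
  hence "\<forall>\<^sub>F k in sequentially. exp (\<delta> * real k) > exp (\<delta> * real N) / \<Phi> N"
    by (simp add: filterlim_at_top_dense)
  then obtain k0 where "\<forall>k\<ge>k0. exp (\<delta> * real k) > exp (\<delta> * real N) / \<Phi> N"
    by (auto simp: eventually_sequentially)
  then obtain k where k: "k \<ge> M" "exp (\<delta> * real k) > exp (\<delta> * real N) / \<Phi> N"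
    by (meson max.cobounded1 max.cobounded2)
  have "exp (2 * \<delta> * real k) * \<Phi> N \<le> exp (\<delta> * real (N + k))"
    using lower[of k] M[of "N + k"] k(1) by simp
  also have "exp (2 * \<delta> * real k) = exp (\<delta> * real k) * exp (\<delta> * real k)"
    by (simp add: exp_add[symmetric])
  also have "exp (\<delta> * real (N + k)) = exp (\<delta> * real k) * exp (\<delta> * real N)"
    by (simp add: exp_add[symmetric] ring_distribs)
  finally have "exp (\<delta> * real k) * (exp (\<delta> * real k) * \<Phi> N) \<le> exp (\<delta> * real k) * exp (\<delta> * real N)"
    by (simp only: mult.assoc)
  hence "exp (\<delta> * real k) * \<Phi> N \<le> exp (\<delta> * real N)"
    by (rule mult_left_le_imp_le) simp
  with k(2) pos[of N] show False by (simp add: divide_less_eq)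
qed

lemma subexponential_progression:
  fixes r0 k c D E \<delta> :: real
  assumes "r0 > 0" "k > 0" "c < 1" "\<delta> > 0" "D \<ge> 0" "E \<ge> 0"
  shows "\<forall>\<^sub>F n in sequentially. D * exp ((r0 + real n * k) powr c) + E \<le> exp (\<delta> * real n)"
proof -
  \<comment> \<open>A positive exponent, still below 1, makes the power monotone in its base; since
    \<open>c\<close> may be negative it is enlarged.\<close>
  define c' where "c' = max c (1/2)"
  have c': "0 < c'" "c' < 1" "c \<le> c'" using assms by (auto simp: c'_def)
  have "((\<lambda>n. (r0 + k) powr c' * real n powr (c' - 1)) \<longlongrightarrow> (r0 + k) powr c' * 0) sequentially"
    using c' by (intro tendsto_intros tendsto_neg_powr filterlim_real_sequentially) auto
  hence ev1: "\<forall>\<^sub>F n in sequentially. (r0 + k) powr c' * real n powr (c' - 1) < \<delta> / 2"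
    by (rule order_tendstoD) (use assms in simp)
  have "filterlim (\<lambda>n. exp (\<delta> / 2 * real n)) at_top sequentially"
    by (intro filterlim_compose[OF exp_at_top] filterlim_tendsto_pos_mult_at_top[OF tendsto_const]
          filterlim_real_sequentially) (use assms in simp)
  hence ev2: "\<forall>\<^sub>F n in sequentially. exp (\<delta> / 2 * real n) > D + E"
    by (simp add: filterlim_at_top_dense)
  have "filterlim (\<lambda>n. real n * k) at_top sequentially"
    by (subst mult.commute) (intro filterlim_tendsto_pos_mult_at_top[OF tendsto_const] filterlim_real_sequentially assms)
  hence ev3: "\<forall>\<^sub>F n in sequentially. real n * k > 1"
    by (simp add: filterlim_at_top_dense)
  show ?thesis
    using ev1 ev2 ev3 eventually_ge_at_top[of 1]
  proof eventually_elim
    case (elim n)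
    have n: "real n \<ge> 1" using elim by simp
    have "(r0 + real n * k) powr c \<le> (r0 + real n * k) powr c'"
      using elim assms c' by (intro powr_mono) auto
    also have "\<dots> \<le> (real n * (r0 + k)) powr c'"
      using n assms c' mult_right_mono[of 1 "real n" r0] by (intro powr_mono2) (auto simp: ring_distribs)
    also have "\<dots> = real n * ((r0 + k) powr c' * real n powr (c' - 1))"
      using n assms by (simp add: powr_mult powr_diff)
    also have "\<dots> \<le> real n * (\<delta> / 2)" using elim n by (intro mult_left_mono) auto
    finally have le: "exp ((r0 + real n * k) powr c) \<le> exp (\<delta> / 2 * real n)" by (simp add: mult.commute)
    have "D * exp ((r0 + real n * k) powr c) + E \<le> D * exp (\<delta> / 2 * real n) + E * exp (\<delta> / 2 * real n)"
      using le assms mult_left_mono[of 1 "exp (\<delta> / 2 * real n)" E] by (intro add_mono mult_left_mono) auto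
    also have "\<dots> = (D + E) * exp (\<delta> / 2 * real n)" by (simp add: ring_distribs)
    also have "\<dots> \<le> exp (\<delta> / 2 * real n) * exp (\<delta> / 2 * real n)"
      using elim by (intro mult_right_mono) auto
    also have "\<dots> = exp (\<delta> * real n)" by (simp add: exp_add[symmetric])
    finally show ?case .
  qed
qed

section \<open>Comparison of the reduced counting function with the characteristic\<close>

lemma countable_zeros:
  assumes "g holomorphic_on UNIV" "g w0 \<noteq> 0"
  shows "countable {a. g a = 0}"
proof -
  have "{a. g a = 0} = (\<Union>n::nat. {a. norm a \<le> real n \<and> g a = 0})"
  proof (intro equalityI subsetI)
    fix a assume "a \<in> {a. g a = 0}"
    moreover obtain n :: nat where "norm a \<le> real n" using real_arch_simple by blast
    ultimately show "a \<in> (\<Union>n::nat. {a. norm a \<le> real n \<and> g a = 0})" by blast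
  qed auto
  also have "countable \<dots>"
    by (rule countable_UN) (auto intro: countable_finite[OF finite_zeros[OF assms]])
  finally show ?thesis .
qed

text \<open>Each pair of a zero and an index excludes only one starting value, so countably many are
  excluded from an uncountable interval.\<close>

lemma zero_free_progression:
  assumes Z: "countable Z" and s: "s < t"
  obtains r0 :: real where "s < r0" "r0 < t" "\<forall>n. \<forall>z\<in>Z. norm (z :: complex) \<noteq> r0 + real n * k"
proof -
  let ?B = "\<Union>n. (\<lambda>z. norm z - real n * k) ` Z"
  have "countable ?B" using Z by (intro countable_UN countable_image) auto
  moreover have "uncountable {s<..<t}" using s by (simp add: uncountable_open_interval)
  ultimately obtain r0 where "r0 \<in> {s<..<t}" "r0 \<notin> ?B"
    by (meson countable_subset subsetI)
  have "norm z \<noteq> r0 + real n * k" if "z \<in> Z" for n z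
  proof
    assume "norm z = r0 + real n * k"
    hence "r0 = norm z - real n * k" by simp
    with \<open>r0 \<notin> ?B\<close> that show False by blast
  qed
  thus ?thesis using \<open>r0 \<in> {s<..<t}\<close> by (intro that[of r0]) auto
qed

lemma log_quotient_bound_exists:
  assumes g: "g holomorphic_on UNIV" and nz: "g w0 \<noteq> 0"
    and r: "0 < r" "r + 2 \<le> R" "zero_free_circle g r" "zero_free_circle g R"
  shows "\<exists>X. log_quotient_bound g r X \<and>
    circle_mean r X = log_mean g R - log_mean g r + 4 / (R - r) * (2 * proximity R g - log_mean g R)"
  by (rule log_difference[OF assms]) (auto simp: log_quotient_bound_def)

context difference_equation
begin

lemma frequently_nev_Nbar_ge:
  assumes tr: "\<not> rational_function w"
    and growth: "\<forall>\<^sub>F r in at_top. proximity r w \<le> exp (r powr c)" and c: "c < 1"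
    and B: "smult (b\<^sup>2) A2 + smult b A1 + A0 \<noteq> 0" and e: "\<epsilon> > 0"
  shows "\<exists>\<^sub>F r in at_top. (1 - \<epsilon>) * proximity r w \<le> nev_Nbar r (\<lambda>z. 1 / (w z - b))"
proof -
  let ?g = "\<lambda>z. w z - b"
  let ?T = "\<lambda>r. proximity r w" and ?N = "\<lambda>r. nev_Nbar r (\<lambda>z. 1 / ?g z)"
  have g: "?g holomorphic_on UNIV" by (intro holomorphic_intros w)
  obtain z1 where z1: "?g z1 \<noteq> 0" using nonconst[of b] by auto
  obtain z2 where z2: "w z2 \<noteq> 0" using nonconst[of 0] by auto
  obtain f z0 K C \<rho> where f: "f holomorphic_on UNIV" "f z0 \<noteq> 0" and \<rho>: "\<rho> \<ge> 1" and
    main: "\<forall>r X Y. r \<ge> \<rho> \<longrightarrow> zero_free_circle w r \<longrightarrow> zero_free_circle ?g r \<longrightarrow> zero_free_circle f r \<longrightarrow>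
      log_quotient_bound ?g r X \<longrightarrow> log_quotient_bound w r Y \<longrightarrow>
      ?T r \<le> ?N r + circle_mean r X + circle_mean r Y + K * ln r + C"
    by (rule proximity_le_nev_Nbar[OF B])
  \<comment> \<open>Each of the two quotient bounds will cost 11 \<eta> T, and the logarithmic and
    constant terms another \<eta> T: 23 in all.\<close>
  define \<eta> where "\<eta> = min 1 (\<epsilon> / 23)"
  have \<eta>: "0 < \<eta>" "\<eta> \<le> 1" "23 * \<eta> \<le> \<epsilon>" using e by (auto simp: \<eta>_def min_def)
  \<comment> \<open>The step size turns the shift coefficient 4 / (R - r) into
    \<open>\<eta>\<close>.\<close>
  define k where "k = 4 / \<eta>"
  have k: "k \<ge> 2" "4 / k = \<eta>" using \<eta> by (auto simp: k_def field_simps)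
  have cnt: "countable ({a. w a = 0} \<union> {a. ?g a = 0} \<union> {a. f a = 0})"
    by (intro countable_Un countable_zeros[OF w z2] countable_zeros[OF g z1] countable_zeros[OF f])
  obtain r0 where r0: "1 < r0" "r0 < 2" and
    r0': "\<forall>n. \<forall>z\<in>{a. w a = 0} \<union> {a. ?g a = 0} \<union> {a. f a = 0}. norm z \<noteq> r0 + real n * k"
    by (rule zero_free_progression[OF cnt, of 1 2]) auto
  define s where "s = (\<lambda>n. r0 + real n * k)"
  have zf: "zero_free_circle w (s n)" "zero_free_circle ?g (s n)" "zero_free_circle f (s n)" for n
    using spec[OF r0', of n] by (auto simp: zero_free_circle_def s_def)
  have s1: "s n \<ge> 1" for n
    unfolding s_def using r0 k(1) by (meson add_increasing2 less_imp_le mult_nonneg_nonneg of_nat_0_le_iff order_trans zero_le_numeral)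
  have sSuc: "s (Suc n) = s n + k" for n by (simp add: s_def algebra_simps)
  have s_mono: "s 0 \<le> s n" "s n \<le> s (Suc n)" for n using k(1) by (simp_all add: s_def ring_distribs)
  \<comment> \<open>Both log means increase along the progression, so their first values bound them
    from below by \<open>- D\<close>.\<close>
  define D where "D = \<bar>log_mean w (s 0)\<bar> + \<bar>log_mean ?g (s 0)\<bar>"
  define C0 where "C0 = log_plus (norm b) + ln 2"
  have C0: "C0 \<ge> 0" unfolding C0_def using log_plus_nonneg[of "norm b"] by simp
  have D: "D \<ge> 0" by (simp add: D_def)
  define Lw where "Lw = (\<lambda>n. log_mean w (s n))"
  define Lg where "Lg = (\<lambda>n. log_mean ?g (s n))"
  have Lw_mono: "Lw n \<le> Lw (Suc n)" and Lg_mono: "Lg n \<le> Lg (Suc n)" for n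
    unfolding Lw_def Lg_def using s1[of n] s_mono(2)[of n]
    by (intro log_mean_mono[OF w z2] log_mean_mono[OF g z1] zf; linarith)+
  have "Lw 0 \<le> Lw n" "Lg 0 \<le> Lg n" for n
    unfolding Lw_def Lg_def using s1[of 0] s_mono(1)[of n]
    by (intro log_mean_mono[OF w z2] log_mean_mono[OF g z1] zf; linarith)+
  moreover have "- D \<le> Lw 0" "- D \<le> Lg 0" by (simp_all add: D_def Lw_def Lg_def)
  ultimately have LD: "- D \<le> Lw n" "- D \<le> Lg n" for n using order_trans by blast+
  define T where "T = (\<lambda>n. ?T (s n))"
  have T0: "T n \<ge> 0" for n unfolding T_def by (rule proximity_nonneg[OF w]) (use s1[of n] in linarith)
  have T_mono: "T n \<le> T (Suc n)" for n
    unfolding T_def by (rule proximity_mono[OF w z2]) (use s1[of n] s_mono(2)[of n] in linarith)+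
  have Tg: "proximity (s n) ?g \<le> T n + C0" for n
    using proximity_diff_const(2)[OF w, of "s n" b] s1[of n] by (simp add: T_def C0_def)
  have LwT: "Lw n \<le> T n" and LgT: "Lg n \<le> T n + C0" for n
    using log_mean_le_proximity[OF w _ zf(1), of n] log_mean_le_proximity[OF g _ zf(2), of n] s1[of n] Tg[of n]
    by (auto simp: Lw_def Lg_def T_def)
  \<comment> \<open>A positive sum of three nondecreasing sequences: one step with small relative
    increase of the sum bounds the increments of all three at once.\<close>
  define \<Phi> where "\<Phi> = (\<lambda>n. T n + Lw n + Lg n + 2 * D + 1)"
  have \<Phi>pos: "\<Phi> n > 0" for n using T0[of n] LD[of n] by (simp add: \<Phi>_def)
  define E where "E = C0 + 2 * D + 1"
  have E: "E \<ge> 0" "D \<le> E" "C0 \<le> E" "2 * C0 + D \<le> 2 * E" using C0 D by (auto simp: E_def)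
  have \<Phi>le: "\<Phi> n \<le> 3 * T n + E" for n
    using LwT[of n] LgT[of n] by (simp add: \<Phi>_def E_def)
  have stop: "filterlim s at_top sequentially"
    unfolding s_def
    by (intro filterlim_tendsto_add_at_top[OF tendsto_const] filterlim_at_top_mult_tendsto_pos[OF tendsto_const]
          filterlim_real_sequentially) (use k in simp)
  have "\<forall>\<^sub>F n in sequentially. \<Phi> n \<le> exp (\<delta> * real n)" if "\<delta> > 0" for \<delta>
  proof -
    have "\<forall>\<^sub>F n in sequentially. 3 * exp ((r0 + real n * k) powr c) + E \<le> exp (\<delta> * real n)"
      by (rule subexponential_progression) (use r0 k c that E in auto)
    moreover have "\<forall>\<^sub>F n in sequentially. T n \<le> exp (s n powr c)"
      unfolding T_def using growth stop by (rule eventually_compose_filterlim)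
    ultimately show ?thesis
    proof eventually_elim
      case (elim n)
      thus ?case using \<Phi>le[of n] by (simp add: s_def)
    qed
  qed
  from slow_growth_step[OF \<Phi>pos this \<eta>(1)]
  have freq: "\<exists>\<^sub>F n in sequentially. \<Phi> (Suc n) \<le> (1 + \<eta>) * \<Phi> n" .
  have "\<forall>\<^sub>F r in at_top. (\<bar>K\<bar> + \<bar>C\<bar> + 10 * E) / \<eta> * ln r \<le> ?T r"
    by (rule proximity_ge_ln[OF w tr])
  moreover have "\<forall>\<^sub>F r :: real in at_top. ln r \<ge> 1"
    using ln_at_top by (simp add: filterlim_at_top)
  ultimately have "\<forall>\<^sub>F r in at_top. K * ln r + C + 10 * E \<le> \<eta> * ?T r"
  proof eventually_elim
    case (elim r)
    have "(\<bar>K\<bar> + \<bar>C\<bar> + 10 * E) * ln r \<le> \<eta> * ?T r"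
      using elim(1) \<eta>(1) by (simp add: field_simps)
    moreover have "K * ln r \<le> \<bar>K\<bar> * ln r" using elim(2) by (intro mult_right_mono) auto
    moreover have "\<bar>C\<bar> \<le> \<bar>C\<bar> * ln r" using elim(2) mult_left_mono[of 1 "ln r" "\<bar>C\<bar>"] by simp
    moreover have "10 * E \<le> 10 * E * ln r" using elim(2) mult_left_mono[of 1 "ln r" "10 * E"] E by simp
    ultimately show ?case by (simp add: ring_distribs)
  qed
  hence ev: "\<forall>\<^sub>F n in sequentially. K * ln (s n) + C + 10 * E \<le> \<eta> * T n"
    unfolding T_def using stop by (rule eventually_compose_filterlim)
  have ev2: "\<forall>\<^sub>F n in sequentially. \<rho> \<le> s n"
    using stop by (simp add: filterlim_at_top)
  have freq': "\<exists>\<^sub>F n in sequentially. (1 - \<epsilon>) * T n \<le> ?N (s n)"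
  proof (rule frequently_rev_mp[OF freq], use ev ev2 in eventually_elim, rule impI)
    fix n assume 1: "K * ln (s n) + C + 10 * E \<le> \<eta> * T n" "\<rho> \<le> s n" and step: "\<Phi> (Suc n) \<le> (1 + \<eta>) * \<Phi> n"
    have r: "0 < s n" "s n + 2 \<le> s (Suc n)" "s (Suc n) - s n = k" using s1[of n] k sSuc[of n] by auto
    have step': "\<Phi> (Suc n) - \<Phi> n \<le> \<eta> * \<Phi> n" using step by (simp add: algebra_simps)
    have \<Phi>inc: "T (Suc n) - T n \<le> \<eta> * \<Phi> n" "Lw (Suc n) - Lw n \<le> \<eta> * \<Phi> n" "Lg (Suc n) - Lg n \<le> \<eta> * \<Phi> n"
      using step' T_mono[of n] Lw_mono[of n] Lg_mono[of n] unfolding \<Phi>_def by linarith+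
    \<comment> \<open>\<open>P\<close> stands for an increment of a log mean, \<open>Q\<close> and
      \<open>L\<close> for the proximity function and the log mean at the next radius. Here Q <= 4 T
      + E + C0, so 2 Q - L <= 8 T + 4 E, while P contributes \<eta> (3 T + E).\<close>
    have bound: "P + \<eta> * (2 * Q - L) \<le> \<eta> * (11 * T n + 5 * E)"
      if "P \<le> \<eta> * \<Phi> n" "Q \<le> T (Suc n) + C0" "- D \<le> L" for P Q L
    proof -
      have "\<eta> * \<Phi> n \<le> 1 * \<Phi> n" using \<eta> \<Phi>pos[of n] by (intro mult_right_mono) auto
      hence "2 * Q - L \<le> 8 * T n + 4 * E" using that \<Phi>inc(1) E \<Phi>le[of n] by linarith
      hence "\<eta> * (2 * Q - L) \<le> \<eta> * (8 * T n + 4 * E)" using \<eta> by (intro mult_left_mono) auto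
      moreover have "\<eta> * \<Phi> n \<le> \<eta> * (3 * T n + E)" using \<eta> \<Phi>le[of n] by (intro mult_left_mono) auto
      ultimately show ?thesis using that(1) by (simp add: ring_distribs)
    qed
    obtain X where X: "log_quotient_bound ?g (s n) X"
      "circle_mean (s n) X = Lg (Suc n) - Lg n + 4 / k * (2 * proximity (s (Suc n)) ?g - Lg (Suc n))"
      using log_quotient_bound_exists[OF g z1 r(1,2) zf(2) zf(2)] unfolding r(3) Lg_def by blast
    obtain Y where Y: "log_quotient_bound w (s n) Y"
      "circle_mean (s n) Y = Lw (Suc n) - Lw n + 4 / k * (2 * proximity (s (Suc n)) w - Lw (Suc n))"
      using log_quotient_bound_exists[OF w z2 r(1,2) zf(1) zf(1)] unfolding r(3) Lw_def by blast
    have mX: "circle_mean (s n) X \<le> \<eta> * (11 * T n + 5 * E)"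
      unfolding X(2) k(2) by (rule bound[OF \<Phi>inc(3) Tg LD(2)])
    have mY: "circle_mean (s n) Y \<le> \<eta> * (11 * T n + 5 * E)"
      unfolding Y(2) k(2) by (rule bound[OF \<Phi>inc(2) _ LD(1)]) (use C0 in \<open>simp add: T_def\<close>)
    have "T n \<le> ?N (s n) + circle_mean (s n) X + circle_mean (s n) Y + K * ln (s n) + C"
      using main 1(2) zf[of n] X(1) Y(1) unfolding T_def by blast
    also have "\<dots> \<le> ?N (s n) + 2 * (\<eta> * (11 * T n + 5 * E)) + K * ln (s n) + C"
      using mX mY by linarith
    also have "\<dots> = ?N (s n) + 22 * (\<eta> * T n) + \<eta> * (10 * E) + K * ln (s n) + C"
      by (simp add: algebra_simps)
    also have "\<eta> * (10 * E) \<le> 1 * (10 * E)" using \<eta> E by (intro mult_right_mono) auto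
    finally have "T n \<le> ?N (s n) + 23 * \<eta> * T n" using 1(1) by simp
    also have "23 * \<eta> * T n \<le> \<epsilon> * T n" using \<eta>(3) T0[of n] by (intro mult_right_mono) auto
    finally show "(1 - \<epsilon>) * T n \<le> ?N (s n)" by (simp add: algebra_simps)
  qed
  show ?thesis
  proof (rule ccontr)
    assume "\<not> ?thesis"
    hence "\<forall>\<^sub>F r in at_top. \<not> (1 - \<epsilon>) * ?T r \<le> ?N r" by (simp add: not_frequently)
    hence "\<forall>\<^sub>F n in sequentially. \<not> (1 - \<epsilon>) * ?T (s n) \<le> ?N (s n)"
      using stop by (rule eventually_compose_filterlim)
    with freq' show False by (simp add: T_def frequently_def)
  qed
qed

end

section \<open>Touching points\<close>

text \<open>Taylor's formula at z0 for both shifts: the terms of order zero cancel. Cauchy's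
  inequality with radius s/2 bounds the second derivative by 8 M / s^2; s >= 2 keeps these circles
  within distance \<open>s\<close> of z0.\<close>

lemma second_order_difference:
  assumes w: "w holomorphic_on UNIV" and s: "s \<ge> 2"
    and M: "\<And>h. norm h \<le> s \<Longrightarrow> norm (w (z0 + h)) \<le> M"
  shows "norm (w (z0 + 1) - w (z0 - 1) - 2 * deriv w z0) \<le> 16 * M / s\<^sup>2"
proof -
  have d2: "norm ((deriv ^^ 2) w x) \<le> 8 * M / s\<^sup>2" if x: "x \<in> cball z0 1" for x
  proof -
    have "norm ((deriv ^^ 2) w x) \<le> fact 2 * M / (s / 2) ^ 2"
    proof (rule Cauchy_inequality)
      fix y assume y: "norm (x - y) = s / 2"
      have "norm (y - z0) \<le> norm (x - y) + norm (z0 - x)"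
        using norm_triangle_ineq[of "y - x" "x - z0"] by (simp add: norm_minus_commute)
      also have "\<dots> \<le> s" using y x s by (simp add: dist_norm)
      finally show "norm (w y) \<le> M" using M[of "y - z0"] by simp
    qed (use s in \<open>auto intro: continuous_on_entire[OF w] holomorphic_on_subset[OF w]\<close>)
    thus ?thesis by (simp add: power2_eq_square field_simps)
  qed
  have T: "norm (w z - (\<Sum>i\<le>1. (deriv ^^ i) w z0 * (z - z0) ^ i / fact i)) \<le> 8 * M / s\<^sup>2 * norm (z - z0) ^ Suc 1 / fact 1"
    if z: "z \<in> cball z0 1" for z
  proof -
    have "norm ((deriv ^^ 0) w z - (\<Sum>i\<le>1. (deriv ^^ i) w z0 * (z - z0) ^ i / fact i)) \<le> 8 * M / s\<^sup>2 * norm (z - z0) ^ Suc 1 / fact 1"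
    proof (rule complex_Taylor[where S = "cball z0 1" and f = "\<lambda>i. (deriv ^^ i) w" and n = 1 and w = z0])
      show "((deriv ^^ i) w has_field_derivative (deriv ^^ Suc i) w x) (at x within cball z0 1)"
        if "x \<in> cball z0 1" "i \<le> 1" for i x
      proof -
        have "(deriv ^^ i) w holomorphic_on UNIV" by (rule holomorphic_higher_deriv[OF w open_UNIV])
        hence "((deriv ^^ i) w has_field_derivative deriv ((deriv ^^ i) w) x) (at x)"
          using holomorphic_derivI[of _ UNIV x] by simp
        thus ?thesis by (simp add: has_field_derivative_at_within)
      qed
    qed (use d2 z in \<open>auto simp: numeral_2_eq_2\<close>)
    thus ?thesis by simp
  qed
  have p: "norm (w (z0 + 1) - (w z0 + deriv w z0)) \<le> 8 * M / s\<^sup>2"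
    using T[of "z0 + 1"] by (simp add: dist_norm)
  have m: "norm (w (z0 - 1) - (w z0 - deriv w z0)) \<le> 8 * M / s\<^sup>2"
    using T[of "z0 - 1"] by (simp add: dist_norm)
  have "w (z0 + 1) - w (z0 - 1) - 2 * deriv w z0 =
     (w (z0 + 1) - (w z0 + deriv w z0)) - (w (z0 - 1) - (w z0 - deriv w z0))" by simp
  also have "norm \<dots> \<le> 8 * M / s\<^sup>2 + 8 * M / s\<^sup>2"
    using norm_triangle_ineq4 p m by (meson add_mono order_trans)
  finally show ?thesis by simp
qed

text \<open>A multiple of \<open>|z|^p * exp (\<epsilon> * |z| powr \<gamma>)\<close> touches \<open>|w|\<close> from above at \<open>z0\<close>; a small \<open>\<epsilon>\<close>
  pushes \<open>z0\<close> far out. This replaces the Wiman-Valiron method.\<close>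

lemma touching_point:
  fixes p :: nat
  assumes w: "w holomorphic_on UNIV" and tr: "\<not> rational_function w"
    and growth: "\<forall>\<^sub>F r in at_top. proximity r w \<le> r powr \<beta>" and g: "\<beta> < \<gamma>" "0 < \<gamma>" and \<rho>: "\<rho> \<ge> 1"
  obtains z0 \<epsilon> where "0 < \<epsilon>" "\<epsilon> \<le> 1" "norm z0 > \<rho>" "norm (w z0) \<ge> norm z0 ^ p"
    "\<forall>z. norm z \<ge> 1 \<longrightarrow> norm (w z) \<le> norm (w z0) * ((norm z / norm z0) ^ p * exp (\<epsilon> * (norm z powr \<gamma> - norm z0 powr \<gamma>)))"
proof -
  obtain w0 where w0: "w w0 \<noteq> 0"
  proof (rule ccontr)
    assume "\<not> thesis"
    hence "w = poly 0" using that by (intro ext) auto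
    with tr rational_function_poly show False by simp
  qed
  have "bounded (w ` cball 0 \<rho>)"
    by (intro compact_imp_bounded compact_continuous_image continuous_on_entire w compact_cball)
  then obtain m where m: "m > 0" "\<And>z. norm z \<le> \<rho> \<Longrightarrow> norm (w z) \<le> m"
    by (auto simp: bounded_pos)
  \<comment> \<open>The excess factor e (m + 1) leaves more than m + 1 after the exponential in
    \<open>u\<close> has taken at most e; \<open>\<epsilon>\<close> is chosen below to ensure
    this.\<close>
  obtain z1 where z1: "norm z1 \<ge> 1" "norm (w z1) > (exp 1 * (m + 1)) * norm z1 ^ p"
    using transcendental_unbounded[OF w tr, of "exp 1 * (m + 1)" 1 p] m(1) by auto
  define \<epsilon> where "\<epsilon> = min 1 (1 / norm z1 powr \<gamma>)"
  have "z1 \<noteq> 0" using z1(1) by auto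
  hence z1p: "norm z1 powr \<gamma> > 0" by simp
  have \<epsilon>: "0 < \<epsilon>" "\<epsilon> \<le> 1" "\<epsilon> * norm z1 powr \<gamma> \<le> 1"
    using z1p by (auto simp: \<epsilon>_def min_def field_simps)
  define u where "u = (\<lambda>z. norm (w z) / (norm z ^ p * exp (\<epsilon> * norm z powr \<gamma>)))"
  have u1: "u z1 > m + 1"
  proof -
    have pp: "norm z1 ^ p * exp (\<epsilon> * norm z1 powr \<gamma>) > 0"
      using z1(1) by (intro mult_pos_pos zero_less_power) auto
    have "(m + 1) * (norm z1 ^ p * exp (\<epsilon> * norm z1 powr \<gamma>)) \<le> (m + 1) * (norm z1 ^ p * exp 1)"
      using \<epsilon>(3) m(1) by (intro mult_left_mono) auto
    also have "\<dots> < norm (w z1)" using z1(2) by (simp add: mult_ac)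
    finally show ?thesis unfolding u_def using pp by (simp add: pos_less_divide_eq)
  qed
  have "((\<lambda>r. r powr (\<beta> - \<gamma>)) \<longlongrightarrow> 0) at_top"
    using g by (intro tendsto_neg_powr filterlim_ident) auto
  hence "((\<lambda>r. 3 * 2 powr \<beta> * r powr (\<beta> - \<gamma>)) \<longlongrightarrow> 3 * 2 powr \<beta> * 0) at_top"
    by (intro tendsto_intros)
  hence ev1: "\<forall>\<^sub>F r in at_top. 3 * 2 powr \<beta> * r powr (\<beta> - \<gamma>) < \<epsilon>"
    by (rule order_tendstoD) (use \<epsilon> in simp)
  have "filterlim (\<lambda>r::real. 2 * r) at_top at_top"
    by (rule filterlim_tendsto_pos_mult_at_top[OF tendsto_const _ filterlim_ident]) simp
  with growth have ev2: "\<forall>\<^sub>F r in at_top. proximity (2 * r) w \<le> (2 * r) powr \<beta>"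
    by (rule eventually_compose_filterlim)
  \<comment> \<open>Since the growth exponent \<open>\<beta>\<close> is below
    \<open>\<gamma>\<close>, the comparison function wins far out, so the supremum of
    \<open>u\<close> is attained on a compact annulus.\<close>
  have "\<forall>\<^sub>F r in at_top. \<forall>z. norm z = r \<longrightarrow> u z \<le> 1"
    using ev1 ev2 eventually_ge_at_top[of 1]
  proof eventually_elim
    case (elim r)
    show ?case
    proof (intro allI impI)
      fix z :: complex assume z: "norm z = r"
      have "log_plus (norm (w z)) \<le> (2 * r + norm z) / (2 * r - norm z) * proximity (2 * r) w"
        by (rule norm_le_exp_proximity[OF w w0]) (use z elim in simp)
      also have "(2 * r + norm z) / (2 * r - norm z) = 3" using z elim by simp
      also have "3 * proximity (2 * r) w \<le> 3 * (2 * r) powr \<beta>" using elim by simp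
      also have "\<dots> = (3 * 2 powr \<beta> * r powr (\<beta> - \<gamma>)) * r powr \<gamma>"
        using elim by (simp add: powr_mult powr_diff)
      also have "\<dots> \<le> \<epsilon> * r powr \<gamma>" using elim by (intro mult_right_mono) auto
      finally have "norm (w z) \<le> exp (\<epsilon> * r powr \<gamma>)"
        using \<epsilon> by (subst (asm) log_plus_le_iff) auto
      also have "\<dots> \<le> norm z ^ p * exp (\<epsilon> * norm z powr \<gamma>)"
        using elim z mult_right_mono[OF one_le_power[of r p], of "exp (\<epsilon> * r powr \<gamma>)"] by simp
      finally have le: "norm (w z) \<le> norm z ^ p * exp (\<epsilon> * norm z powr \<gamma>)" .
      have "norm z ^ p * exp (\<epsilon> * norm z powr \<gamma>) > 0"
        using elim z by (intro mult_pos_pos zero_less_power) auto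
      with le show "u z \<le> 1" unfolding u_def by (simp add: pos_divide_le_eq)
    qed
  qed
  then obtain \<rho>1 where \<rho>1: "\<And>z. norm z \<ge> \<rho>1 \<Longrightarrow> u z \<le> 1" unfolding eventually_at_top_linorder by blast
  define K where "K = {z :: complex. 1 \<le> norm z \<and> norm z \<le> max \<rho>1 1}"
  have "K = cball 0 (max \<rho>1 1) - ball 0 1" by (auto simp: K_def)
  hence K: "compact K" by (simp add: compact_diff)
  have z1K: "z1 \<in> K" using z1(1) u1 \<rho>1[of z1] m(1) by (fastforce simp: K_def)
  have "continuous_on K u"
    unfolding u_def by (intro continuous_intros continuous_on_entire w) (auto simp: K_def)
  then obtain z0 where z0: "z0 \<in> K" "\<And>z. z \<in> K \<Longrightarrow> u z \<le> u z0"
    using continuous_attains_sup[OF K, of u] z1K by blast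
  have u0: "u z0 > m + 1" using z0(2)[OF z1K] u1 by simp
  have z01: "norm z0 \<ge> 1" using z0(1) by (simp add: K_def)
  have pp: "norm z ^ p * exp (\<epsilon> * norm z powr \<gamma>) \<ge> 1" if "norm z \<ge> 1" for z :: complex
    using mult_mono[of 1 "norm z ^ p" 1 "exp (\<epsilon> * norm z powr \<gamma>)"] that \<epsilon>(1) by (simp add: one_le_power)
  have umax: "u z \<le> u z0" if "norm z \<ge> 1" for z
  proof (cases "z \<in> K")
    case False
    hence "norm z \<ge> \<rho>1" using that by (auto simp: K_def)
    thus ?thesis using \<rho>1[of z] u0 m(1) by linarith
  qed (use z0 in auto)
  \<comment> \<open>On 1 <= |z| <= \<open>\<rho>\<close> the comparison function is at least 1, so
    \<open>u\<close> is at most \<open>m\<close> there, less than its maximum.\<close>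
  have "norm z0 > \<rho>"
  proof (rule ccontr)
    assume "\<not> norm z0 > \<rho>"
    hence "norm (w z0) \<le> m * 1" using m(2) by simp
    also have "m * 1 \<le> m * (norm z0 ^ p * exp (\<epsilon> * norm z0 powr \<gamma>))"
      using m(1) by (intro mult_left_mono pp[OF z01]) simp
    finally have "u z0 \<le> m" unfolding u_def using pp[OF z01] by (simp add: pos_divide_le_eq)
    thus False using u0 by simp
  qed
  moreover have "norm (w z0) \<ge> norm z0 ^ p"
  proof -
    have "norm z0 ^ p * 1 \<le> norm z0 ^ p * exp (\<epsilon> * norm z0 powr \<gamma>)"
      using \<epsilon>(1) by (intro mult_left_mono) auto
    also have "\<dots> \<le> norm (w z0)"
      using u0 m(1) pp[OF z01] unfolding u_def
      by (smt (verit) divide_less_eq_1_pos)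
    finally show ?thesis by simp
  qed
  moreover have "norm (w z) \<le> norm (w z0) * ((norm z / norm z0) ^ p * exp (\<epsilon> * (norm z powr \<gamma> - norm z0 powr \<gamma>)))"
    if z: "norm z \<ge> 1" for z
  proof -
    have "norm (w z) = u z * (norm z ^ p * exp (\<epsilon> * norm z powr \<gamma>))"
    proof -
      have "norm (w z) = norm (w z) / X * X" if "X \<ge> 1" for X :: real using that by simp
      from this[OF pp[OF z]] show ?thesis by (simp only: u_def)
    qed
    also have "\<dots> \<le> u z0 * (norm z ^ p * exp (\<epsilon> * norm z powr \<gamma>))"
      using umax[OF z] pp[OF z] by (intro mult_right_mono) auto
    also have "\<dots> = norm (w z0) * ((norm z / norm z0) ^ p * exp (\<epsilon> * (norm z powr \<gamma> - norm z0 powr \<gamma>)))"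
      by (simp add: u_def power_divide right_diff_distrib exp_diff)
    finally show ?thesis .
  qed
  ultimately show ?thesis using \<epsilon> by (intro that) auto
qed

lemma has_real_derivative_norm_square:
  fixes \<psi> :: "real \<Rightarrow> complex"
  assumes "(\<psi> has_vector_derivative \<psi>') (at t)"
  shows "((\<lambda>t. (norm (\<psi> t))\<^sup>2) has_real_derivative 2 * Re (\<psi>' * cnj (\<psi> t))) (at t)"
proof -
  have d: "((\<lambda>t. Re (\<psi> t)) has_real_derivative Re \<psi>') (at t)" "((\<lambda>t. Im (\<psi> t)) has_real_derivative Im \<psi>') (at t)"
    using bounded_linear.has_vector_derivative[OF bounded_linear_Re assms]
      bounded_linear.has_vector_derivative[OF bounded_linear_Im assms]
    by (simp_all add: has_real_derivative_iff_has_vector_derivative)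
  show ?thesis unfolding cmod_power2
    by (rule DERIV_cong[OF DERIV_add[OF DERIV_power[OF d(1)] DERIV_power[OF d(2)]]])
       (simp add: algebra_simps)
qed

text \<open>Along the curve t -> z0 exp (c t), the square of |w| divided by that of the touching
  function has a local maximum at t = 0. The direction c = 1 gives the real part of z0 w'/w, and c =
  i shows that its imaginary part vanishes.\<close>

lemma touching_derivative:
  fixes p :: nat
  assumes w: "w holomorphic_on UNIV" and z0: "norm z0 > 1" "w z0 \<noteq> 0"
    and touch: "\<forall>z. norm z \<ge> 1 \<longrightarrow> norm (w z) \<le>
           norm (w z0) * ((norm z / norm z0) ^ p * exp (\<epsilon> * (norm z powr \<gamma> - norm z0 powr \<gamma>)))"
  shows "z0 * deriv w z0 = of_real (real p + \<epsilon> * \<gamma> * norm z0 powr \<gamma>) * w z0"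
proof -
  define r where "r = norm z0"
  define \<nu> where "\<nu> = real p + \<epsilon> * \<gamma> * r powr \<gamma>"
  have r: "r > 1" using z0 by (simp add: r_def)
  have key: "Re (c * (z0 * deriv w z0 * cnj (w z0))) = Re c * \<nu> * (norm (w z0))\<^sup>2" for c
  proof -
    define x where "x = Re c"
    define \<psi> where "\<psi> = (\<lambda>t :: real. w (z0 * exp (c * of_real t)))"
    \<comment> \<open>The logarithm of the touching function along the curve, normalised to vanish
      at t = 0; its derivative there is \<open>x * \<nu>\<close>.\<close>
    define E where "E = (\<lambda>t. real p * (x * t) + \<epsilon> * r powr \<gamma> * (exp (\<gamma> * (x * t)) - 1))"
    define F where "F = (\<lambda>t. (norm (\<psi> t))\<^sup>2 * exp (- 2 * E t))"
    have "((\<lambda>\<zeta>. w (z0 * exp (c * \<zeta>))) has_field_derivative deriv w z0 * (z0 * c)) (at (of_real 0))"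
    proof (rule DERIV_chain2[where f = w and g = "\<lambda>\<zeta>. z0 * exp (c * \<zeta>)"])
      show "(w has_field_derivative deriv w z0) (at (z0 * exp (c * of_real 0)))"
        using holomorphic_derivI[OF w open_UNIV] by simp
      show "((\<lambda>\<zeta>. z0 * exp (c * \<zeta>)) has_field_derivative z0 * c) (at (of_real 0))"
        by (auto intro!: derivative_eq_intros)
    qed
    hence "(\<psi> has_vector_derivative deriv w z0 * (z0 * c)) (at 0)"
      unfolding \<psi>_def by (rule has_vector_derivative_real_field)
    from has_real_derivative_norm_square[OF this]
    have d\<psi>: "((\<lambda>t. (norm (\<psi> t))\<^sup>2) has_real_derivative 2 * Re (deriv w z0 * (z0 * c) * cnj (w z0))) (at 0)"
      by (simp add: \<psi>_def)
    have dE: "((\<lambda>t. exp (- 2 * E t)) has_real_derivative - 2 * (x * \<nu>)) (at 0)"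
      unfolding E_def \<nu>_def by (auto intro!: derivative_eq_intros simp: algebra_simps)
    have dF: "(F has_real_derivative
        2 * Re (deriv w z0 * (z0 * c) * cnj (w z0)) * exp (- 2 * E 0) + - 2 * (x * \<nu>) * (norm (\<psi> 0))\<^sup>2) (at 0)"
      unfolding F_def by (rule DERIV_mult[OF d\<psi> dE])
    \<comment> \<open>Keeps |x t| below ln r, so the curve stays in the region |z| >= 1 where the
      majorization holds.\<close>
    define d where "d = ln r / (\<bar>x\<bar> + 1)"
    have d: "d > 0" using r by (simp add: d_def)
    have "F t \<le> F 0" if t: "\<bar>0 - t\<bar> < d" for t
    proof -
      have "\<bar>x * t\<bar> \<le> ln r"
      proof -
        have "\<bar>x * t\<bar> \<le> (\<bar>x\<bar> + 1) * d" unfolding abs_mult using t by (intro mult_mono) auto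
        thus ?thesis by (simp add: d_def)
      qed
      hence "exp (- ln r) \<le> exp (x * t)" by (simp add: abs_le_iff)
      hence xt: "r * exp (x * t) \<ge> 1" using r by (simp add: exp_minus field_simps)
      have n: "norm (z0 * exp (c * of_real t)) = r * exp (x * t)"
        by (simp add: norm_mult r_def x_def)
      have "norm (\<psi> t) \<le> norm (w z0) * ((r * exp (x * t) / r) ^ p * exp (\<epsilon> * ((r * exp (x * t)) powr \<gamma> - r powr \<gamma>)))"
        using touch[rule_format, of "z0 * exp (c * of_real t)"] xt unfolding n r_def[symmetric] \<psi>_def by simp
      also have "(r * exp (x * t) / r) ^ p * exp (\<epsilon> * ((r * exp (x * t)) powr \<gamma> - r powr \<gamma>)) = exp (E t)"
      proof -
        have "(r * exp (x * t) / r) ^ p = exp (real p * (x * t))" using r by (simp add: exp_of_nat_mult)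
        moreover have "(r * exp (x * t)) powr \<gamma> = r powr \<gamma> * exp (\<gamma> * (x * t))"
          using r by (simp add: powr_mult exp_powr_real mult.commute)
        moreover have "\<epsilon> * (r powr \<gamma> * exp (\<gamma> * (x * t)) - r powr \<gamma>) = \<epsilon> * r powr \<gamma> * (exp (\<gamma> * (x * t)) - 1)"
          by (simp add: algebra_simps)
        ultimately show ?thesis unfolding E_def exp_add by (simp only:)
      qed
      finally have "(norm (\<psi> t))\<^sup>2 \<le> (norm (w z0) * exp (E t))\<^sup>2" by (intro power_mono) auto
      hence "F t \<le> (norm (w z0) * exp (E t))\<^sup>2 * exp (- 2 * E t)" unfolding F_def by (intro mult_right_mono) auto
      also have "\<dots> = (norm (w z0))\<^sup>2"
        unfolding power_mult_distrib exp_double[symmetric] by (simp add: mult.assoc flip: exp_add)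
      also have "\<dots> = F 0" by (simp add: F_def \<psi>_def E_def)
      finally show ?thesis .
    qed
    hence "2 * Re (deriv w z0 * (z0 * c) * cnj (w z0)) * exp (- 2 * E 0) + - 2 * (x * \<nu>) * (norm (\<psi> 0))\<^sup>2 = 0"
      using DERIV_local_max[OF dF d] by blast
    hence "Re (deriv w z0 * (z0 * c) * cnj (w z0)) = x * \<nu> * (norm (w z0))\<^sup>2"
      by (simp add: E_def \<psi>_def)
    moreover have "deriv w z0 * (z0 * c) * cnj (w z0) = c * (z0 * deriv w z0 * cnj (w z0))"
      by (simp add: mult_ac)
    ultimately show ?thesis unfolding x_def by metis
  qed
  have "z0 * deriv w z0 * cnj (w z0) = of_real (\<nu> * (norm (w z0))\<^sup>2)"
  proof (rule complex_eqI)
    show "Re (z0 * deriv w z0 * cnj (w z0)) = Re (of_real (\<nu> * (norm (w z0))\<^sup>2))"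
      using key[of 1] by simp
    have "Re (\<i> * (z0 * deriv w z0 * cnj (w z0))) = 0" using key[of \<i>] by simp
    thus "Im (z0 * deriv w z0 * cnj (w z0)) = Im (of_real (\<nu> * (norm (w z0))\<^sup>2))"
      by (simp only: Re_i_times Im_complex_of_real neg_equal_0_iff_equal)
  qed
  also have "\<dots> = of_real \<nu> * w z0 * cnj (w z0)"
    unfolding of_real_mult complex_norm_square by (simp only: mult.assoc)
  finally show ?thesis using z0(2) by (simp add: \<nu>_def r_def)
qed

section \<open>The lower bound for the order\<close>

context difference_equation
begin

lemma growth_lower_bound:
  assumes tr: "\<not> rational_function w" and q: "q \<noteq> 0"
    and growth: "\<forall>\<^sub>F r in at_top. proximity r w \<le> r powr \<beta>" and \<beta>: "\<beta> < 1"
  shows False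
proof -
  \<comment> \<open>Strictly between \<open>\<beta>\<close> and 1, and at least 1/2 so that 1 <= 2
    \<gamma> below.\<close>
  define \<gamma> where "\<gamma> = (max \<beta> 0 + 1) / 2"
  have \<gamma>: "\<beta> < \<gamma>" "0 < \<gamma>" "\<gamma> < 1" "1 / 2 \<le> \<gamma>" using \<beta> by (auto simp: \<gamma>_def max_def)
  obtain c \<rho>1 where c: "c > 0" "\<And>z. norm z \<ge> \<rho>1 \<Longrightarrow> norm (poly q z) \<ge> c"
    using poly_norm_ge_const[OF q] by blast
  obtain M \<rho>2 where M: "\<rho>2 \<ge> 1"
    "\<forall>z. \<forall>p\<in>{q, A, A2, A1, A0, smult (2 * 0) A2 + A1}. norm z \<ge> \<rho>2 \<longrightarrow> norm (poly p z) \<le> norm z ^ M"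
    by (rule coefficient_bound[of 0])
  \<comment> \<open>16 comes from the second-order remainder, e from the growth of \<open>w\<close>
    within distance \<open>s\<close> of a touching point, and 4 from 1/s^2 = 4 (\<nu> /
    r)^2.\<close>
  define B where "B = 16 * exp (1::real) * 4"
  have B: "B > 0" by (simp add: B_def)
  text \<open>Far out \<open>w (z + 1) - w (z - 1)\<close> is nearly \<open>2 * deriv w z = 2 \<nu> w z / z\<close> at a touching point,
    so that dividing the equation by \<open>(w z)\<^sup>2\<close> leaves \<open>2 q \<nu> / z = A2 + small\<close>.\<close>
  have key: "\<exists>z \<nu>. norm z > \<rho> \<and> real p \<le> \<nu> \<and> \<nu> / norm z \<le> \<delta> \<and>
      norm (2 * poly q z * of_real \<nu> / z - poly A2 z) \<le> norm (poly q z) * (B * (\<nu> / norm z)\<^sup>2) + 3 * norm z ^ M / norm z ^ p"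
    if p: "p \<ge> 2" and \<delta>: "\<delta> > 0" for p :: nat and \<rho> \<delta>
  proof -
    have "((\<lambda>r. real p / r + r powr (\<gamma> - 1)) \<longlongrightarrow> 0 + 0) at_top"
      using \<gamma> by (intro tendsto_intros tendsto_neg_powr filterlim_ident tendsto_divide_0[OF tendsto_const]
            filterlim_at_top_imp_at_infinity) auto
    hence "\<forall>\<^sub>F r in at_top. real p / r + r powr (\<gamma> - 1) < min \<delta> (1/4)"
      by (rule order_tendstoD) (use \<delta> in simp)
    then obtain \<rho>3 where \<rho>3: "\<And>r. r \<ge> \<rho>3 \<Longrightarrow> real p / r + r powr (\<gamma> - 1) < min \<delta> (1/4)"
      unfolding eventually_at_top_linorder by blast
    define \<rho>' where "\<rho>' = Max {\<rho>, \<rho>2, \<rho>3, 2}"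
    have \<rho>': "\<rho>' \<ge> \<rho>" "\<rho>' \<ge> \<rho>2" "\<rho>' \<ge> \<rho>3" "\<rho>' \<ge> 2" by (simp_all add: \<rho>'_def)
    obtain z0 \<epsilon> where z0: "0 < \<epsilon>" "\<epsilon> \<le> 1" "norm z0 > \<rho>'" "norm (w z0) \<ge> norm z0 ^ p" and
      touch: "\<forall>z. norm z \<ge> 1 \<longrightarrow> norm (w z) \<le> norm (w z0) * ((norm z / norm z0) ^ p * exp (\<epsilon> * (norm z powr \<gamma> - norm z0 powr \<gamma>)))"
      by (rule touching_point[OF w tr growth \<gamma>(1,2), of \<rho>' p]) (use \<rho>' in auto)
    define r where "r = norm z0"
    have r: "r > \<rho>'" "r > 2" using z0 \<rho>' by (simp_all add: r_def)
    have rp: "r ^ p \<ge> 1" using r by (simp add: one_le_power)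
    have w1: "norm (w z0) \<ge> 1" using z0(4) rp unfolding r_def by linarith
    hence w0: "w z0 \<noteq> 0" by auto
    define \<nu> where "\<nu> = real p + \<epsilon> * \<gamma> * r powr \<gamma>"
    have dw: "z0 * deriv w z0 = of_real \<nu> * w z0"
      unfolding \<nu>_def r_def by (rule touching_derivative[OF w _ w0 touch]) (use z0 \<rho>' in linarith)
    have \<nu>p: "\<nu> \<ge> real p" using z0 \<gamma> by (simp add: \<nu>_def)
    hence \<nu>2: "\<nu> \<ge> 2" using p by linarith
    have "\<nu> / r = real p / r + \<epsilon> * \<gamma> * r powr (\<gamma> - 1)"
      using r by (simp add: \<nu>_def add_divide_distrib powr_diff)
    also have "\<epsilon> * \<gamma> * r powr (\<gamma> - 1) \<le> 1 * r powr (\<gamma> - 1)"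
      using z0 \<gamma> mult_mono[of \<epsilon> 1 \<gamma> 1] by (intro mult_right_mono) auto
    also have "real p / r + 1 * r powr (\<gamma> - 1) < min \<delta> (1/4)" using \<rho>3[of r] r \<rho>' by simp
    finally have \<nu>r: "\<nu> / r < \<delta>" "\<nu> / r < 1/4" by simp_all
    \<comment> \<open>Within this radius the logarithm of the touching function increases by at most
      2 \<nu> s / r = 1, so |w| grows at most by the factor e.\<close>
    define s where "s = r / (2 * \<nu>)"
    have s: "s \<ge> 2" "s \<le> r / 2" using \<nu>r(2) \<nu>2 r by (simp_all add: s_def field_simps)
    have bound: "norm (w (z0 + h)) \<le> exp 1 * norm (w z0)" if h: "norm h \<le> s" for h
    proof -
      have h1: "norm (z0 + h) \<ge> 1" using norm_triangle_ineq2[of z0 "- h"] h s r by (simp add: r_def)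
      have "r * (1 + s / r) = r + s" using r by (simp add: field_simps)
      hence h2: "norm (z0 + h) \<le> r * (1 + s / r)" using norm_triangle_ineq[of z0 h] h by (simp add: r_def)
      have sr: "s / r \<ge> 0" using s r by simp
      have "(norm (z0 + h) / r) ^ p \<le> (1 + s / r) ^ p"
        using h2 r by (intro power_mono) (auto simp: divide_le_eq mult.commute)
      also have "\<dots> \<le> exp (s / r) ^ p" using sr by (intro power_mono exp_ge_add_one_self) auto
      also have "\<dots> = exp (real p * (s / r))" by (rule exp_of_nat_mult[symmetric])
      finally have e1: "(norm (z0 + h) / r) ^ p \<le> exp (real p * (s / r))" .
      have "norm (z0 + h) powr \<gamma> \<le> (r * (1 + s / r)) powr \<gamma>"
        using h2 \<gamma> by (intro powr_mono2) auto
      also have "\<dots> = r powr \<gamma> * (1 + s / r) powr \<gamma>" using r sr by (simp add: powr_mult)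
      also have "(1 + s / r) powr \<gamma> \<le> (1 + s / r) powr 1" using sr \<gamma> by (intro powr_mono) auto
      also have "(1 + s / r) powr 1 = 1 + s / r" using sr by simp
      finally have "norm (z0 + h) powr \<gamma> - r powr \<gamma> \<le> r powr \<gamma> * (s / r)"
        using r by (simp add: distrib_left)
      hence "\<epsilon> * (norm (z0 + h) powr \<gamma> - r powr \<gamma>) \<le> \<epsilon> * (r powr \<gamma> * (s / r))"
        using z0 by (intro mult_left_mono) auto
      also have "\<dots> \<le> 2 * \<gamma> * (\<epsilon> * (r powr \<gamma> * (s / r)))"
      proof -
        have "0 \<le> \<epsilon> * (r powr \<gamma> * (s / r))" using z0(1) sr by (intro mult_nonneg_nonneg) auto
        hence "1 * (\<epsilon> * (r powr \<gamma> * (s / r))) \<le> 2 * \<gamma> * (\<epsilon> * (r powr \<gamma> * (s / r)))"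
          using \<gamma>(4) by (intro mult_right_mono) auto
        thus ?thesis by simp
      qed
      finally have le: "\<epsilon> * (norm (z0 + h) powr \<gamma> - r powr \<gamma>) \<le> 2 * \<gamma> * (\<epsilon> * (r powr \<gamma> * (s / r)))" .
      have "X \<le> 2 * X" if "X \<ge> 0" for X :: real using that by simp
      from this[OF mult_nonneg_nonneg[OF of_nat_0_le_iff[of p] sr]]
      have "real p * (s / r) \<le> 2 * (real p * (s / r))" .
      from add_mono[OF this le] have "real p * (s / r) + \<epsilon> * (norm (z0 + h) powr \<gamma> - r powr \<gamma>) \<le>
          2 * (real p * (s / r)) + 2 * \<gamma> * (\<epsilon> * (r powr \<gamma> * (s / r)))"
        .
      also have "\<dots> = 2 * \<nu> * (s / r)" by (simp add: \<nu>_def algebra_simps)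
      also have "\<dots> = 1" using \<nu>2 r by (simp add: s_def)
      finally have e2: "exp (real p * (s / r)) * exp (\<epsilon> * (norm (z0 + h) powr \<gamma> - r powr \<gamma>)) \<le> exp 1"
        by (simp flip: exp_add)
      have "norm (w (z0 + h)) \<le> norm (w z0) * ((norm (z0 + h) / r) ^ p * exp (\<epsilon> * (norm (z0 + h) powr \<gamma> - r powr \<gamma>)))"
        using touch[rule_format, OF h1] by (simp add: r_def)
      also have "\<dots> \<le> norm (w z0) * exp 1"
        by (intro mult_left_mono order_trans[OF mult_right_mono[OF e1] e2]) auto
      finally show ?thesis by (simp add: mult.commute)
    qed
    define \<Delta> where "\<Delta> = w (z0 + 1) - w (z0 - 1) - 2 * deriv w z0"
    have "norm \<Delta> \<le> 16 * (exp 1 * norm (w z0)) / s\<^sup>2"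
      unfolding \<Delta>_def by (rule second_order_difference[OF w s(1)]) (rule bound)
    also have "\<dots> = B * (\<nu> / r)\<^sup>2 * norm (w z0)"
      using r \<nu>2 by (simp add: B_def s_def power_divide power_mult_distrib field_simps)
    finally have \<Delta>: "norm \<Delta> \<le> B * (\<nu> / r)\<^sup>2 * norm (w z0)" .
    have z00: "z0 \<noteq> 0" using r by (auto simp: r_def)
    have dw': "deriv w z0 = of_real \<nu> * w z0 / z0" using dw z00 by (simp add: field_simps)
    have dwn: "norm (deriv w z0) \<le> norm (w z0)"
    proof -
      have "norm (deriv w z0) = \<nu> / r * norm (w z0)"
        using \<nu>2 by (simp add: dw' norm_mult norm_divide r_def)
      also have "\<dots> \<le> 1 * norm (w z0)"
        by (intro mult_right_mono less_imp_le[OF less_trans[OF \<nu>r(2)]]) auto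
      finally show ?thesis by simp
    qed
    have Mz: "norm (poly p z0) \<le> r ^ M" if "p \<in> {q, A, A2, A1, A0, smult (2 * 0) A2 + A1}" for p
      using bspec[OF spec[OF M(2), of z0] that] r \<rho>' by (simp add: r_def)
    have "poly q z0 * w z0 * (\<Delta> + 2 * deriv w z0) + poly A z0 * deriv w z0 =
               poly A2 z0 * (w z0)\<^sup>2 + poly A1 z0 * w z0 + poly A0 z0"
      using eq[of z0] by (simp add: \<Delta>_def)
    hence "(2 * poly q z0 * of_real \<nu> / z0 - poly A2 z0) * (w z0)\<^sup>2 =
       - (poly q z0 * \<Delta>) * w z0 + (poly A1 z0 * w z0 + poly A0 z0 - poly A z0 * deriv w z0)"
      unfolding dw' by (simp add: power2_eq_square algebra_simps)
    hence "norm (2 * poly q z0 * of_real \<nu> / z0 - poly A2 z0) * (norm (w z0))\<^sup>2 =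
      norm (- (poly q z0 * \<Delta>) * w z0 + (poly A1 z0 * w z0 + poly A0 z0 - poly A z0 * deriv w z0))"
      by (metis norm_mult norm_power)
    also have "\<dots> \<le> norm (poly q z0) * norm \<Delta> * norm (w z0) +
        (norm (poly A1 z0) * norm (w z0) + norm (poly A0 z0) + norm (poly A z0) * norm (deriv w z0))"
      by (intro order_trans[OF norm_triangle_ineq] add_mono order_trans[OF norm_triangle_ineq4])
         (simp_all add: norm_mult)
    also have "\<dots> \<le> norm (poly q z0) * (B * (\<nu> / r)\<^sup>2 * norm (w z0)) * norm (w z0) +
        (r ^ M * norm (w z0) + r ^ M * norm (w z0) + r ^ M * norm (w z0))"
    proof (intro add_mono mult_right_mono mult_left_mono \<Delta>)
      have "norm (poly A0 z0) * 1 \<le> r ^ M * norm (w z0)" using Mz[of A0] w1 r by (intro mult_mono) auto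
      thus "norm (poly A0 z0) \<le> r ^ M * norm (w z0)" by simp
      show "norm (poly A z0) * norm (deriv w z0) \<le> r ^ M * norm (w z0)"
        using Mz[of A] dwn r by (intro mult_mono) auto
    qed (use Mz[of A1] in auto)
    also have "\<dots> = (norm (poly q z0) * (B * (\<nu> / r)\<^sup>2) + 3 * r ^ M / norm (w z0)) * (norm (w z0))\<^sup>2"
      using w1 by (simp add: power2_eq_square field_simps)
    finally have "norm (2 * poly q z0 * of_real \<nu> / z0 - poly A2 z0) \<le>
        norm (poly q z0) * (B * (\<nu> / r)\<^sup>2) + 3 * r ^ M / norm (w z0)"
      by (rule mult_right_le_imp_le) (use w0 in simp)
    also have "3 * r ^ M / norm (w z0) \<le> 3 * r ^ M / r ^ p"
    proof (rule divide_left_mono)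
      show "r ^ p \<le> norm (w z0)" using z0(4) by (simp add: r_def)
      show "0 \<le> 3 * r ^ M" using r by simp
      have "r ^ p > 0" "norm (w z0) > 0" using rp w1 by linarith+
      thus "0 < norm (w z0) * r ^ p" by simp
    qed
    finally show ?thesis
      using r \<rho>' \<nu>p \<nu>r(1) unfolding r_def by (intro exI[of _ z0] exI[of _ \<nu>]) auto
  qed
  show False
  proof (cases "degree (pCons 0 A2) \<le> degree q")
    case True
    obtain \<Lambda> \<rho>4 where \<Lambda>: "\<Lambda> > 0" "\<forall>z. norm z \<ge> \<rho>4 \<longrightarrow> norm (poly (pCons 0 A2) z) \<le> \<Lambda> * norm (poly q z)"
      by (rule poly_norm_le_poly[OF q True])
    \<comment> \<open>Here z A2 / q is bounded by \<open>\<Lambda>\<close> far out. The estimate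
      will force \<nu> <= 3/c + \<Lambda>, contradicting \<nu> >= p; and p > M makes the remainder,
      multiplied by |z|, at most 3.\<close>
    define p where "p = max (M + 2) (nat \<lceil>\<Lambda> + 3 / c\<rceil> + 1)"
    have p: "p \<ge> 2" "p \<ge> M + 1" "real p > \<Lambda> + 3 / c" unfolding p_def by linarith+
    obtain z \<nu> where z: "norm z > Max {\<rho>1, \<rho>4, 1}" "real p \<le> \<nu>" "\<nu> / norm z \<le> 1 / B"
      "norm (2 * poly q z * of_real \<nu> / z - poly A2 z) \<le> norm (poly q z) * (B * (\<nu> / norm z)\<^sup>2) + 3 * norm z ^ M / norm z ^ p"
      using key[OF p(1), of "1 / B" "Max {\<rho>1, \<rho>4, 1}"] B by auto
    define Q where "Q = norm (poly q z)"
    have z1: "norm z > 1" "norm z \<ge> \<rho>4" "norm z \<ge> \<rho>1" using z(1) by auto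
    have z0: "z \<noteq> 0" using z1 by auto
    have Q: "Q \<ge> c" using c(2)[OF z1(3)] by (simp add: Q_def)
    have \<nu>0: "\<nu> \<ge> 0" using z(2) by linarith
    have "2 * Q * \<nu> = norm (2 * poly q z * of_real \<nu>)" using \<nu>0 by (simp add: norm_mult Q_def)
    also have "2 * poly q z * of_real \<nu> = z * (2 * poly q z * of_real \<nu> / z - poly A2 z) + poly (pCons 0 A2) z"
      using z0 by (simp add: field_simps)
    also have "norm \<dots> \<le> norm z * norm (2 * poly q z * of_real \<nu> / z - poly A2 z) + norm (poly (pCons 0 A2) z)"
      by (intro order_trans[OF norm_triangle_ineq]) (simp add: norm_mult)
    also have "\<dots> \<le> norm z * (Q * (B * (\<nu> / norm z)\<^sup>2) + 3 * norm z ^ M / norm z ^ p) + \<Lambda> * Q"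
      using z(4) \<Lambda>(2) z1 unfolding Q_def by (intro add_mono mult_left_mono) auto
    also have "\<dots> = Q * \<nu> * (B * (\<nu> / norm z)) + 3 * (norm z ^ (M + 1) / norm z ^ p) + \<Lambda> * Q"
      using z1 by (simp add: power2_eq_square field_simps)
    also have "\<dots> \<le> Q * \<nu> * 1 + 3 * 1 + \<Lambda> * Q"
    proof (intro add_mono mult_left_mono order_refl)
      show "B * (\<nu> / norm z) \<le> 1" using z(3) B by (simp add: field_simps)
      have "norm z ^ p > 0" by (rule zero_less_power) (use z1 in linarith)
      moreover have "norm z ^ (M + 1) \<le> norm z ^ p" using z1 p(2) by (intro power_increasing) auto
      ultimately show "norm z ^ (M + 1) / norm z ^ p \<le> 1" by (simp only: divide_le_eq_1_pos)
    qed (use Q c(1) \<nu>0 \<Lambda>(1) in auto)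
    finally have "Q * \<nu> \<le> 3 + \<Lambda> * Q" by simp
    also have "3 \<le> 3 / c * Q" using Q c by (simp add: field_simps)
    finally have "\<nu> * Q \<le> (3 / c + \<Lambda>) * Q" by (simp add: algebra_simps)
    hence "\<nu> \<le> 3 / c + \<Lambda>" by (rule mult_right_le_imp_le) (use Q c in linarith)
    with z(2) p(3) show False by linarith
  next
    case False
    \<comment> \<open>Now deg A2 + 1 > deg q, so \<open>q\<close> is O(A2), whereas the touching
      estimate makes \<open>A2\<close> an arbitrarily small multiple of \<open>q\<close>.\<close>
    hence A2: "A2 \<noteq> 0" by auto
    with False have "degree q \<le> degree A2" by simp
    from poly_norm_le_poly[OF A2 this]
    obtain \<Lambda> \<rho>4 where \<Lambda>: "\<Lambda> > 0" "\<forall>z. norm z \<ge> \<rho>4 \<longrightarrow> norm (poly q z) \<le> \<Lambda> * norm (poly A2 z)" .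
    define p where "p = M + 2"
    \<comment> \<open>The sum 3 + B collects 2 from the main term, B from the second-order term and
      1 from the remainder; this \<open>\<delta>\<close> makes
      \<open>\<Lambda> * (3 + B) * \<delta>\<close> less than 1.\<close>
    define \<delta> where "\<delta> = 1 / (\<Lambda> * (3 + B) + 1)"
    have \<Lambda>B: "\<Lambda> * (3 + B) > 0" using \<Lambda>(1) B by simp
    hence \<delta>: "\<delta> > 0" "\<delta> \<le> 1" by (simp_all add: \<delta>_def)
    obtain z \<nu> where z: "norm z > Max {\<rho>1, \<rho>4, 1, 3 / (c * \<delta>)}" "real p \<le> \<nu>" "\<nu> / norm z \<le> \<delta>"
      "norm (2 * poly q z * of_real \<nu> / z - poly A2 z) \<le> norm (poly q z) * (B * (\<nu> / norm z)\<^sup>2) + 3 * norm z ^ M / norm z ^ p"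
      using key[of p \<delta> "Max {\<rho>1, \<rho>4, 1, 3 / (c * \<delta>)}"] \<delta> by (auto simp: p_def)
    define Q where "Q = norm (poly q z)"
    have z1: "norm z > 1" "norm z \<ge> \<rho>4" "norm z \<ge> \<rho>1" "norm z > 3 / (c * \<delta>)" using z(1) by auto
    have Q: "Q \<ge> c" using c(2)[OF z1(3)] by (simp add: Q_def)
    define x where "x = \<nu> / norm z"
    have x: "0 \<le> x" "x \<le> \<delta>" using z(2,3) by (auto simp: x_def)
    have "norm (poly A2 z) \<le> norm (2 * poly q z * of_real \<nu> / z) + norm (2 * poly q z * of_real \<nu> / z - poly A2 z)"
      using norm_triangle_ineq2[of "poly A2 z" "2 * poly q z * of_real \<nu> / z"] by (simp add: norm_minus_commute)
    also have "\<dots> \<le> 2 * Q * x + (Q * (B * x\<^sup>2) + 3 * norm z ^ M / norm z ^ p)"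
      using z(2,4) unfolding Q_def x_def by (intro add_mono) (auto simp: norm_mult norm_divide)
    also have "\<dots> \<le> 2 * Q * \<delta> + (Q * (B * \<delta>) + Q * \<delta>)"
    proof (intro add_mono mult_left_mono)
      have "x\<^sup>2 \<le> \<delta> * 1" unfolding power2_eq_square using x \<delta> by (intro mult_mono) auto
      thus "x\<^sup>2 \<le> \<delta>" by simp
      have zp: "norm z > 0" using z1(1) by linarith
      have "3 * norm z ^ M / norm z ^ p = 3 / (norm z * norm z)"
        using z1 by (simp add: p_def power_add power2_eq_square)
      also have "\<dots> \<le> 3 / (norm z * 1)"
        using z1(1) zp by (intro divide_left_mono mult_left_mono mult_pos_pos) auto
      also have "\<dots> \<le> c * \<delta>"
      proof -
        have "c * \<delta> > 0" using c(1) \<delta>(1) by simp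
        hence "3 < norm z * (c * \<delta>)" using z1(4) by (simp only: pos_divide_less_eq)
        thus ?thesis using zp by (simp only: mult_1_right pos_divide_le_eq mult.commute[of _ "norm z"])
      qed
      also have "\<dots> \<le> Q * \<delta>" using Q \<delta> by (intro mult_right_mono) auto
      finally show "3 * norm z ^ M / norm z ^ p \<le> Q * \<delta>" .
    qed (use x Q c B in auto)
    finally have "norm (poly A2 z) \<le> Q * ((3 + B) * \<delta>)" by (simp add: algebra_simps)
    hence "\<Lambda> * norm (poly A2 z) \<le> \<Lambda> * (Q * ((3 + B) * \<delta>))" using \<Lambda>(1) by (intro mult_left_mono) auto
    moreover have "Q \<le> \<Lambda> * norm (poly A2 z)" using \<Lambda>(2) z1(2) by (simp add: Q_def)
    ultimately have "Q * 1 \<le> Q * (\<Lambda> * (3 + B) * \<delta>)" by (simp add: mult_ac)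
    hence "1 \<le> \<Lambda> * (3 + B) * \<delta>" by (rule mult_left_le_imp_le) (use Q c in linarith)
    also have "\<dots> < 1" using \<Lambda>B unfolding \<delta>_def by (simp add: pos_divide_less_eq)
    finally show False by simp
  qed
qed

end

section \<open>Rational coefficients and the ramification index\<close>

lemma entire_eventually_nonzero:
  assumes g: "g holomorphic_on UNIV" and nz: "g w0 \<noteq> 0"
  shows "\<forall>\<^sub>\<approx>z\<in>UNIV. g z \<noteq> 0"
  unfolding eventually_cosparse_open_eq[OF open_UNIV]
proof
  fix a :: complex
  obtain k where k: "k holomorphic_on UNIV" "k a \<noteq> 0" "\<And>z. g z = (z - a) ^ zmult g a * k z"
    using zmult_factor[OF g nz, of a] by blast
  have "isCont k a" using continuous_on_entire[OF k(1), of UNIV] by (simp add: continuous_on_eq_continuous_at)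
  hence "\<forall>\<^sub>F z in at a. k z \<noteq> 0"
    using k(2) by (intro tendsto_imp_eventually_ne[of k "k a"]) (simp_all add: isCont_def)
  moreover have "\<forall>\<^sub>F z in at a. z \<noteq> a" by (simp add: eventually_at_filter)
  ultimately show "\<forall>\<^sub>F z in at a. g z \<noteq> 0"
    by eventually_elim (subst k(3), simp)
qed

text \<open>An identity off a sparse set holds in a punctured neighbourhood of every point, and
  continuity fills in the point itself.\<close>

lemma entire_eq_of_cosparse:
  assumes F: "F holomorphic_on UNIV" and G: "G holomorphic_on UNIV" and eq: "\<forall>\<^sub>\<approx>z\<in>UNIV. F z = G z"
  shows "F z = G z"
proof -
  have "F \<midarrow>z\<rightarrow> F z" "G \<midarrow>z\<rightarrow> G z"
    using continuous_on_entire[OF F, of UNIV] continuous_on_entire[OF G, of UNIV]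
    by (simp_all add: continuous_on_def)
  moreover have "\<forall>\<^sub>F x in at z. F x = G x"
    using eq by (rule eventually_cosparse_imp_eventually_at) simp
  hence "F \<midarrow>z\<rightarrow> G z \<longleftrightarrow> G \<midarrow>z\<rightarrow> G z" by (rule tendsto_cong)
  ultimately show ?thesis using LIM_unique by blast
qed

lemma poly_eventually_nonzero:
  fixes p :: "complex poly"
  assumes "p \<noteq> 0"
  shows "\<forall>\<^sub>\<approx>z\<in>UNIV. poly p z \<noteq> 0"
proof -
  obtain z where "poly p z \<noteq> 0" using assms poly_all_0_iff_0 by blast
  thus ?thesis by (intro entire_eventually_nonzero holomorphic_intros)
qed

section \<open>Order, hyper-order and ramification index in terms of the proximity function\<close>

context
  fixes w :: "complex \<Rightarrow> complex"
  assumes w: "w holomorphic_on UNIV" and tr: "\<not> rational_function w"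
begin

lemma transcendental_nonconst: "\<exists>z. w z \<noteq> b"
proof (rule ccontr)
  assume "\<not> ?thesis"
  hence "w = poly [:b:]" by (intro ext) simp
  with tr rational_function_poly show False by simp
qed

lemma proximity_at_top: "filterlim (\<lambda>r. proximity r w) at_top at_top"
  by (rule filterlim_at_top_mono[OF ln_at_top])
     (use proximity_ge_ln[OF w tr, of 1] in simp)

lemma proximity_le_powr:
  assumes "nev_order w < 1"
  obtains \<beta> where "\<beta> < 1" "\<forall>\<^sub>F r in at_top. proximity r w \<le> r powr \<beta>"
proof -
  obtain \<beta> where \<beta>: "nev_order w < ereal \<beta>" "ereal \<beta> < 1" using ereal_dense2[OF assms] by blast
  have "\<forall>\<^sub>F r in at_top. ereal (ln (nev_T r w) / ln r) < ereal \<beta>"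
    using \<beta>(1) unfolding nev_order_def by (rule Limsup_lessD)
  moreover have "\<forall>\<^sub>F r in at_top. proximity r w \<ge> 1" using proximity_at_top by (simp add: filterlim_at_top)
  ultimately have "\<forall>\<^sub>F r in at_top. proximity r w \<le> r powr \<beta>"
    using eventually_gt_at_top[of 1]
  proof eventually_elim
    case (elim r)
    hence "ln (proximity r w) < \<beta> * ln r" by (simp add: nev_T_entire[OF w] divide_less_eq)
    hence "exp (ln (proximity r w)) \<le> exp (\<beta> * ln r)" by simp
    thus ?case using elim by (simp add: powr_def)
  qed
  thus ?thesis using \<beta>(2) by (intro that[of \<beta>]) simp_all
qed

lemma proximity_le_exp_powr:
  assumes "hyper_order w < 1"
  obtains c where "c < 1" "\<forall>\<^sub>F r in at_top. proximity r w \<le> exp (r powr c)"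
proof -
  obtain c where c: "hyper_order w < ereal c" "ereal c < 1" using ereal_dense2[OF assms] by blast
  have "\<forall>\<^sub>F r in at_top. ereal (ln (ln (nev_T r w)) / ln r) < ereal c"
    using c(1) unfolding hyper_order_def by (rule Limsup_lessD)
  moreover have "\<forall>\<^sub>F r in at_top. proximity r w \<ge> exp 1" using proximity_at_top by (simp add: filterlim_at_top)
  ultimately have "\<forall>\<^sub>F r in at_top. proximity r w \<le> exp (r powr c)"
    using eventually_gt_at_top[of 1]
  proof eventually_elim
    case (elim r)
    have T: "proximity r w > 0" using elim(2) less_le_trans[OF exp_gt_zero] by blast
    hence "ln (proximity r w) \<ge> 1" using elim(2) by (simp add: ln_ge_iff)
    moreover have "ln (ln (proximity r w)) < c * ln r"
      using elim by (simp add: nev_T_entire[OF w] divide_less_eq)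
    hence "exp (ln (ln (proximity r w))) \<le> exp (c * ln r)" by simp
    ultimately have "ln (proximity r w) \<le> r powr c" using elim by (simp add: powr_def)
    hence "exp (ln (proximity r w)) \<le> exp (r powr c)" by simp
    thus ?case using T by simp
  qed
  thus ?thesis using c(2) by (intro that[of c]) simp_all
qed

text \<open>The limsup is at most 1 by the first main theorem and at least 1 by \<open>freq\<close>.
  Arbitrarily large radii suffice for the lower bound.\<close>

lemma nev_Theta_eq_0:
  assumes freq: "\<And>\<epsilon>. \<epsilon> > 0 \<Longrightarrow> \<exists>\<^sub>F r in at_top. (1 - \<epsilon>) * proximity r w \<le> nev_Nbar r (\<lambda>z. 1 / (w z - b))"
  shows "nev_Theta b w = 0"
proof -
  let ?N = "\<lambda>r. nev_Nbar r (\<lambda>z. 1 / (w z - b))"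
  let ?L = "Limsup at_top (\<lambda>r. ereal (?N r / nev_T r w))"
  have g: "(\<lambda>z. w z - b) holomorphic_on UNIV" by (intro holomorphic_intros w)
  obtain z1 where z1: "w z1 - b \<noteq> 0" using transcendental_nonconst[of b] by auto
  obtain C where C: "\<And>r. r \<ge> 1 \<Longrightarrow> ?N r \<le> proximity r (\<lambda>z. w z - b) + C"
    using nev_Nbar_le_proximity[OF g z1] by blast
  define D where "D = \<bar>log_plus (norm b) + ln 2 + C\<bar>"
  have "?L \<le> 1"
  proof (rule ereal_le_epsilon2)
    fix \<epsilon> :: real assume e: "\<epsilon> > 0"
    have "\<forall>\<^sub>F r in at_top. proximity r w \<ge> max 1 (D / \<epsilon>)"
      using proximity_at_top unfolding filterlim_at_top by blast
    hence "\<forall>\<^sub>F r in at_top. ereal (?N r / nev_T r w) \<le> 1 + ereal \<epsilon>"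
      using eventually_ge_at_top[of 1]
    proof eventually_elim
      case (elim r)
      have T: "proximity r w \<ge> 1" "D \<le> \<epsilon> * proximity r w" using elim(1) e by (simp_all add: pos_divide_le_eq mult.commute)
      have "?N r \<le> proximity r w + D"
        using C[OF elim(2)] proximity_diff_const(2)[OF w, of r b] elim(2) by (simp add: D_def)
      also have "\<dots> \<le> (1 + \<epsilon>) * proximity r w" using T by (simp add: algebra_simps)
      finally have "?N r / proximity r w \<le> 1 + \<epsilon>" using T by (simp add: pos_divide_le_eq)
      thus ?case by (simp add: nev_T_entire[OF w])
    qed
    thus "?L \<le> 1 + ereal \<epsilon>" by (rule Limsup_bounded)
  qed
  moreover have "1 \<le> ?L"
  proof (rule ccontr)
    assume "\<not> 1 \<le> ?L"
    hence "?L < 1" by simp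
    then obtain x where x: "?L < ereal x" "ereal x < 1" using ereal_dense2 by blast
    have "\<forall>\<^sub>F r in at_top. ereal (?N r / nev_T r w) < ereal x" using x(1) by (rule Limsup_lessD)
    moreover have "\<forall>\<^sub>F r in at_top. proximity r w \<ge> 1" using proximity_at_top by (simp add: filterlim_at_top)
    ultimately have "\<forall>\<^sub>F r in at_top. \<not> (1 - (1 - x)) * proximity r w \<le> ?N r"
      by eventually_elim (simp add: nev_T_entire[OF w] divide_less_eq not_le)
    with freq[of "1 - x"] x(2) show False by (simp add: frequently_def)
  qed
  ultimately have "?L = 1" by (rule antisym)
  thus ?thesis by (simp add: nev_Theta_def)
qed

end

text \<open>The equalities are claimed off the roots of \<open>q\<close>, where all four
  denominators are nonzero and the convention for division by zero does not interfere.\<close>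

lemma common_denominator:
  assumes "rational_function a" "rational_function a2" "rational_function a1" "rational_function a0"
  obtains q A A2 A1 A0 where "q \<noteq> 0"
    "\<forall>z. poly q z \<noteq> 0 \<longrightarrow> a z = poly A z / poly q z \<and> a2 z = poly A2 z / poly q z \<and>
       a1 z = poly A1 z / poly q z \<and> a0 z = poly A0 z / poly q z"
proof -
  obtain p q p2 q2 p1 q1 p0 q0 where nz: "q \<noteq> 0" "q2 \<noteq> 0" "q1 \<noteq> 0" "q0 \<noteq> 0" and
    eqs: "a = (\<lambda>z. poly p z / poly q z)" "a2 = (\<lambda>z. poly p2 z / poly q2 z)"
     "a1 = (\<lambda>z. poly p1 z / poly q1 z)" "a0 = (\<lambda>z. poly p0 z / poly q0 z)"
    using assms unfolding rational_function_def by blast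
  show ?thesis
  proof (rule that[of "q * q2 * q1 * q0" "p * q2 * q1 * q0" "q * p2 * q1 * q0" "q * q2 * p1 * q0" "q * q2 * q1 * p0"])
    show "q * q2 * q1 * q0 \<noteq> 0" using nz by simp
  qed (auto simp: eqs)
qed

theorem theorem1p3:
  fixes a a2 a1 a0 w :: "complex \<Rightarrow> complex"
  assumes "rational_function a" "rational_function a2"
    and "rational_function a1" "rational_function a0"
    and a0_nonzero: "\<not> (\<forall>\<^sub>\<approx>z\<in>UNIV. a0 z = 0)"
    and "transcendental_entire w"
    and "hyper_order w < 1"
    and equation: "\<forall>\<^sub>\<approx>z\<in>UNIV. w (z + 1) - w (z - 1) + a z * (deriv w z / w z) =
                     (a2 z * w z ^ 2 + a1 z * w z + a0 z) / w z"
  shows "nev_order w \<ge> 1 \<and>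
         (\<forall>b. \<not> (\<forall>\<^sub>\<approx>z\<in>UNIV. a2 z * b ^ 2 + a1 z * b + a0 z = 0) \<longrightarrow> nev_Theta b w = 0)"
proof -
  have w: "w holomorphic_on UNIV" and tr: "\<not> rational_function w"
    using \<open>transcendental_entire w\<close> by (auto simp: transcendental_entire_def)
  note nonconst = transcendental_nonconst[OF w tr]
  obtain w0 where w0: "w w0 \<noteq> 0" using nonconst[of 0] by auto
  obtain q A A2 A1 A0 where q: "q \<noteq> 0" and
    coeff: "\<forall>z. poly q z \<noteq> 0 \<longrightarrow> a z = poly A z / poly q z \<and> a2 z = poly A2 z / poly q z \<and>
       a1 z = poly A1 z / poly q z \<and> a0 z = poly A0 z / poly q z"
    by (rule common_denominator[OF assms(1-4)])
  note qnz = poly_eventually_nonzero[OF q]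
  \<comment> \<open>The condition on \<open>b\<close> is passed to the polynomial coefficients; b =
    0 then yields that \<open>A0\<close> is nonzero.\<close>
  have B: "smult (b\<^sup>2) A2 + smult b A1 + A0 \<noteq> 0"
    if b: "\<not> (\<forall>\<^sub>\<approx>z\<in>UNIV. a2 z * b ^ 2 + a1 z * b + a0 z = 0)" for b
  proof
    assume 0: "smult (b\<^sup>2) A2 + smult b A1 + A0 = 0"
    have "\<forall>\<^sub>\<approx>z\<in>UNIV. a2 z * b ^ 2 + a1 z * b + a0 z = 0"
      using qnz
    proof eventually_elim
      case (elim z)
      have "a2 z * b ^ 2 + a1 z * b + a0 z = poly (smult (b\<^sup>2) A2 + smult b A1 + A0) z / poly q z"
        using coeff elim by (simp add: add_divide_distrib mult.commute)
      thus ?case by (simp add: 0)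
    qed
    with b show False by simp
  qed
  have "A0 \<noteq> 0" using B[of 0] a0_nonzero by simp
  have "poly q z * w z * (w (z + 1) - w (z - 1)) + poly A z * deriv w z =
               poly A2 z * (w z)\<^sup>2 + poly A1 z * w z + poly A0 z" for z
  \<comment> \<open>The equation is cleared of denominators where \<open>q\<close> and
    \<open>w\<close> are nonzero, off a sparse set; both sides are entire, so it then holds
    everywhere.\<close>
  proof (rule entire_eq_of_cosparse[where z = z and
        F = "\<lambda>z. poly q z * w z * (w (z + 1) - w (z - 1)) + poly A z * deriv w z" and
        G = "\<lambda>z. poly A2 z * (w z)\<^sup>2 + poly A1 z * w z + poly A0 z"])
    have sh: "(\<lambda>z. w (z + c)) holomorphic_on UNIV" for c
      using holomorphic_on_compose_gen[of "\<lambda>z. z + c" UNIV w UNIV] w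
      by (simp add: o_def holomorphic_intros)
    show "(\<lambda>z. poly q z * w z * (w (z + 1) - w (z - 1)) + poly A z * deriv w z) holomorphic_on UNIV"
      using sh[of 1] sh[of "- 1"] w holomorphic_deriv[OF w open_UNIV]
      by (intro holomorphic_intros) simp_all
    show "(\<lambda>z. poly A2 z * (w z)\<^sup>2 + poly A1 z * w z + poly A0 z) holomorphic_on UNIV"
      by (intro holomorphic_intros w)
    show "\<forall>\<^sub>\<approx>z\<in>UNIV. poly q z * w z * (w (z + 1) - w (z - 1)) + poly A z * deriv w z =
               poly A2 z * (w z)\<^sup>2 + poly A1 z * w z + poly A0 z"
      using equation qnz entire_eventually_nonzero[OF w w0]
    proof eventually_elim
      case (elim z)
      have clear: "Q * W * \<Delta> + (Q * c) * d = Q * X"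
        if "\<Delta> + c * (d / W) = X / W" "W \<noteq> 0" for Q W \<Delta> c d X :: complex
      proof -
        have "X = W * (\<Delta> + c * (d / W))" using that by simp
        also have "\<dots> = W * \<Delta> + c * d" using that(2) by (simp add: distrib_left)
        finally show ?thesis by (simp only: distrib_left mult.assoc)
      qed
      have "poly q z * w z * (w (z + 1) - w (z - 1)) + (poly q z * a z) * deriv w z =
            poly q z * (a2 z * w z ^ 2 + a1 z * w z + a0 z)"
        by (rule clear[OF elim(1,3)])
      also have "\<dots> = (poly q z * a2 z) * (w z)\<^sup>2 + (poly q z * a1 z) * w z + poly q z * a0 z"
        by (simp add: distrib_left mult.assoc)
      finally have "poly q z * w z * (w (z + 1) - w (z - 1)) + (poly q z * a z) * deriv w z = \<dots>" .
      moreover have "poly q z * a z = poly A z" "poly q z * a2 z = poly A2 z"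
          "poly q z * a1 z = poly A1 z" "poly q z * a0 z = poly A0 z"
        using coeff elim(2) by simp_all
      ultimately show ?case by (simp only:)
    qed
  qed
  then interpret difference_equation q A A2 A1 A0 w
    using w \<open>A0 \<noteq> 0\<close> nonconst by unfold_locales
  show ?thesis
  proof (intro conjI allI impI)
    show "nev_order w \<ge> 1"
    proof (rule ccontr)
      assume "\<not> nev_order w \<ge> 1"
      hence "nev_order w < 1" by simp
      then obtain \<beta> where "\<beta> < 1" "\<forall>\<^sub>F r in at_top. proximity r w \<le> r powr \<beta>"
        by (rule proximity_le_powr[OF w tr])
      thus False using growth_lower_bound[OF tr q] by blast
    qed
    fix b assume b: "\<not> (\<forall>\<^sub>\<approx>z\<in>UNIV. a2 z * b ^ 2 + a1 z * b + a0 z = 0)"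
    obtain c where c: "c < 1" "\<forall>\<^sub>F r in at_top. proximity r w \<le> exp (r powr c)"
      by (rule proximity_le_exp_powr[OF w tr \<open>hyper_order w < 1\<close>])
    show "nev_Theta b w = 0"
      by (rule nev_Theta_eq_0[OF w tr]) (rule frequently_nev_Nbar_ge[OF tr c(2,1) B[OF b]])
  qed
qed

end
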